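(* The problems $\textsc{Ccv}$, $\textsc{3vLfmm}$ and $\textsc{vLfmm}$ are equivalent under $\mathsf{AC}^0$ many-one reductions.
   Context: $\textsc{Ccv}$: given a comparator circuit (wires and a sequence of comparator gates, each mapping the values $(p,q)$ of two wires to $(p\wedge q,p\vee q)$), a Boolean input value for each wire and a designated wire, decide whether that wire outputs $1$. For a bipartite graph $G=(V,W,E)$ with bottom nodes $V=\{v_0,\dots,v_{m-1}\}$ and top nodes $W=\{w_0,\dots,w_{n-1}\}$, the lexicographically first maximal matching (lfm-matching) is obtained by processing $v_0,\dots,v_{m-1}$ in order and matching each to the least-indexed adjacent top node not yet matched (if any). $\textsc{vLfmm}$: given $G$ and a designated top node, decide whether it is matched in the lfm-matching. $\textsc{3vLfmm}$ is the restriction of $\textsc{vLfmm}$ to graphs of maximum degree at most three. $A$ is $\mathsf{AC}^0$ many-one reducible to $B$ if there is a uniform $\mathsf{AC}^0$ computable function $F$ with $A(X)\leftrightarrow B(F(X))$. *)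

theory Defs
  imports Main
begin

section \<open>Comparator circuits\<close>

text \<open>The gate \<open>(i, j)\<close> writes the conjunction to wire \<open>i\<close> and the disjunction to wire \<open>j\<close>.\<close>

definition comparator_circuit :: "nat \<Rightarrow> (nat \<times> nat) list \<Rightarrow> bool" where
  "comparator_circuit m gs \<longleftrightarrow> (\<forall>(i, j) \<in> set gs. i < m \<and> j < m \<and> i \<noteq> j)"

fun comparator_gate :: "nat \<times> nat \<Rightarrow> (nat \<Rightarrow> bool) \<Rightarrow> (nat \<Rightarrow> bool)" where
  "comparator_gate (i, j) v = v(i := v i \<and> v j, j := v i \<or> v j)"

definition comparator_run :: "(nat \<times> nat) list \<Rightarrow> (nat \<Rightarrow> bool) \<Rightarrow> (nat \<Rightarrow> bool)" where
  "comparator_run gs v = fold comparator_gate gs v"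


section \<open>Lexicographically first maximal matchings\<close>

text \<open>A bipartite graph with bottom nodes \<open>0, \<dots>, m - 1\<close> and top nodes \<open>0, \<dots>, n - 1\<close>
  is given by \<open>m\<close>, \<open>n\<close> and its set \<open>E\<close> of edges (bottom, top).\<close>

definition bipartite_graph :: "nat \<Rightarrow> nat \<Rightarrow> (nat \<times> nat) set \<Rightarrow> bool" where
  "bipartite_graph m n E \<longleftrightarrow> E \<subseteq> {..<m} \<times> {..<n}"

definition available :: "(nat \<times> nat) set \<Rightarrow> (nat \<times> nat) set \<Rightarrow> nat \<Rightarrow> nat set" where
  "available E M i = {j. (i, j) \<in> E \<and> j \<notin> snd ` M}"

text \<open>\<open>lfm_matching E k\<close> is the matching after the bottom nodes \<open>0, \<dots>, k - 1\<close> have been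
  processed.\<close>

fun lfm_matching :: "(nat \<times> nat) set \<Rightarrow> nat \<Rightarrow> (nat \<times> nat) set" where
  "lfm_matching E 0 = {}"
| "lfm_matching E (Suc i) =
     (let M = lfm_matching E i in
      if available E M i = {} then M else insert (i, LEAST j. j \<in> available E M i) M)"

definition top_matched :: "nat \<Rightarrow> (nat \<times> nat) set \<Rightarrow> nat \<Rightarrow> bool" where
  "top_matched m E t \<longleftrightarrow> t \<in> snd ` lfm_matching E m"

definition max_degree_le :: "nat \<Rightarrow> nat \<Rightarrow> nat \<Rightarrow> (nat \<times> nat) set \<Rightarrow> bool" where
  "max_degree_le d m n E \<longleftrightarrow>
     (\<forall>i<m. card {j. (i, j) \<in> E} \<le> d) \<and> (\<forall>j<n. card {i. (i, j) \<in> E} \<le> d)"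


section \<open>The decision problems as languages\<close>

text \<open>Instances are coded by bit strings, with the sizes in unary. A wire or node is coded by
  its characteristic vector, so that all gates of a circuit have codes of equal length. Strings
  that code no instance belong to none of the languages.\<close>

definition unary :: "nat \<Rightarrow> bool list" where
  "unary k = replicate k True @ [False]"

definition char_vec :: "nat \<Rightarrow> nat \<Rightarrow> bool list" where
  "char_vec n i = map (\<lambda>j. j = i) [0..<n]"

definition ccv_code :: "nat \<Rightarrow> (nat \<times> nat) list \<Rightarrow> bool list \<Rightarrow> nat \<Rightarrow> bool list" where
  "ccv_code m gs y w =
     unary m @ y @ char_vec m w @ concat (map (\<lambda>(i, j). char_vec m i @ char_vec m j) gs)"

definition lfmm_code :: "nat \<Rightarrow> nat \<Rightarrow> (nat \<times> nat) set \<Rightarrow> nat \<Rightarrow> bool list" where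
  "lfmm_code m n E t =
     unary m @ unary n @ char_vec n t @
     concat (map (\<lambda>i. map (\<lambda>j. (i, j) \<in> E) [0..<n]) [0..<m])"

text \<open>Both codes are uniquely decodable, so membership depends on the instance only.\<close>

lemma unary_append_eq: "unary k @ xs = unary l @ ys \<longleftrightarrow> k = l \<and> xs = ys"
proof (induction k arbitrary: l)
  case 0
  show ?case by (cases l) (auto simp: unary_def)
next
  case (Suc k)
  then show ?case by (cases l) (auto simp: unary_def)
qed

lemma char_vec_eq:
  assumes "i < n" "char_vec n i = char_vec n j"
  shows "i = j"
proof -
  have "char_vec n i ! i = char_vec n j ! i" using assms(2) by simp
  then show ?thesis using assms(1) by (simp add: char_vec_def)
qed

lemma length_char_vec [simp]: "length (char_vec n i) = n"
  by (simp add: char_vec_def)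

lemma ccv_code_inject:
  assumes "ccv_code m gs y w = ccv_code m' gs' y' w'"
    and "comparator_circuit m gs" "length y = m" "w < m"
    and "comparator_circuit m' gs'" "length y' = m'" "w' < m'"
  shows "m = m' \<and> gs = gs' \<and> y = y' \<and> w = w'"
proof -
  let ?f = "\<lambda>(i, j). char_vec m i @ char_vec m j"
  have ne: "char_vec m i \<noteq> []" for i
    using assms(4) by (metis length_char_vec less_nat_zero_code list.size(3))
  have m: "m' = m" using assms(1) by (simp add: ccv_code_def unary_append_eq)
  have eq: "y = y'" "char_vec m w = char_vec m w'" "concat (map ?f gs) = concat (map ?f gs')"
    using assms(1,3,6) m by (auto simp: ccv_code_def unary_append_eq)
  have "gs = gs'"
    using eq(3) assms(2) assms(5)[unfolded m]
  proof (induction gs arbitrary: gs')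
    case Nil
    then show ?case using ne by (cases gs') auto
  next
    case (Cons a gs)
    obtain i j where a: "a = (i, j)" by fastforce
    show ?case
    proof (cases gs')
      case Nil
      then show ?thesis using Cons.prems(1) ne a by auto
    next
      case (Cons b gs'')
      obtain i' j' where b: "b = (i', j')" by fastforce
      have lt: "i < m" "j < m" using Cons.prems(2) a by (auto simp: comparator_circuit_def)
      have e: "char_vec m i = char_vec m i'" "char_vec m j = char_vec m j'"
        "concat (map ?f gs) = concat (map ?f gs'')"
        using Cons.prems(1) Cons a b by auto
      have "gs = gs''"
        using Cons.IH[OF e(3)] Cons.prems Cons by (auto simp: comparator_circuit_def)
      then show ?thesis using char_vec_eq[OF lt(1) e(1)] char_vec_eq[OF lt(2) e(2)] a b Cons by simp
    qed
  qed
  then show ?thesis using m eq char_vec_eq[OF assms(4) eq(2)] by simp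
qed

lemma lfmm_code_inject:
  assumes "lfmm_code m n E t = lfmm_code m' n' E' t'"
    and "bipartite_graph m n E" "t < n" "bipartite_graph m' n' E'" "t' < n'"
  shows "m = m' \<and> n = n' \<and> E = E' \<and> t = t'"
proof -
  let ?f = "\<lambda>E i. map (\<lambda>j. (i, j) \<in> E) [0..<n]"
  have mn: "m' = m" "n' = n" using assms(1) by (auto simp: lfmm_code_def unary_append_eq)
  have eq: "char_vec n t = char_vec n t'"
    "concat (map (?f E) [0..<m]) = concat (map (?f E') [0..<m])"
    using assms(1) mn by (auto simp: lfmm_code_def unary_append_eq)
  have rows: "\<forall>i \<in> set is. ?f E i = ?f E' i"
    if "concat (map (?f E) is) = concat (map (?f E') is)" for "is"
    using that by (induction "is") auto
  have "(i, j) \<in> E \<longleftrightarrow> (i, j) \<in> E'" if "i < m" "j < n" for i j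
    using rows[OF eq(2)] that by auto
  then have "E = E'"
    using assms(2,4) mn unfolding bipartite_graph_def by blast
  then show ?thesis using mn char_vec_eq[OF assms(3) eq(1)] by simp
qed

definition Ccv :: "bool list set" where
  "Ccv = {ccv_code m gs y w | m gs y w.
     comparator_circuit m gs \<and> length y = m \<and> w < m \<and> comparator_run gs (\<lambda>i. y ! i) w}"

definition vLfmm :: "bool list set" where
  "vLfmm = {lfmm_code m n E t | m n E t.
     bipartite_graph m n E \<and> t < n \<and> top_matched m E t}"

definition three_vLfmm :: "bool list set" where
  "three_vLfmm = {lfmm_code m n E t | m n E t.
     bipartite_graph m n E \<and> max_degree_le 3 m n E \<and> t < n \<and> top_matched m E t}"


section \<open>Bounded formulas of arithmetic\<close>

text \<open>First-order formulas over the natural numbers with \<open>+\<close> and \<open>\<times>\<close>, all quantifiers being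
  bounded by terms. Variables are de Bruijn indices. On arguments that are polynomial in
  \<open>n\<close> these formulas define the predicates of FO(BIT) over the universe of size \<open>n\<close>.\<close>

datatype arith_term =
    Var nat | Zero | One | Plus arith_term arith_term | Times arith_term arith_term

datatype bounded_formula =
    Eq arith_term arith_term
  | Le arith_term arith_term
  | Neg bounded_formula
  | Conj bounded_formula bounded_formula
  | BEx arith_term bounded_formula

primrec term_val :: "nat list \<Rightarrow> arith_term \<Rightarrow> nat" where
  "term_val e (Var i) = (if i < length e then e ! i else 0)"
| "term_val e Zero = 0"
| "term_val e One = 1"
| "term_val e (Plus s t) = term_val e s + term_val e t"
| "term_val e (Times s t) = term_val e s * term_val e t"

primrec sat :: "nat list \<Rightarrow> bounded_formula \<Rightarrow> bool" where
  "sat e (Eq s t) \<longleftrightarrow> term_val e s = term_val e t"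
| "sat e (Le s t) \<longleftrightarrow> term_val e s \<le> term_val e t"
| "sat e (Neg p) \<longleftrightarrow> \<not> sat e p"
| "sat e (Conj p q) \<longleftrightarrow> sat e p \<and> sat e q"
| "sat e (BEx t p) \<longleftrightarrow> (\<exists>a \<le> term_val e t. sat (a # e) p)"


section \<open>Uniform constant-depth circuits\<close>

datatype gate_kind = Input nat | NotGate | AndGate | OrGate

text \<open>The gates are \<open>0, \<dots>, ngates - 1\<close>; a wire \<open>(g, h)\<close> says that gate \<open>g\<close> reads
  gate \<open>h\<close>. Fan-in is unbounded; conjunction and disjunction
  gates without wires are the constants.\<close>

record circuit =
  ngates :: nat
  kind :: "nat \<Rightarrow> gate_kind"
  wires :: "(nat \<times> nat) set"
  outs :: "nat list"

definition wf_circuit :: "nat \<Rightarrow> circuit \<Rightarrow> bool" where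
  "wf_circuit n C \<longleftrightarrow>
     wires C \<subseteq> {..<ngates C} \<times> {..<ngates C} \<and>
     set (outs C) \<subseteq> {..<ngates C} \<and>
     (\<forall>g<ngates C. \<forall>j. kind C g = Input j \<longrightarrow> j < n \<and> wires C `` {g} = {}) \<and>
     (\<forall>g<ngates C. kind C g = NotGate \<longrightarrow> (\<exists>h. wires C `` {g} = {h}))"

definition depth_le :: "nat \<Rightarrow> circuit \<Rightarrow> bool" where
  "depth_le d C \<longleftrightarrow> wires C ^^ Suc d = {}"

text \<open>A circuit of finite depth has exactly one such assignment of values to its gates.\<close>

definition gate_values :: "circuit \<Rightarrow> bool list \<Rightarrow> (nat \<Rightarrow> bool) \<Rightarrow> bool" where
  "gate_values C x v \<longleftrightarrow>
     (\<forall>g<ngates C. v g \<longleftrightarrow>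
       (case kind C g of
          Input j \<Rightarrow> x ! j
        | NotGate \<Rightarrow> (\<forall>h \<in> wires C `` {g}. \<not> v h)
        | AndGate \<Rightarrow> (\<forall>h \<in> wires C `` {g}. v h)
        | OrGate \<Rightarrow> (\<exists>h \<in> wires C `` {g}. v h)))"

lemma gate_values_unique:
  assumes wf: "wf_circuit n C" and d: "depth_le d C"
    and v: "gate_values C x v" and v': "gate_values C x v'" and g: "g < ngates C"
  shows "v g = v' g"
proof (rule ccontr)
  assume neq: "v g \<noteq> v' g"
  have step: "\<exists>h. (a, h) \<in> wires C \<and> h < ngates C \<and> v h \<noteq> v' h"
    if a: "a < ngates C" "v a \<noteq> v' a" for a
  proof (rule ccontr)
    assume "\<not> ?thesis"
    then have "\<forall>h \<in> wires C `` {a}. v h = v' h"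
      using wf unfolding wf_circuit_def by blast
    then have "v a = v' a"
      using v v' a(1) unfolding gate_values_def by (cases "kind C a") auto
    with a(2) show False by simp
  qed
  have "\<exists>h. (g, h) \<in> wires C ^^ k \<and> h < ngates C \<and> v h \<noteq> v' h" for k
  proof (induction k)
    case 0
    show ?case using g neq by auto
  next
    case (Suc k)
    then show ?case using step by (meson relpow_Suc_I)
  qed
  from this[of "Suc d"] d show False unfolding depth_le_def by auto
qed

text \<open>Uniformity: the direct connection language of the family is first-order definable.\<close>

definition uniform_family :: "(nat \<Rightarrow> circuit) \<Rightarrow> bool" where
  "uniform_family C \<longleftrightarrow>
     (\<exists>p. \<forall>n g j. sat [n, g, j] p \<longleftrightarrow> g < ngates (C n) \<and> kind (C n) g = Input j) \<and>
     (\<exists>p. \<forall>n g. sat [n, g] p \<longleftrightarrow> g < ngates (C n) \<and> kind (C n) g = NotGate) \<and>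
     (\<exists>p. \<forall>n g. sat [n, g] p \<longleftrightarrow> g < ngates (C n) \<and> kind (C n) g = AndGate) \<and>
     (\<exists>p. \<forall>n g. sat [n, g] p \<longleftrightarrow> g < ngates (C n) \<and> kind (C n) g = OrGate) \<and>
     (\<exists>p. \<forall>n g h. sat [n, g, h] p \<longleftrightarrow> (g, h) \<in> wires (C n)) \<and>
     (\<exists>p. \<forall>n i g. sat [n, i, g] p \<longleftrightarrow> i < length (outs (C n)) \<and> outs (C n) ! i = g)"

definition uniform_AC0_family :: "(nat \<Rightarrow> circuit) \<Rightarrow> bool" where
  "uniform_AC0_family C \<longleftrightarrow>
     (\<forall>n. wf_circuit n (C n)) \<and>
     (\<exists>c. \<forall>n. ngates (C n) \<le> n ^ c + c \<and> length (outs (C n)) \<le> n ^ c + c) \<and>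
     (\<exists>d. \<forall>n. depth_le d (C n)) \<and>
     uniform_family C"

text \<open>The length of \<open>F x\<close> may depend on \<open>x\<close> and not just on the length of \<open>x\<close>. The output gates
  therefore come in pairs, the \<open>i\<close>-th pair being \<open>(1, b)\<close> if \<open>b\<close> is the \<open>i\<close>-th bit of
  \<open>F x\<close>, and \<open>(0, 0)\<close> if \<open>F x\<close> has no \<open>i\<close>-th bit.\<close>

definition uniform_AC0_computable :: "(bool list \<Rightarrow> bool list) \<Rightarrow> bool" where
  "uniform_AC0_computable F \<longleftrightarrow>
     (\<exists>C. uniform_AC0_family C \<and>
       (\<forall>x. \<exists>v k. gate_values (C (length x)) x v \<and>
          map v (outs (C (length x))) =
            concat (map (\<lambda>b. [True, b]) (F x)) @ replicate (2 * k) False))"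

definition AC0_reducible :: "bool list set \<Rightarrow> bool list set \<Rightarrow> bool" (infix "\<le>\<^sub>A\<^sub>C\<^sub>0" 50) where
  "A \<le>\<^sub>A\<^sub>C\<^sub>0 B \<longleftrightarrow> (\<exists>F. uniform_AC0_computable F \<and> (\<forall>x. x \<in> A \<longleftrightarrow> F x \<in> B))"

definition AC0_equivalent :: "bool list set \<Rightarrow> bool list set \<Rightarrow> bool" (infix "\<equiv>\<^sub>A\<^sub>C\<^sub>0" 50) where
  "A \<equiv>\<^sub>A\<^sub>C\<^sub>0 B \<longleftrightarrow> A \<le>\<^sub>A\<^sub>C\<^sub>0 B \<and> B \<le>\<^sub>A\<^sub>C\<^sub>0 A"

end

theory Submission
  imports Defs "HOL-Library.Nat_Bijection"
begin

text \<open>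
  A predicate on bit strings that is first-order definable, with bounded quantifiers over the
  positions and with arithmetic, is brought into layered form: gates numbered by codes of variable
  assignments, each a disjunction of possibly negated gates of the next layer, with the wires
  definable in bounded arithmetic. This is a uniform circuit family of constant depth, so that
  functions with first-order definable bits are AC0 computable. Such functions compose by
  substituting formulas, and three reductions forming a cycle suffice.

  \<^item> 3vLfmm to vLfmm is the identity on graphs of degree at most three.
  \<^item> vLfmm to Ccv: a comparator gate from the wire of a bottom node (true while it is unmatched) to
    the wire of a top node (true once it is matched) performs one step of the greedy algorithm.
  \<^item> Ccv to 3vLfmm: a top node is matched if a wire carries 1. The bottom node of a wire takes the
    top node of the present layer when the value is 0 and is otherwise passed on to the next layer;
    behind a gate, the first of the two bottom nodes that are passed on takes the disjunction and
    the second one the conjunction.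
\<close>

section \<open>Definability in bounded arithmetic\<close>

text \<open>Uniformity shapes the proof: one bounded formula, the same for all input lengths, has to
  recognise every wire. A code of an assignment determines its gate by arithmetic alone, and the
  graph of the Cantor pairing behind these codes is a polynomial equation. Definability is treated
  on HOL predicates (\<open>delta0\<close>, \<open>fo\<close>) that are closed under the
  connectives, so it is established by introduction rules and hardly any formula is written out.
  Sizes are measured by powers of the input length plus 2: the base is at least 2 even for the empty
  input, so that a further factor absorbs a doubling. Reductions are composed as formulas rather
  than as circuits, because the output of a circuit is spread over pairs of gates with padding,
  while a formula about \<open>F x\<close> only needs the length and the bits of \<open>F x\<close>
  to be definable.\<close>

definition var :: "nat \<Rightarrow> nat list \<Rightarrow> nat" where
  "var i e = (if i < length e then e ! i else 0)"

lemma var_Cons [simp]: "var 0 (a # e) = a" "var (Suc i) (a # e) = var i e"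
  by (simp_all add: var_def)

lemma var_Cons_numeral [simp]: "var 1 (a # e) = var 0 e" "var (numeral k) (a # e) = var (pred_numeral k) e"
  by (simp_all add: var_def numeral_eq_Suc)

lemma var_Nil [simp]: "var i [] = 0"
  by (simp add: var_def)

lemma var_tl: "var i (tl e) = var (Suc i) e"
  by (cases e) (simp_all add: var_def)

lemma var_drop: "var i (drop k e) = var (k + i) e"
  by (auto simp: var_def)

lemma var_append: "var i (e @ e') = (if i < length e then var i e else var (i - length e) e')"
  by (auto simp: var_def nth_append)

definition term_fun :: "(nat list \<Rightarrow> nat) \<Rightarrow> bool" where
  "term_fun f \<longleftrightarrow> (\<exists>t. \<forall>e. term_val e t = f e)"

definition delta0 :: "(nat list \<Rightarrow> bool) \<Rightarrow> bool" where
  "delta0 P \<longleftrightarrow> (\<exists>p. \<forall>e. sat e p = P e)"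

text \<open>Under nested binders the closure rules produce environments such as
  \<open>tl (tl e)\<close>. Collecting these forms lets \<open>term_fun_var\<close> treat a variable
  at every binding depth.\<close>

definition drops :: "(nat list \<Rightarrow> nat list) \<Rightarrow> bool" where
  "drops g \<longleftrightarrow> (\<exists>k. \<forall>e. g e = drop k e)"

lemma drops_id: "drops (\<lambda>e. e)"
  unfolding drops_def by (rule exI[of _ 0]) simp

lemma drops_tl: "drops g \<Longrightarrow> drops (\<lambda>e. tl (g e))"
  unfolding drops_def by (metis drop_Suc tl_drop)

lemma term_fun_var: "drops g \<Longrightarrow> term_fun (\<lambda>e. var i (g e))"
  unfolding drops_def term_fun_def
proof (elim exE)
  fix k assume "\<forall>e. g e = drop k e"
  then have "\<forall>e. term_val e (Var (k + i)) = var i (g e)"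
    by (auto simp: var_drop) (auto simp: var_def)
  then show "\<exists>t. \<forall>e. term_val e t = var i (g e)" by blast
qed

lemma term_fun_Plus: "term_fun f \<Longrightarrow> term_fun g \<Longrightarrow> term_fun (\<lambda>e. f e + g e)"
  unfolding term_fun_def by (metis term_val.simps(4))

lemma term_fun_Times: "term_fun f \<Longrightarrow> term_fun g \<Longrightarrow> term_fun (\<lambda>e. f e * g e)"
  unfolding term_fun_def by (metis term_val.simps(5))

lemma term_fun_const: "term_fun (\<lambda>e. k)"
proof (induction k)
  case 0
  show ?case unfolding term_fun_def by (metis term_val.simps(2))
next
  case (Suc k)
  have "term_fun (\<lambda>e. 1)" unfolding term_fun_def by (metis term_val.simps(3))
  from term_fun_Plus[OF Suc this] show ?case by simp
qed

lemma term_fun_Suc: "term_fun f \<Longrightarrow> term_fun (\<lambda>e. Suc (f e))"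
  using term_fun_Plus[OF _ term_fun_const[of 1]] by simp

lemma term_fun_power: "term_fun f \<Longrightarrow> term_fun (\<lambda>e. f e ^ c)"
  by (induction c) (simp_all add: term_fun_const term_fun_Times)

lemma delta0_le: "term_fun f \<Longrightarrow> term_fun g \<Longrightarrow> delta0 (\<lambda>e. f e \<le> g e)"
  unfolding term_fun_def delta0_def by (metis sat.simps(2))

lemma delta0_eq: "term_fun f \<Longrightarrow> term_fun g \<Longrightarrow> delta0 (\<lambda>e. f e = g e)"
  unfolding term_fun_def delta0_def by (metis sat.simps(1))

lemma delta0_not: "delta0 P \<Longrightarrow> delta0 (\<lambda>e. \<not> P e)"
  unfolding delta0_def by (metis sat.simps(3))

lemma delta0_and: "delta0 P \<Longrightarrow> delta0 Q \<Longrightarrow> delta0 (\<lambda>e. P e \<and> Q e)"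
  unfolding delta0_def by (metis sat.simps(4))

lemma delta0_less: "term_fun f \<Longrightarrow> term_fun g \<Longrightarrow> delta0 (\<lambda>e. f e < g e)"
  using delta0_le[OF term_fun_Suc] by (simp add: Suc_le_eq)

lemma delta0_or: "delta0 P \<Longrightarrow> delta0 Q \<Longrightarrow> delta0 (\<lambda>e. P e \<or> Q e)"
  using delta0_not[OF delta0_and[OF delta0_not delta0_not]] by simp

text \<open>Formulas have no truth constants, so a Boolean fixed in the metalogic becomes an
  equation of two numerals. It arises where the sign or the depth of a gate is already
  fixed.\<close>

lemma delta0_const: "delta0 (\<lambda>e. b)"
proof -
  have "delta0 (\<lambda>e. (0::nat) = (if b then 0 else 1))"
    by (intro delta0_eq term_fun_const)
  then show ?thesis by (cases b) simp_all
qed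

text \<open>The bound variable is a separate argument of \<open>Q\<close>, so that the rule matches
  a quantified HOL predicate by higher-order unification. The second premise puts it back at index 0
  of the environment.\<close>

lemma delta0_ex:
  assumes "term_fun f" and "delta0 (\<lambda>e. Q (var 0 e) (tl e))"
  shows "delta0 (\<lambda>e. \<exists>a\<le>f e. Q a e)"
proof -
  obtain t p where t: "\<And>e. term_val e t = f e" and p: "\<And>e. sat e p = Q (var 0 e) (tl e)"
    using assms unfolding term_fun_def delta0_def by blast
  have "sat e (BEx t p) = (\<exists>a\<le>f e. Q a e)" for e
    by (simp add: t p)
  then show ?thesis unfolding delta0_def by blast
qed

section \<open>Substitution of terms for variables\<close>

primrec tsubst :: "(nat \<Rightarrow> arith_term) \<Rightarrow> arith_term \<Rightarrow> arith_term" where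
  "tsubst \<sigma> (Var i) = \<sigma> i"
| "tsubst \<sigma> Zero = Zero"
| "tsubst \<sigma> One = One"
| "tsubst \<sigma> (Plus s t) = Plus (tsubst \<sigma> s) (tsubst \<sigma> t)"
| "tsubst \<sigma> (Times s t) = Times (tsubst \<sigma> s) (tsubst \<sigma> t)"

lemma term_val_tsubst:
  "(\<And>i. term_val e (\<sigma> i) = var i e') \<Longrightarrow> term_val e (tsubst \<sigma> t) = term_val e' t"
  by (induction t) (simp_all add: var_def)

primrec fsubst :: "(nat \<Rightarrow> arith_term) \<Rightarrow> bounded_formula \<Rightarrow> bounded_formula" where
  "fsubst \<sigma> (Eq s t) = Eq (tsubst \<sigma> s) (tsubst \<sigma> t)"
| "fsubst \<sigma> (Le s t) = Le (tsubst \<sigma> s) (tsubst \<sigma> t)"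
| "fsubst \<sigma> (Neg p) = Neg (fsubst \<sigma> p)"
| "fsubst \<sigma> (Conj p q) = Conj (fsubst \<sigma> p) (fsubst \<sigma> q)"
| "fsubst \<sigma> (BEx t p) =
     BEx (tsubst \<sigma> t) (fsubst (case_nat (Var 0) (\<lambda>i. tsubst (\<lambda>j. Var (Suc j)) (\<sigma> i))) p)"

lemma sat_fsubst:
  "(\<And>i. term_val e (\<sigma> i) = var i e') \<Longrightarrow> sat e (fsubst \<sigma> p) = sat e' p"
proof (induction p arbitrary: \<sigma> e e')
  case (BEx t p)
  let ?\<sigma> = "case_nat (Var 0) (\<lambda>i. tsubst (\<lambda>j. Var (Suc j)) (\<sigma> i))"
  have "term_val (a # e) (?\<sigma> i) = var i (a # e')" for a i
  proof (cases i)
    case (Suc j)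
    have "term_val (a # e) (tsubst (\<lambda>j. Var (Suc j)) (\<sigma> j)) = term_val e (\<sigma> j)"
      by (rule term_val_tsubst) (simp add: var_def)
    then show ?thesis using BEx.prems Suc by simp
  qed simp
  then have "sat (a # e) (fsubst ?\<sigma> p) = sat (a # e') p" for a
    by (rule BEx.IH)
  moreover have "term_val e (tsubst \<sigma> t) = term_val e' t"
    by (rule term_val_tsubst) (rule BEx.prems)
  ultimately show ?case by simp
qed (simp_all add: term_val_tsubst)

lemma term_fun_subst:
  assumes "term_fun f" and "\<And>i. term_fun (\<lambda>e. var i (g e))"
  shows "term_fun (\<lambda>e. f (g e))"
proof -
  obtain t where t: "\<And>e. term_val e t = f e" using assms(1) unfolding term_fun_def by blast
  obtain \<sigma> where "\<And>i e. term_val e (\<sigma> i) = var i (g e)"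
    using assms(2) unfolding term_fun_def by metis
  then have "term_val e (tsubst \<sigma> t) = f (g e)" for e
    by (simp add: term_val_tsubst[where e' = "g e"] t)
  then show ?thesis unfolding term_fun_def by blast
qed

text \<open>Substitution in semantic form: \<open>g e\<close> may be any environment whose entries
  are terms over \<open>e\<close>, so that variables can be permuted, dropped or replaced at
  once.\<close>

lemma delta0_subst:
  assumes "delta0 P" and "\<And>i. term_fun (\<lambda>e. var i (g e))"
  shows "delta0 (\<lambda>e. P (g e))"
proof -
  obtain p where p: "\<And>e. sat e p = P e" using assms(1) unfolding delta0_def by blast
  obtain \<sigma> where "\<And>i e. term_val e (\<sigma> i) = var i (g e)"
    using assms(2) unfolding term_fun_def by metis
  then have "sat e (fsubst \<sigma> p) = P (g e)" for e
    by (simp add: sat_fsubst[where e' = "g e"] p)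
  then show ?thesis unfolding delta0_def by blast
qed

lemma term_fun_tl: "term_fun f \<Longrightarrow> term_fun (\<lambda>e. f (tl e))"
  by (erule term_fun_subst) (intro term_fun_var drops_tl drops_id)

lemma term_fun_Cons: "term_fun f \<Longrightarrow> (\<And>i. term_fun (\<lambda>e. var i (g e))) \<Longrightarrow> term_fun (\<lambda>e. var i (f e # g e))"
  by (cases i) simp_all

lemma term_fun_Nil: "term_fun (\<lambda>e. var i [])"
  by (simp add: term_fun_const)

lemma delta0_ex_less:
  assumes "term_fun f" and "delta0 (\<lambda>e. Q (var 0 e) (tl e))"
  shows "delta0 (\<lambda>e. \<exists>a<f e. Q a e)"
proof -
  have "delta0 (\<lambda>e. \<exists>a\<le>f e. a < f e \<and> Q a e)"
    by (intro delta0_ex assms delta0_and delta0_less term_fun_var drops_id term_fun_tl)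
  moreover have "(\<exists>a\<le>n. a < n \<and> R a) \<longleftrightarrow> (\<exists>a<n. R a)" for n :: nat and R
    by (meson less_imp_le)
  ultimately show ?thesis by simp
qed

text \<open>A finite set fixed in the metalogic turns into a finite disjunction. This serves
  quantification over layers and signs, whose number does not grow with the input.\<close>

lemma delta0_Bex_finite:
  assumes "finite A" "\<And>k. k \<in> A \<Longrightarrow> delta0 (P k)"
  shows "delta0 (\<lambda>e. \<exists>k\<in>A. P k e)"
  using assms by (induction A) (simp_all add: delta0_const delta0_or)

lemma delta0_app3:
  assumes "delta0 (\<lambda>e. R (var 0 e) (var 1 e) (var 2 e))" "term_fun f" "term_fun g" "term_fun h"
  shows "delta0 (\<lambda>e. R (f e) (g e) (h e))"
proof -
  have "term_fun (\<lambda>e. var i [f e, g e, h e])" for i by (intro term_fun_Cons term_fun_Nil assms)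
  from delta0_subst[OF assms(1) this] show ?thesis by simp
qed

lemmas term_fun_intros = term_fun_var drops_id drops_tl term_fun_Plus term_fun_Times term_fun_Suc term_fun_power term_fun_Cons term_fun_Nil term_fun_const
lemmas delta0_intros = delta0_le delta0_eq delta0_less delta0_not delta0_and delta0_or delta0_ex delta0_ex_less term_fun_intros

section \<open>Layered families of gates\<close>

text \<open>A layer \<open>G n a b s\<close> makes gate \<open>a\<close> a disjunction that reads gate \<open>b\<close> of the next layer,
  positively if \<open>s\<close> holds and negated otherwise; \<open>n\<close> is the input length. Below the last layer
  there are the input bits.\<close>

type_synonym layer = "nat \<Rightarrow> nat \<Rightarrow> nat \<Rightarrow> bool \<Rightarrow> bool"

primrec layers_val :: "layer list \<Rightarrow> bool list \<Rightarrow> nat \<Rightarrow> bool" where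
  "layers_val [] x a \<longleftrightarrow> a < length x \<and> x ! a"
| "layers_val (G # Gs) x a \<longleftrightarrow> (\<exists>b s. G (length x) a b s \<and> layers_val Gs x b = s)"

definition good_layer :: "layer \<Rightarrow> bool" where
  "good_layer G \<longleftrightarrow>
     (\<forall>s. delta0 (\<lambda>e. G (var 0 e) (var 1 e) (var 2 e) s)) \<and>
     (\<exists>c. \<forall>n a b s. G n a b s \<longrightarrow> b < (n + 2) ^ c)"

lemma good_layerI:
  assumes "delta0 (\<lambda>e. G (var 0 e) (var 1 e) (var 2 e) True)" "delta0 (\<lambda>e. G (var 0 e) (var 1 e) (var 2 e) False)"
    and "\<And>n a b s. G n a b s \<Longrightarrow> b < (n + 2) ^ c"
  shows "good_layer G"
  unfolding good_layer_def using assms by (metis (full_types))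

text \<open>The layers may depend on the exponent \<open>k\<close> because a quantifier reads gates
  with larger numbers than its own. Beyond the range of \<open>k\<close> they may compute
  anything.\<close>

definition layered :: "(bool list \<Rightarrow> nat \<Rightarrow> bool) \<Rightarrow> bool" where
  "layered P \<longleftrightarrow> (\<forall>k. \<exists>Gs. list_all good_layer Gs \<and>
     (\<forall>x a. a < (length x + 2) ^ k \<longrightarrow> layers_val Gs x a = P x a))"

lemma layered_arith:
  assumes "delta0 (\<lambda>e. R (var 0 e) (var 1 e))"
  shows "layered (\<lambda>x. R (length x))"
  unfolding layered_def
proof
  fix k
  \<comment> \<open>Position \<open>n\<close> lies just past the input and has the value false.
    Reading it negated makes gate \<open>a\<close> true exactly if \<open>R n a\<close>
    holds.\<close>
  let ?G = "\<lambda>n a b s. \<not> s \<and> b = n \<and> R n a"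
  have "good_layer ?G"
    by (rule good_layerI[where c = 1]) (intro delta0_intros delta0_const assms, intro delta0_intros delta0_const assms, auto)
  then show "\<exists>Gs. list_all good_layer Gs \<and>
      (\<forall>x a. a < (length x + 2) ^ k \<longrightarrow> layers_val Gs x a = R (length x) a)"
    by (intro exI[of _ "[?G]"]) auto
qed

lemma layered_bit:
  assumes "delta0 (\<lambda>e. R (var 0 e) (var 1 e) (var 2 e))"
  shows "layered (\<lambda>x a. \<exists>b. R (length x) a b \<and> b < length x \<and> x ! b)"
  unfolding layered_def
proof
  fix k
  let ?G = "\<lambda>n a b s. s \<and> b < n \<and> R n a b"
  have "good_layer ?G"
    by (rule good_layerI[where c = 1]) (intro delta0_intros delta0_const assms, intro delta0_intros delta0_const assms, auto)
  then show "\<exists>Gs. list_all good_layer Gs \<and>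
      (\<forall>x a. a < (length x + 2) ^ k \<longrightarrow>
        layers_val Gs x a = (\<exists>b. R (length x) a b \<and> b < length x \<and> x ! b))"
    by (intro exI[of _ "[?G]"]) auto
qed

lemma layered_not:
  assumes "layered P"
  shows "layered (\<lambda>x a. \<not> P x a)"
  unfolding layered_def
proof
  fix k
  obtain Gs where Gs: "list_all good_layer Gs"
    "\<And>x a. a < (length x + 2) ^ k \<Longrightarrow> layers_val Gs x a = P x a"
    using assms unfolding layered_def by metis
  let ?G = "\<lambda>n a b s. \<not> s \<and> a = b \<and> b < (n + 2) ^ k"
  have "good_layer ?G"
    by (rule good_layerI[where c = k]) (intro delta0_intros delta0_const, intro delta0_intros delta0_const, blast)
  then show "\<exists>Gs. list_all good_layer Gs \<and>
      (\<forall>x a. a < (length x + 2) ^ k \<longrightarrow> layers_val Gs x a = (\<not> P x a))"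
    using Gs by (intro exI[of _ "?G # Gs"]) auto
qed

text \<open>Unbounded fan-in makes the disjunction over \<open>b\<close> a single layer. By
  \<open>bound\<close> the numbers of the gates it reads stay polynomial, so the layers for
  \<open>P\<close> can be chosen for the exponent \<open>l\<close>.\<close>

lemma layered_ex:
  assumes "layered P" and "delta0 (\<lambda>e. R (var 0 e) (var 1 e) (var 2 e))"
    and bound: "\<And>k. \<exists>l. \<forall>n a b. a < (n + 2) ^ k \<longrightarrow> R n a b \<longrightarrow> b < (n + 2) ^ l"
  shows "layered (\<lambda>x a. \<exists>b. R (length x) a b \<and> P x b)"
  unfolding layered_def
proof
  fix k
  obtain l where l: "\<And>n a b. a < (n + 2) ^ k \<Longrightarrow> R n a b \<Longrightarrow> b < (n + 2) ^ l"
    using bound by metis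
  obtain Gs where Gs: "list_all good_layer Gs"
    "\<And>x a. a < (length x + 2) ^ l \<Longrightarrow> layers_val Gs x a = P x a"
    using assms(1) unfolding layered_def by metis
  let ?G = "\<lambda>n a b s. s \<and> a < (n + 2) ^ k \<and> R n a b"
  have "good_layer ?G"
    by (rule good_layerI[where c = l]) (intro delta0_intros delta0_const assms, intro delta0_intros delta0_const assms, use l in blast)
  then show "\<exists>Gs. list_all good_layer Gs \<and>
      (\<forall>x a. a < (length x + 2) ^ k \<longrightarrow>
        layers_val Gs x a = (\<exists>b. R (length x) a b \<and> P x b))"
  proof (intro exI[of _ "?G # Gs"] conjI allI impI)
    fix x :: "bool list" and a assume a: "a < (length x + 2) ^ k"
    have "layers_val Gs x b = P x b" if "R (length x) a b" for b
      using Gs(2)[OF l[OF a that]] .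
    then show "layers_val (?G # Gs) x a = (\<exists>b. R (length x) a b \<and> P x b)"
      using a by auto
  qed (simp add: Gs(1))
qed

text \<open>Padding for families of different depth. It is appended below a family, where nothing
  but input bits has to be passed on.\<close>

definition id_layer :: layer where
  "id_layer n a b s \<longleftrightarrow> s \<and> a = b \<and> b < n"

lemma good_id_layer: "good_layer id_layer"
  unfolding id_layer_def
  by (rule good_layerI[where c = 1]) (intro delta0_intros delta0_const, intro delta0_intros delta0_const, simp)

lemma layers_val_pad: "layers_val (Gs @ replicate d id_layer) x a = layers_val Gs x a"
proof (induction Gs arbitrary: a)
  case Nil
  show ?case
    by (induction d arbitrary: a) (auto simp: id_layer_def)
qed simp

text \<open>Two families are run in parallel on the even and on the odd gate numbers.\<close>

definition merge_layer :: "layer \<Rightarrow> layer \<Rightarrow> layer" where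
  "merge_layer G H n a b s \<longleftrightarrow>
     (\<exists>a' b'. a = 2 * a' \<and> b = 2 * b' \<and> G n a' b' s) \<or>
     (\<exists>a' b'. a = Suc (2 * a') \<and> b = Suc (2 * b') \<and> H n a' b' s)"

text \<open>Below the two parallel families, both copies of position \<open>b\<close> lead back to
  the same input bit.\<close>

definition unmerge_layer :: layer where
  "unmerge_layer n a b s \<longleftrightarrow> s \<and> b < n \<and> (a = 2 * b \<or> a = Suc (2 * b))"

lemma merge_layer_even: "merge_layer G H n (2 * a) b s \<longleftrightarrow> (\<exists>b'. b = 2 * b' \<and> G n a b' s)"
  and merge_layer_odd:
    "merge_layer G H n (Suc (2 * a)) b s \<longleftrightarrow> (\<exists>b'. b = Suc (2 * b') \<and> H n a b' s)"
  unfolding merge_layer_def by (auto, presburger+)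

lemma good_unmerge_layer: "good_layer unmerge_layer"
  unfolding unmerge_layer_def
  by (rule good_layerI[where c = 1]) (intro delta0_intros delta0_const, intro delta0_intros delta0_const, simp)

lemma good_merge_layer:
  assumes "good_layer G" "good_layer H"
  shows "good_layer (merge_layer G H)"
proof -
  obtain c where c: "\<And>n a b s. G n a b s \<Longrightarrow> b < (n + 2) ^ c"
    using assms(1) unfolding good_layer_def by blast
  obtain d where d: "\<And>n a b s. H n a b s \<Longrightarrow> b < (n + 2) ^ d"
    using assms(2) unfolding good_layer_def by blast
  have G: "delta0 (\<lambda>e. G (var 0 e) (var 1 e) (var 2 e) s)" and H: "delta0 (\<lambda>e. H (var 0 e) (var 1 e) (var 2 e) s)" for s
    using assms unfolding good_layer_def by blast+
  \<comment> \<open>The halves are at most the gate numbers they come from, which makes the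
    quantifiers bounded.\<close>
  have eq: "merge_layer G H n a b s \<longleftrightarrow>
     (\<exists>a'\<le>a. \<exists>b'\<le>b. a = 2 * a' \<and> b = 2 * b' \<and> G n a' b' s) \<or>
     (\<exists>a'\<le>a. \<exists>b'\<le>b. a = Suc (2 * a') \<and> b = Suc (2 * b') \<and> H n a' b' s)" for n a b s
  proof -
    have le: "a = 2 * a' \<Longrightarrow> a' \<le> a" "a = Suc (2 * a') \<Longrightarrow> a' \<le> a" for a a' :: nat by simp_all
    show ?thesis unfolding merge_layer_def by (blast intro: le)
  qed
  have *: "delta0 (\<lambda>e. merge_layer G H (var 0 e) (var 1 e) (var 2 e) s)" for s
    unfolding eq
    by (intro delta0_intros delta0_app3[OF G[of s]] delta0_app3[OF H[of s]])
  \<comment> \<open>The exponent \<open>c + d\<close> covers both families, and one more factor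
    \<open>n + 2\<close> absorbs the doubling of gate numbers.\<close>
  have "b < (n + 2) ^ (c + d + 1)" if m: "merge_layer G H n a b s" for n a b s
  proof -
    have "\<exists>b'. b \<le> Suc (2 * b') \<and> (b' < (n + 2) ^ c \<or> b' < (n + 2) ^ d)"
      using m unfolding merge_layer_def
    proof (elim disjE exE conjE)
      fix a' b' assume "b = 2 * b'" "G n a' b' s"
      with c show ?thesis by (intro exI[of _ b']) auto
    next
      fix a' b' assume "b = Suc (2 * b')" "H n a' b' s"
      with d show ?thesis by (intro exI[of _ b']) auto
    qed
    then obtain b' where b': "b \<le> Suc (2 * b')" "b' < (n + 2) ^ c \<or> b' < (n + 2) ^ d"
      by blast
    have "(n + 2) ^ c \<le> (n + 2) ^ (c + d)" "(n + 2) ^ d \<le> (n + 2) ^ (c + d)"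
      by (rule power_increasing; simp)+
    then have "b' < (n + 2) ^ (c + d)" using b'(2) by linarith
    moreover have "2 * (n + 2) ^ (c + d) \<le> (n + 2) ^ (c + d + 1)" by simp
    ultimately show ?thesis using b'(1) by linarith
  qed
  with * show ?thesis unfolding good_layer_def by blast
qed

lemma layers_val_merge:
  assumes "length Gs = length Hs"
  shows "layers_val (map2 merge_layer Gs Hs @ [unmerge_layer]) x (2 * a) = layers_val Gs x a \<and>
    layers_val (map2 merge_layer Gs Hs @ [unmerge_layer]) x (Suc (2 * a)) = layers_val Hs x a"
  using assms
proof (induction Gs Hs arbitrary: a rule: list_induct2)
  case Nil
  have "2 * a = 2 * b \<longleftrightarrow> a = b" "2 * a \<noteq> Suc (2 * b)" "Suc (2 * a) \<noteq> 2 * b" for b :: nat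
    by presburger+
  then show ?case by (auto simp: unmerge_layer_def)
next
  case (Cons G Gs H Hs)
  then show ?case by (auto simp: merge_layer_even merge_layer_odd)
qed

lemma layered_or:
  assumes "layered P" "layered Q"
  shows "layered (\<lambda>x a. P x a \<or> Q x a)"
  unfolding layered_def
proof
  fix k
  obtain Gs0 where Gs0: "list_all good_layer Gs0"
    "\<And>x a. a < (length x + 2) ^ k \<Longrightarrow> layers_val Gs0 x a = P x a"
    using assms(1) unfolding layered_def by metis
  obtain Hs0 where Hs0: "list_all good_layer Hs0"
    "\<And>x a. a < (length x + 2) ^ k \<Longrightarrow> layers_val Hs0 x a = Q x a"
    using assms(2) unfolding layered_def by metis
  define Gs where "Gs = Gs0 @ replicate (length Hs0) id_layer"
  define Hs where "Hs = Hs0 @ replicate (length Gs0) id_layer"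
  have len: "length Gs = length Hs" by (simp add: Gs_def Hs_def)
  \<comment> \<open>A new top layer joins the families by reading both copies of gate
    \<open>a\<close>.\<close>
  let ?G = "\<lambda>n a b s. s \<and> a < (n + 2) ^ k \<and> (b = 2 * a \<or> b = Suc (2 * a))"
  have "good_layer ?G"
  proof (rule good_layerI[where c = "k + 1"], intro delta0_intros delta0_const, intro delta0_intros delta0_const)
    fix n a b s assume *: "?G n a b s"
    have "2 * (n + 2) ^ k \<le> (n + 2) ^ (k + 1)" by simp
    then show "b < (n + 2) ^ (k + 1)" using * by linarith
  qed
  moreover have "list_all good_layer (map2 merge_layer Gs Hs @ [unmerge_layer])"
  proof -
    have "\<forall>G\<in>set Gs. good_layer G" "\<forall>H\<in>set Hs. good_layer H"
      using Gs0(1) Hs0(1) by (auto simp: Gs_def Hs_def list_all_iff good_id_layer)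
    then show ?thesis
      by (auto simp: list_all_iff good_unmerge_layer intro!: good_merge_layer
          dest: set_zip_leftD set_zip_rightD)
  qed
  moreover have "layers_val (?G # map2 merge_layer Gs Hs @ [unmerge_layer]) x a = (P x a \<or> Q x a)"
    if "a < (length x + 2) ^ k" for x a
  proof -
    have "layers_val (map2 merge_layer Gs Hs @ [unmerge_layer]) x (2 * a) = P x a"
      "layers_val (map2 merge_layer Gs Hs @ [unmerge_layer]) x (Suc (2 * a)) = Q x a"
      using layers_val_merge[OF len] Gs0(2)[OF that] Hs0(2)[OF that]
      by (simp_all add: Gs_def Hs_def layers_val_pad)
    then show ?thesis using that unfolding layers_val.simps by metis
  qed
  ultimately show "\<exists>Gs. list_all good_layer Gs \<and>
      (\<forall>x a. a < (length x + 2) ^ k \<longrightarrow> layers_val Gs x a = (P x a \<or> Q x a))"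
    by (intro exI[of _ "?G # map2 merge_layer Gs Hs @ [unmerge_layer]"]) simp
qed

section \<open>Circuits of layered families\<close>

text \<open>Gate \<open>a\<close> of the layer at depth \<open>d\<close> becomes the disjunction gate \<open>gate_no Gs d a True\<close>,
  accompanied by the negation gate \<open>gate_no Gs d a False\<close>.\<close>

definition gate_no :: "layer list \<Rightarrow> nat \<Rightarrow> nat \<Rightarrow> bool \<Rightarrow> nat" where
  "gate_no Gs d a s = (a * Suc (length Gs) + d) * 2 + (if s then 0 else 1)"

text \<open>Since every disjunction gate has a negation gate beside it, the sign in a layer is just
  the choice of the gate to be read. On the lowest level the numbers past the input become
  disjunctions without wires, hence false, in agreement with \<open>layers_val []\<close>.\<close>

definition layers_circuit :: "layer list \<Rightarrow> nat \<Rightarrow> nat \<Rightarrow> nat \<Rightarrow> circuit" where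
  "layers_circuit Gs B Q n =
     \<lparr>ngates = 2 * Suc (length Gs) * B,
      kind = (\<lambda>g. if odd g then NotGate
                else if g div 2 mod Suc (length Gs) = length Gs \<and> g div 2 div Suc (length Gs) < n
                then Input (g div 2 div Suc (length Gs)) else OrGate),
      wires = {(gate_no Gs d a True, gate_no Gs (Suc d) b s) | d a b s.
                 d < length Gs \<and> a < B \<and> b < B \<and> (Gs ! d) n a b s} \<union>
              {(gate_no Gs d a False, gate_no Gs d a True) | d a. d \<le> length Gs \<and> a < B},
      outs = map (\<lambda>i. gate_no Gs 0 i True) [0..<Q]\<rparr>"

lemma radix_div_mod:
  assumes "d \<le> l"
  shows "(a * Suc l + d) mod Suc l = d" "(a * Suc l + d) div Suc l = a"
  using assms by (simp_all only: mod_mult_self3 mod_less less_Suc_eq_le div_mult_self3 div_less)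

lemma gate_no_inject:
  assumes "d \<le> length Gs" "d' \<le> length Gs"
  shows "gate_no Gs d a s = gate_no Gs d' a' s' \<longleftrightarrow> d = d' \<and> a = a' \<and> s = s'"
proof
  assume eq: "gate_no Gs d a s = gate_no Gs d' a' s'"
  then have s: "s = s'" unfolding gate_no_def by (cases s; cases s'; simp; presburger)
  then have *: "a * Suc (length Gs) + d = a' * Suc (length Gs) + d'"
    using eq unfolding gate_no_def by (cases s) simp_all
  then have "d = d'" using radix_div_mod(1)[OF assms(1)] radix_div_mod(1)[OF assms(2)] by metis
  then show "d = d' \<and> a = a' \<and> s = s'" using * s by (metis add_right_cancel mult_cancel2 nat.distinct(1))
qed simp

text \<open>Depth and sign are the low digits of a mixed radix number, so a bound on gate numbers
  cuts off \<open>a\<close> at the same place on every level and for both signs.\<close>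

lemma gate_no_less:
  assumes "d \<le> length Gs"
  shows "gate_no Gs d a s < 2 * Suc (length Gs) * B \<longleftrightarrow> a < B"
proof
  assume "a < B"
  then have "a * Suc (length Gs) + Suc (length Gs) \<le> B * Suc (length Gs)"
    by (metis Suc_leI add.commute mult_Suc mult_le_mono1)
  then show "gate_no Gs d a s < 2 * Suc (length Gs) * B"
    using assms by (simp add: gate_no_def algebra_simps)
next
  assume *: "gate_no Gs d a s < 2 * Suc (length Gs) * B"
  show "a < B"
  proof (rule ccontr)
    assume "\<not> a < B"
    then have "B * Suc (length Gs) \<le> a * Suc (length Gs)" by (metis mult_le_mono1 not_less)
    then show False using * by (simp add: gate_no_def algebra_simps)
  qed
qed

lemma gate_no_cases:
  obtains d a s where "d \<le> length Gs" "g = gate_no Gs d a s"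
proof
  let ?h = "g div 2"
  show "?h mod Suc (length Gs) \<le> length Gs"
    by (simp add: less_Suc_eq_le[symmetric])
  have "?h = ?h div Suc (length Gs) * Suc (length Gs) + ?h mod Suc (length Gs)"
    by (rule div_mult_mod_eq[symmetric])
  moreover have "g = ?h * 2 + (if even g then 0 else 1)" by presburger
  ultimately show "g = gate_no Gs (?h mod Suc (length Gs)) (?h div Suc (length Gs)) (even g)"
    unfolding gate_no_def by metis
qed

lemma kind_gate_no:
  assumes "d \<le> length Gs"
  shows "kind (layers_circuit Gs B Q n) (gate_no Gs d a s) =
    (if \<not> s then NotGate else if d = length Gs \<and> a < n then Input a else OrGate)"
proof -
  have h: "gate_no Gs d a s div 2 = a * Suc (length Gs) + d"
    by (simp add: gate_no_def)
  note radix_div_mod[OF assms, of a]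
  moreover have "odd (gate_no Gs d a s) = (\<not> s)" by (simp add: gate_no_def)
  ultimately show ?thesis unfolding layers_circuit_def by (simp only: h circuit.simps)
qed

lemma wires_gate_no:
  assumes "d \<le> length Gs"
  shows "wires (layers_circuit Gs B Q n) `` {gate_no Gs d a True} =
      {gate_no Gs (Suc d) b s | b s. d < length Gs \<and> a < B \<and> b < B \<and> (Gs ! d) n a b s}"
    and "wires (layers_circuit Gs B Q n) `` {gate_no Gs d a False} =
      {gate_no Gs d a True | _::unit. a < B}"
  using assms by (auto simp: layers_circuit_def gate_no_inject)

lemma wf_layers_circuit:
  assumes "Q \<le> B"
  shows "wf_circuit n (layers_circuit Gs B Q n)"
  unfolding wf_circuit_def
proof (intro conjI allI impI)
  let ?C = "layers_circuit Gs B Q n"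
  have ng: "ngates ?C = 2 * Suc (length Gs) * B" by (simp add: layers_circuit_def)
  show "wires ?C \<subseteq> {..<ngates ?C} \<times> {..<ngates ?C}"
    unfolding ng by (auto simp: layers_circuit_def gate_no_less simp del: mult_Suc mult_Suc_right)
  show "set (outs ?C) \<subseteq> {..<ngates ?C}"
    unfolding ng using assms by (auto simp: layers_circuit_def gate_no_less simp del: mult_Suc mult_Suc_right)
  fix g assume g: "g < ngates ?C"
  obtain d a s where d: "d \<le> length Gs" and gd: "g = gate_no Gs d a s" by (rule gate_no_cases)
  have a: "a < B" using g unfolding ng gd gate_no_less[OF d] .
  show "\<exists>h. wires ?C `` {g} = {h}" if "kind ?C g = NotGate"
  proof -
    have "\<not> s" using that unfolding gd kind_gate_no[OF d] by (auto split: if_splits)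
    then show ?thesis using a unfolding gd by (simp add: wires_gate_no[OF d])
  qed
  fix j assume "kind ?C g = Input j"
  then have *: "s" "d = length Gs" "a < n" "j = a"
    unfolding gd kind_gate_no[OF d] by (auto split: if_splits)
  then show "j < n" "wires ?C `` {g} = {}"
    unfolding gd by (auto simp: wires_gate_no)
qed

text \<open>Twice the number of levels below a gate, plus one for a negation gate, falls along every
  wire: a negation gate leads to its own disjunction gate, and that one to a gate on the next
  level.\<close>

lemma depth_layers_circuit: "depth_le (2 * length Gs + 1) (layers_circuit Gs B Q n)"
proof -
  let ?W = "wires (layers_circuit Gs B Q n)"
  have step: "\<exists>d' a' s'. d' \<le> length Gs \<and> h = gate_no Gs d' a' s' \<and>
      Suc (2 * (length Gs - d') + (if s' then 0 else 1)) \<le> 2 * (length Gs - d) + (if s then 0 else 1)"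
    if gh: "(gate_no Gs d a s, h) \<in> ?W" and d: "d \<le> length Gs" for d a s h
  proof (cases s)
    case True
    then have "h \<in> ?W `` {gate_no Gs d a True}" using gh by simp
    then obtain b s' where "d < length Gs" "h = gate_no Gs (Suc d) b s'"
      unfolding wires_gate_no[OF d] by blast
    then show ?thesis using True by (intro exI[of _ "Suc d"] exI) auto
  next
    case False
    then have "h \<in> ?W `` {gate_no Gs d a False}" using gh by simp
    then have "h = gate_no Gs d a True" unfolding wires_gate_no[OF d] by blast
    then show ?thesis using False d by (intro exI[of _ d] exI) auto
  qed
  have "k \<le> 2 * (length Gs - d) + (if s then 0 else 1)"
    if "(gate_no Gs d a s, h) \<in> ?W ^^ k" "d \<le> length Gs" for k d a s h
    using that
  proof (induction k arbitrary: d a s)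
    case (Suc k)
    then obtain g where g: "(gate_no Gs d a s, g) \<in> ?W" "(g, h) \<in> ?W ^^ k"
      by (meson relpow_Suc_D2)
    from step[OF g(1) Suc.prems(2)] obtain d' a' s' where
      d': "d' \<le> length Gs" "g = gate_no Gs d' a' s'"
      "Suc (2 * (length Gs - d') + (if s' then 0 else 1)) \<le> 2 * (length Gs - d) + (if s then 0 else 1)"
      by blast
    have "k \<le> 2 * (length Gs - d') + (if s' then 0 else 1)"
      using Suc.IH g(2) d' by blast
    then show ?case using d'(3) by linarith
  qed simp
  note len' = this
  have len: "k \<le> 2 * length Gs + 1" if gh: "(g, h) \<in> ?W ^^ k" for k g h
  proof -
    obtain d a s where d: "d \<le> length Gs" "g = gate_no Gs d a s" by (rule gate_no_cases)
    have "k \<le> 2 * (length Gs - d) + (if s then 0 else 1)"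
      using len' gh d by blast
    also have "\<dots> \<le> 2 * length Gs + 1" by auto
    finally show ?thesis .
  qed
  show ?thesis unfolding depth_le_def
  proof (rule ccontr)
    assume "?W ^^ Suc (2 * length Gs + 1) \<noteq> {}"
    then obtain g h where "(g, h) \<in> ?W ^^ Suc (2 * length Gs + 1)" by fastforce
    from len[OF this] show False by simp
  qed
qed

text \<open>The parity of a gate number is its sign. Comparing the layer value with
  \<open>even g\<close> therefore gives a disjunction gate the value itself and a negation gate its
  complement. The hypothesis says that restricting the wires to targets below \<open>B\<close> loses
  nothing.\<close>

lemma gate_values_layers_circuit:
  assumes bound: "\<And>d a b s. d < length Gs \<Longrightarrow> (Gs ! d) (length x) a b s \<Longrightarrow> b < B"
  shows "gate_values (layers_circuit Gs B Q (length x)) x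
    (\<lambda>g. layers_val (drop (g div 2 mod Suc (length Gs)) Gs) x (g div 2 div Suc (length Gs)) = even g)"
    (is "gate_values ?C x ?v")
  unfolding gate_values_def
proof (intro allI impI)
  have v: "?v (gate_no Gs d a s) \<longleftrightarrow> layers_val (drop d Gs) x a = s" if "d \<le> length Gs" for d a s
  proof -
    have h: "gate_no Gs d a s div 2 = a * Suc (length Gs) + d" "even (gate_no Gs d a s) = s"
      by (simp_all add: gate_no_def)
    note radix_div_mod[OF that, of a]
    then show ?thesis by (simp only: h)
  qed
  fix g assume g: "g < ngates ?C"
  obtain d a s where d: "d \<le> length Gs" and gd: "g = gate_no Gs d a s" by (rule gate_no_cases)
  have a: "a < B" using g unfolding gd by (simp only: layers_circuit_def circuit.simps gate_no_less[OF d])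
  show "?v g \<longleftrightarrow>
       (case kind ?C g of
          Input j \<Rightarrow> x ! j
        | NotGate \<Rightarrow> (\<forall>h \<in> wires ?C `` {g}. \<not> ?v h)
        | AndGate \<Rightarrow> (\<forall>h \<in> wires ?C `` {g}. ?v h)
        | OrGate \<Rightarrow> (\<exists>h \<in> wires ?C `` {g}. ?v h))" (is "_ \<longleftrightarrow> ?R")
  proof (cases s)
    case False
    then have "?R \<longleftrightarrow> \<not> ?v (gate_no Gs d a True)"
      using a unfolding gd by (simp add: kind_gate_no[OF d] wires_gate_no[OF d])
    then show ?thesis unfolding gd v[OF d] using False by simp
  next
    case True
    show ?thesis
    proof (cases "d = length Gs")
      case D: True
      then have "?R \<longleftrightarrow> a < length x \<and> x ! a"
        unfolding gd kind_gate_no[OF d] using True wires_gate_no(1)[OF d] by auto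
      then show ?thesis unfolding gd v[OF d] using D True by simp
    next
      case D: False
      then have d': "d < length Gs" "Suc d \<le> length Gs" using d by auto
      have "?R \<longleftrightarrow> (\<exists>h \<in> wires ?C `` {gate_no Gs d a True}. ?v h)"
        unfolding gd kind_gate_no[OF d] using True D by simp
      also have "\<dots> \<longleftrightarrow> (\<exists>b s. b < B \<and> (Gs ! d) (length x) a b s \<and> ?v (gate_no Gs (Suc d) b s))"
        unfolding wires_gate_no[OF d] using d' a by blast
      also have "\<dots> \<longleftrightarrow> (\<exists>b s. (Gs ! d) (length x) a b s \<and> layers_val (drop (Suc d) Gs) x b = s)"
        unfolding v[OF d'(2)] using bound[OF d'(1)] by blast
      also have "\<dots> \<longleftrightarrow> layers_val (drop d Gs) x a"
        by (simp only: Cons_nth_drop_Suc[OF d'(1), symmetric] layers_val.simps)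
      finally show ?thesis unfolding gd v[OF d] using True by simp
    qed
  qed
qed

text \<open>For fixed depth and sign the gate number is a term in \<open>a\<close>. A formula thus
  recovers \<open>a\<close> by a quantifier bounded by \<open>B n\<close>, and depth and sign by a
  finite disjunction.\<close>

lemma uniform_layers_circuit:
  assumes good: "list_all good_layer Gs" and B: "term_fun (\<lambda>e. B (var 0 e))" and Q: "term_fun (\<lambda>e. Q (var 0 e))"
  shows "uniform_family (\<lambda>n. layers_circuit Gs (B n) (Q n) n)"
proof -
  let ?C = "\<lambda>n. layers_circuit Gs (B n) (Q n) n" and ?L = "length Gs"
  have ng: "ngates (?C n) = 2 * Suc ?L * B n" for n by (simp add: layers_circuit_def)
  have B': "term_fun (\<lambda>e. B (f e))" if "term_fun f" for f
  proof -
    have "term_fun (\<lambda>e. var i [f e])" for i by (intro term_fun_Cons term_fun_Nil that)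
    from term_fun_subst[OF B this] show ?thesis by simp
  qed
  have no: "term_fun (\<lambda>e. gate_no Gs d (f e) s)" if "term_fun f" for d f s
    unfolding gate_no_def by (intro term_fun_intros that)
  have kind: "g < ngates (?C n) \<and> kind (?C n) g = K \<longleftrightarrow>
      (\<exists>d\<in>{..?L}. \<exists>s\<in>UNIV. \<exists>a<B n. g = gate_no Gs d a s \<and>
        K = (if \<not> s then NotGate else if d = ?L \<and> a < n then Input a else OrGate))" for n g K
  proof -
    obtain d a s where d: "d \<le> ?L" "g = gate_no Gs d a s" by (rule gate_no_cases)
    show ?thesis unfolding ng d(2)
      by (auto simp: kind_gate_no[OF d(1)] gate_no_less[OF d(1)] gate_no_inject[OF d(1)] d(1)
          simp del: mult_Suc mult_Suc_right)
  qed
  have kI: "g < ngates (?C n) \<and> kind (?C n) g = Input j \<longleftrightarrow>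
      (\<exists>d\<in>{..?L}. \<exists>s\<in>UNIV. \<exists>a<B n. g = gate_no Gs d a s \<and> s \<and> d = ?L \<and> a < n \<and> a = j)" for n g j
    unfolding kind by (intro bex_cong ex_cong1 conj_cong refl) auto
  have kN: "g < ngates (?C n) \<and> kind (?C n) g = NotGate \<longleftrightarrow>
      (\<exists>d\<in>{..?L}. \<exists>s\<in>UNIV. \<exists>a<B n. g = gate_no Gs d a s \<and> \<not> s)" for n g
    unfolding kind by (intro bex_cong ex_cong1 conj_cong refl) auto
  have kO: "g < ngates (?C n) \<and> kind (?C n) g = OrGate \<longleftrightarrow>
      (\<exists>d\<in>{..?L}. \<exists>s\<in>UNIV. \<exists>a<B n. g = gate_no Gs d a s \<and> s \<and> \<not> (d = ?L \<and> a < n))" for n g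
    unfolding kind by (intro bex_cong ex_cong1 conj_cong refl) auto
  have kA: "\<not> (g < ngates (?C n) \<and> kind (?C n) g = AndGate)" for n g
    unfolding layers_circuit_def by simp
  have 1: "delta0 (\<lambda>e. \<exists>d\<in>{..?L}. \<exists>s\<in>UNIV. \<exists>a<B (var 0 e). var 1 e = gate_no Gs d a s \<and>
      s \<and> d = ?L \<and> a < var 0 e \<and> a = var 2 e)"
    by (intro delta0_Bex_finite delta0_intros delta0_const no B') simp_all
  have 2: "delta0 (\<lambda>e. \<exists>d\<in>{..?L}. \<exists>s\<in>UNIV. \<exists>a<B (var 0 e). var 1 e = gate_no Gs d a s \<and> \<not> s)"
    by (intro delta0_Bex_finite delta0_intros delta0_const no B') simp_all
  have 3: "delta0 (\<lambda>e. \<exists>d\<in>{..?L}. \<exists>s\<in>UNIV. \<exists>a<B (var 0 e). var 1 e = gate_no Gs d a s \<and>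
      s \<and> \<not> (d = ?L \<and> a < var 0 e))"
    by (intro delta0_Bex_finite delta0_intros delta0_const no B') simp_all
  have layer: "delta0 (\<lambda>e. (Gs ! d) (f e) (g e) (h e) s)" if "d \<in> {..<?L}" "term_fun f" "term_fun g" "term_fun h" for d s f g h
  proof (rule delta0_app3[where R = "\<lambda>n a b. (Gs ! d) n a b s", OF _ that(2-4)])
    have "good_layer (Gs ! d)" using that(1) good by (simp add: list_all_length)
    then show "delta0 (\<lambda>e. (Gs ! d) (var 0 e) (var 1 e) (var 2 e) s)" unfolding good_layer_def by blast
  qed
  have 4: "delta0 (\<lambda>e. (\<exists>d\<in>{..<?L}. \<exists>s\<in>UNIV. \<exists>a<B (var 0 e). \<exists>b<B (var 0 e). (Gs ! d) (var 0 e) a b s \<and>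
        var 1 e = gate_no Gs d a True \<and> var 2 e = gate_no Gs (Suc d) b s) \<or>
      (\<exists>d\<in>{..?L}. \<exists>a<B (var 0 e). var 1 e = gate_no Gs d a False \<and> var 2 e = gate_no Gs d a True))"
    by (intro delta0_Bex_finite delta0_intros delta0_const no B' layer) simp_all
  have wires: "(g, h) \<in> wires (?C n) \<longleftrightarrow>
      (\<exists>d\<in>{..<?L}. \<exists>s\<in>UNIV. \<exists>a<B n. \<exists>b<B n. (Gs ! d) n a b s \<and>
        g = gate_no Gs d a True \<and> h = gate_no Gs (Suc d) b s) \<or>
      (\<exists>d\<in>{..?L}. \<exists>a<B n. g = gate_no Gs d a False \<and> h = gate_no Gs d a True)" for n g h
    unfolding layers_circuit_def circuit.simps by blast
  have 5: "delta0 (\<lambda>e. var 1 e < Q (var 0 e) \<and> var 2 e = gate_no Gs 0 (var 1 e) True)"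
    by (intro delta0_intros no Q)
  have outs: "i < length (outs (?C n)) \<and> outs (?C n) ! i = g \<longleftrightarrow> i < Q n \<and> g = gate_no Gs 0 i True" for n i g
    unfolding layers_circuit_def by auto
  show ?thesis unfolding uniform_family_def
  proof (intro conjI)
    show "\<exists>p. \<forall>n g j. sat [n, g, j] p \<longleftrightarrow> g < ngates (?C n) \<and> kind (?C n) g = Input j"
    proof -
      obtain p where p: "\<And>e. sat e p = (\<exists>d\<in>{..?L}. \<exists>s\<in>UNIV. \<exists>a<B (var 0 e). var 1 e = gate_no Gs d a s \<and>
        s \<and> d = ?L \<and> a < var 0 e \<and> a = var 2 e)"
        using 1 unfolding delta0_def by blast
      show ?thesis unfolding kI by (rule exI[of _ p]) (simp add: p)
    qed
    show "\<exists>p. \<forall>n g. sat [n, g] p \<longleftrightarrow> g < ngates (?C n) \<and> kind (?C n) g = NotGate"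
    proof -
      obtain p where p: "\<And>e. sat e p = (\<exists>d\<in>{..?L}. \<exists>s\<in>UNIV. \<exists>a<B (var 0 e). var 1 e = gate_no Gs d a s \<and> \<not> s)"
        using 2 unfolding delta0_def by blast
      show ?thesis unfolding kN by (rule exI[of _ p]) (simp add: p)
    qed
    show "\<exists>p. \<forall>n g. sat [n, g] p \<longleftrightarrow> g < ngates (?C n) \<and> kind (?C n) g = AndGate"
    proof -
      obtain p where p: "\<And>e. \<not> sat e p"
        using delta0_const[of False] unfolding delta0_def by blast
      show ?thesis by (rule exI[of _ p]) (use p kA in blast)
    qed
    show "\<exists>p. \<forall>n g. sat [n, g] p \<longleftrightarrow> g < ngates (?C n) \<and> kind (?C n) g = OrGate"
    proof -
      obtain p where p: "\<And>e. sat e p = (\<exists>d\<in>{..?L}. \<exists>s\<in>UNIV. \<exists>a<B (var 0 e). var 1 e = gate_no Gs d a s \<and>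
        s \<and> \<not> (d = ?L \<and> a < var 0 e))"
        using 3 unfolding delta0_def by blast
      show ?thesis unfolding kO by (rule exI[of _ p]) (simp add: p)
    qed
    show "\<exists>p. \<forall>n g h. sat [n, g, h] p \<longleftrightarrow> (g, h) \<in> wires (?C n)"
    proof -
      obtain p where p: "\<And>e. sat e p = ((\<exists>d\<in>{..<?L}. \<exists>s\<in>UNIV. \<exists>a<B (var 0 e). \<exists>b<B (var 0 e). (Gs ! d) (var 0 e) a b s \<and>
        var 1 e = gate_no Gs d a True \<and> var 2 e = gate_no Gs (Suc d) b s) \<or>
      (\<exists>d\<in>{..?L}. \<exists>a<B (var 0 e). var 1 e = gate_no Gs d a False \<and> var 2 e = gate_no Gs d a True))"
        using 4 unfolding delta0_def by blast
      show ?thesis unfolding wires by (rule exI[of _ p]) (simp add: p)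
    qed
    show "\<exists>p. \<forall>n i g. sat [n, i, g] p \<longleftrightarrow> i < length (outs (?C n)) \<and> outs (?C n) ! i = g"
    proof -
      obtain p where p: "\<And>e. sat e p = (var 1 e < Q (var 0 e) \<and> var 2 e = gate_no Gs 0 (var 1 e) True)"
        using 5 unfolding delta0_def by blast
      show ?thesis unfolding outs by (rule exI[of _ p]) (simp add: p)
    qed
  qed
qed

section \<open>Polynomial size, and the passage from layers to uniform circuits\<close>

lemma poly_bound: "\<exists>k. \<forall>n::nat. K * (n + 2) ^ c \<le> n ^ k + k"
proof (intro exI allI)
  fix n :: nat
  \<comment> \<open>For \<open>n \<le> 1\<close> the additive part of the bound has to do the work,
    hence the summand \<open>K * 3 ^ c\<close>. For larger \<open>n\<close> the estimates
    \<open>K \<le> n ^ K\<close> and \<open>n + 2 \<le> n * n\<close> lead to the exponent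
    \<open>K + 2 * c\<close>.\<close>
  let ?k = "K * 3 ^ c + K + 2 * c"
  show "K * (n + 2) ^ c \<le> n ^ ?k + ?k"
  proof (cases "n \<le> 1")
    case True
    then have "(n + 2) ^ c \<le> 3 ^ c" by (intro power_mono) auto
    then have "K * (n + 2) ^ c \<le> K * 3 ^ c" by (rule mult_le_mono2)
    then show ?thesis by linarith
  next
    case False
    have "K \<le> 2 ^ K" by (simp add: less_imp_le)
    also have "\<dots> \<le> n ^ K" using False by (intro power_mono) auto
    finally have K: "K \<le> n ^ K" .
    have "n + 2 \<le> n * n" using False mult_le_mono1[of 2 n n] by linarith
    then have "(n + 2) ^ c \<le> (n * n) ^ c" by (rule power_mono) simp
    also have "\<dots> = n ^ (2 * c)" by (simp add: power_mult power2_eq_square)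
    finally have "K * (n + 2) ^ c \<le> n ^ K * n ^ (2 * c)" using K by (rule mult_le_mono[rotated])
    also have "\<dots> = n ^ (K + 2 * c)" by (simp add: power_add)
    also have "\<dots> \<le> n ^ ?k" using False by (intro power_increasing) auto
    finally show ?thesis by linarith
  qed
qed

lemma good_layers_bound:
  assumes "list_all good_layer Gs"
  shows "\<exists>c\<ge>c0. \<forall>G\<in>set Gs. \<forall>n a b s. G n a b s \<longrightarrow> b < (n + 2) ^ c"
  using assms
proof (induction Gs)
  case (Cons G Gs)
  then have "list_all good_layer Gs" by simp
  from Cons.IH[OF this]
  obtain c where c: "c \<ge> c0" "\<And>G n a b s. G \<in> set Gs \<Longrightarrow> G n a b s \<Longrightarrow> b < (n + 2) ^ c"
    by blast
  obtain d where d: "\<And>n a b s. G n a b s \<Longrightarrow> b < (n + 2) ^ d"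
  proof -
    have "good_layer G" using Cons.prems by simp
    then show ?thesis using that unfolding good_layer_def by blast
  qed
  have "(n + 2) ^ c \<le> (n + 2) ^ (c + d)" "(n + 2) ^ d \<le> (n + 2) ^ (c + d)" for n :: nat
    by (rule power_increasing; simp)+
  note le = this
  have "b < (n + 2) ^ (c + d)" if H: "H \<in> set (G # Gs)" "H n a b s" for H n a b s
  proof (cases "H = G")
    case True
    then have "b < (n + 2) ^ d" using d[of n a b s] H(2) by simp
    then show ?thesis using le(2)[of n] by linarith
  next
    case False
    then have "b < (n + 2) ^ c" using c(2)[of H n a b s] H by simp
    then show ?thesis using le(1)[of n] by linarith
  qed
  then have "\<forall>H\<in>set (G # Gs). \<forall>n a b s. H n a b s \<longrightarrow> b < (n + 2) ^ (c + d)"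
    by blast
  then show ?case using c(1) by (meson trans_le_add1)
qed auto

text \<open>The output gates are the first disjunction gates of the top level, two for each of the
  \<open>(length x + 2) ^ q\<close> potential bits of \<open>F x\<close>.\<close>

lemma layered_imp_AC0_computable:
  assumes P: "layered P"
    and out: "\<And>x. \<exists>k. map (P x) [0..<2 * (length x + 2) ^ q] =
      concat (map (\<lambda>b. [True, b]) (F x)) @ replicate (2 * k) False"
  shows "uniform_AC0_computable F"
proof -
  obtain Gs where Gs: "list_all good_layer Gs"
    "\<And>x a. a < (length x + 2) ^ (q + 1) \<Longrightarrow> layers_val Gs x a = P x a"
    using P unfolding layered_def by metis
  \<comment> \<open>The width \<open>B\<close> must also cover the output gates; their number
    \<open>2 * (n + 2) ^ q\<close> is at most \<open>(n + 2) ^ (q + 1)\<close>.\<close>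
  obtain c where c: "c \<ge> q + 1" "\<And>G n a b s. G \<in> set Gs \<Longrightarrow> G n a b s \<Longrightarrow> b < (n + 2) ^ c"
    using good_layers_bound[OF Gs(1)] by blast
  define B Q where "B n = (n + 2) ^ c" and "Q n = 2 * (n + 2) ^ q" for n :: nat
  let ?C = "\<lambda>n. layers_circuit Gs (B n) (Q n) n"
  have Q: "Q n \<le> (n + 2) ^ (q + 1)" for n by (simp add: Q_def)
  have QB: "Q n \<le> B n" for n
    using Q[of n] power_increasing[OF c(1), of "n + 2"] unfolding B_def by linarith
  have "term_fun (\<lambda>e. B (var 0 e))" "term_fun (\<lambda>e. Q (var 0 e))"
    unfolding B_def Q_def by (intro term_fun_intros)+
  then have "uniform_family ?C" using Gs(1) by (intro uniform_layers_circuit)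
  moreover have "\<exists>k. \<forall>n. ngates (?C n) \<le> n ^ k + k \<and> length (outs (?C n)) \<le> n ^ k + k"
  proof -
    obtain k where k: "\<And>n. 2 * Suc (length Gs) * (n + 2) ^ c \<le> n ^ k + k"
      using poly_bound by blast
    have ng: "ngates (?C n) = 2 * Suc (length Gs) * (n + 2) ^ c" for n
      by (simp add: layers_circuit_def B_def)
    have "length (outs (?C n)) \<le> ngates (?C n)" for n
      using QB[of n] by (simp add: layers_circuit_def)
    then show ?thesis using k unfolding ng by (meson order_trans)
  qed
  ultimately have "uniform_AC0_family ?C"
    unfolding uniform_AC0_family_def using wf_layers_circuit[OF QB] depth_layers_circuit by blast
  moreover have "\<exists>v k. gate_values (?C (length x)) x v \<and> map v (outs (?C (length x))) =
      concat (map (\<lambda>b. [True, b]) (F x)) @ replicate (2 * k) False" for x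
  proof -
    let ?v = "\<lambda>g. layers_val (drop (g div 2 mod Suc (length Gs)) Gs) x (g div 2 div Suc (length Gs)) = even g"
    have "gate_values (?C (length x)) x ?v"
      by (rule gate_values_layers_circuit) (unfold B_def, rule c(2)[OF nth_mem])
    moreover have "map ?v (outs (?C (length x))) = map (P x) [0..<2 * (length x + 2) ^ q]"
    proof -
      have "?v (gate_no Gs 0 i True) = P x i" if "i < Q (length x)" for i
      proof -
        have h: "gate_no Gs 0 i True div 2 = i * Suc (length Gs) + 0" "even (gate_no Gs 0 i True)"
          by (simp_all add: gate_no_def)
        have "i < (length x + 2) ^ (q + 1)" using that Q[of "length x"] by linarith
        then show ?thesis
          unfolding h(1) radix_div_mod[OF le0] using h(2) by (simp add: Gs(2))
      qed
      then show ?thesis by (auto simp: layers_circuit_def Q_def)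
    qed
    ultimately show ?thesis using out[of x] by auto
  qed
  ultimately show ?thesis unfolding uniform_AC0_computable_def by (intro exI[of _ ?C]) blast
qed

section \<open>First-order definability over bit strings\<close>

text \<open>Terms see the string through its length only. The bounds of quantifiers are then known
  before the bits are, as a circuit for a given length requires.\<close>

definition poly_fun :: "(bool list \<Rightarrow> nat list \<Rightarrow> nat) \<Rightarrow> bool" where
  "poly_fun f \<longleftrightarrow> (\<exists>g. term_fun g \<and> (\<forall>x e. f x e = g (length x # e)))"

lemma poly_fun_var: "drops g \<Longrightarrow> poly_fun (\<lambda>x e. var i (g e))"
  unfolding poly_fun_def drops_def
proof (elim exE)
  fix k assume g: "\<forall>e. g e = drop k e"
  show "\<exists>h. term_fun h \<and> (\<forall>x e. var i (g e) = h (length x # e))"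
    by (intro exI[of _ "\<lambda>e. var (Suc (k + i)) e"] conjI term_fun_var drops_id) (simp add: g var_drop)
qed

lemma poly_fun_length: "poly_fun (\<lambda>x e. length x)"
  unfolding poly_fun_def by (intro exI[of _ "\<lambda>e. var 0 e"] conjI term_fun_var drops_id) simp

lemma poly_fun_const: "poly_fun (\<lambda>x e. k)"
  unfolding poly_fun_def using term_fun_const by blast

lemma poly_fun_Plus: "poly_fun f \<Longrightarrow> poly_fun g \<Longrightarrow> poly_fun (\<lambda>x e. f x e + g x e)"
  unfolding poly_fun_def
proof (elim exE conjE)
  fix f' g' assume "term_fun f'" "term_fun g'" "\<forall>x e. f x e = f' (length x # e)" "\<forall>x e. g x e = g' (length x # e)"
  then show "\<exists>h. term_fun h \<and> (\<forall>x e. f x e + g x e = h (length x # e))"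
    by (intro exI[of _ "\<lambda>e. f' e + g' e"] conjI term_fun_Plus) simp_all
qed

lemma poly_fun_Times: "poly_fun f \<Longrightarrow> poly_fun g \<Longrightarrow> poly_fun (\<lambda>x e. f x e * g x e)"
  unfolding poly_fun_def
proof (elim exE conjE)
  fix f' g' assume "term_fun f'" "term_fun g'" "\<forall>x e. f x e = f' (length x # e)" "\<forall>x e. g x e = g' (length x # e)"
  then show "\<exists>h. term_fun h \<and> (\<forall>x e. f x e * g x e = h (length x # e))"
    by (intro exI[of _ "\<lambda>e. f' e * g' e"] conjI term_fun_Times) simp_all
qed

lemma poly_fun_Suc: "poly_fun f \<Longrightarrow> poly_fun (\<lambda>x e. Suc (f x e))"
  using poly_fun_Plus[OF _ poly_fun_const[of 1]] by simp

lemma poly_fun_power: "poly_fun f \<Longrightarrow> poly_fun (\<lambda>x e. f x e ^ c)"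
  by (induction c) (simp_all add: poly_fun_const poly_fun_Times)

lemma poly_fun_Cons: "poly_fun f \<Longrightarrow> (\<And>i. poly_fun (\<lambda>x e. var i (g x e))) \<Longrightarrow> poly_fun (\<lambda>x e. var i (f x e # g x e))"
  by (cases i) simp_all

lemma poly_fun_Nil: "poly_fun (\<lambda>x e. var i [])"
  by (simp add: poly_fun_const)

lemma poly_fun_subst_term_fun:
  assumes "term_fun f" and "\<And>i. poly_fun (\<lambda>x e. var i (g x e))"
  shows "poly_fun (\<lambda>x e. f (g x e))"
proof -
  obtain t where t: "\<And>e. term_val e t = f e" using assms(1) unfolding term_fun_def by blast
  obtain h where h: "\<And>i. term_fun (h i)" "\<And>i x e. var i (g x e) = h i (length x # e)"
    using assms(2) unfolding poly_fun_def by metis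
  obtain \<sigma> where \<sigma>: "\<And>i e. term_val e (\<sigma> i) = h i e"
    using h(1) unfolding term_fun_def by metis
  have "f (g x e) = term_val (length x # e) (tsubst \<sigma> t)" for x e
    unfolding t[symmetric] by (rule term_val_tsubst[symmetric]) (simp add: \<sigma> h(2))
  then show ?thesis
    unfolding poly_fun_def term_fun_def by (intro exI[of _ "\<lambda>e. term_val e (tsubst \<sigma> t)"]) auto
qed

lemma poly_fun_subst:
  assumes "poly_fun f" and "\<And>i. poly_fun (\<lambda>x e. var i (g x e))"
  shows "poly_fun (\<lambda>x e. f x (g x e))"
proof -
  obtain h where h: "term_fun h" "\<And>x e. f x e = h (length x # e)"
    using assms(1) unfolding poly_fun_def by blast
  have "poly_fun (\<lambda>x e. h (length x # g x e))"
    by (rule poly_fun_subst_term_fun[OF h(1)]) (intro poly_fun_Cons poly_fun_length assms(2))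
  then show ?thesis by (simp add: h(2))
qed

text \<open>An inductive definition instead of the existence of a formula, because the translation
  into layers and the substitution of a function for the string both go by induction on the
  construction. A bit past the end of the string counts as 0.\<close>

inductive fo :: "(bool list \<Rightarrow> nat list \<Rightarrow> bool) \<Rightarrow> bool" where
  fo_le: "poly_fun f \<Longrightarrow> poly_fun g \<Longrightarrow> fo (\<lambda>x e. f x e \<le> g x e)"
| fo_bit: "poly_fun f \<Longrightarrow> fo (\<lambda>x e. f x e < length x \<and> x ! f x e)"
| fo_not: "fo P \<Longrightarrow> fo (\<lambda>x e. \<not> P x e)"
| fo_or: "fo P \<Longrightarrow> fo Q \<Longrightarrow> fo (\<lambda>x e. P x e \<or> Q x e)"
| fo_BEx: "poly_fun f \<Longrightarrow> fo P \<Longrightarrow> fo (\<lambda>x e. \<exists>a\<le>f x e. P x (a # e))"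

lemma fo_ex: "poly_fun f \<Longrightarrow> fo (\<lambda>x e. Q x (var 0 e) (tl e)) \<Longrightarrow> fo (\<lambda>x e. \<exists>a\<le>f x e. Q x a e)"
  using fo_BEx[of f "\<lambda>x e. Q x (var 0 e) (tl e)"] by simp

lemma fo_and:
  assumes "fo P" "fo Q"
  shows "fo (\<lambda>x e. P x e \<and> Q x e)"
proof -
  have "fo (\<lambda>x e. \<not> (\<not> P x e \<or> \<not> Q x e))" by (rule fo_not, rule fo_or; rule fo_not, fact)
  then show ?thesis by simp
qed

lemma fo_imp:
  assumes "fo P" "fo Q"
  shows "fo (\<lambda>x e. P x e \<longrightarrow> Q x e)"
  unfolding imp_conv_disj by (rule fo_or, rule fo_not) fact+

lemma fo_iff:
  assumes "fo P" "fo Q"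
  shows "fo (\<lambda>x e. P x e = Q x e)"
  unfolding iff_conv_conj_imp by (rule fo_and; rule fo_imp; fact)

lemma fo_eq: "poly_fun f \<Longrightarrow> poly_fun g \<Longrightarrow> fo (\<lambda>x e. f x e = g x e)"
  using fo_and[OF fo_le fo_le] by (simp add: eq_iff)

lemma fo_less: "poly_fun f \<Longrightarrow> poly_fun g \<Longrightarrow> fo (\<lambda>x e. f x e < g x e)"
  using fo_le[OF poly_fun_Suc] by (simp add: Suc_le_eq)

lemma poly_fun_tl: "poly_fun f \<Longrightarrow> poly_fun (\<lambda>x e. f x (tl e))"
  by (erule poly_fun_subst) (intro poly_fun_var drops_tl drops_id)

lemma fo_ex_less:
  assumes "poly_fun f" "fo (\<lambda>x e. Q x (var 0 e) (tl e))"
  shows "fo (\<lambda>x e. \<exists>a<f x e. Q x a e)"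
proof -
  have "fo (\<lambda>x e. \<exists>a\<le>f x e. a < f x e \<and> Q x a e)"
    by (intro fo_ex fo_and fo_less poly_fun_var drops_id poly_fun_tl assms)
  moreover have "(\<exists>a\<le>n. a < n \<and> R a) \<longleftrightarrow> (\<exists>a<n. R a)" for n :: nat and R
    by (meson less_imp_le)
  ultimately show ?thesis by simp
qed

lemma fo_all:
  assumes "poly_fun f" "fo (\<lambda>x e. Q x (var 0 e) (tl e))"
  shows "fo (\<lambda>x e. \<forall>a\<le>f x e. Q x a e)"
  using fo_not[OF fo_ex[OF assms(1) fo_not[OF assms(2)]]] by simp

lemma fo_all_less:
  assumes "poly_fun f" "fo (\<lambda>x e. Q x (var 0 e) (tl e))"
  shows "fo (\<lambda>x e. \<forall>a<f x e. Q x a e)"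
  using fo_not[OF fo_ex_less[OF assms(1) fo_not[OF assms(2)]]] by simp

lemmas poly_fun_intros = poly_fun_var drops_id drops_tl poly_fun_length poly_fun_Plus poly_fun_Times poly_fun_Suc poly_fun_power
  poly_fun_Cons poly_fun_Nil poly_fun_const
lemmas fo_intros = fo_le fo_eq fo_less fo_not fo_and fo_or fo_imp fo_iff fo_ex fo_ex_less fo_all
  fo_all_less poly_fun_intros

lemma fo_subst:
  assumes "fo P" and "\<And>i. poly_fun (\<lambda>x e. var i (g x e))"
  shows "fo (\<lambda>x e. P x (g x e))"
  using assms
proof (induction arbitrary: g)
  case (fo_BEx f P)
  have "fo (\<lambda>x e. P x (var 0 e # g x (tl e)))"
    by (rule fo_BEx.IH) (intro poly_fun_Cons poly_fun_var drops_id poly_fun_tl fo_BEx.prems)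
  then show ?case by (intro fo_ex poly_fun_subst[OF fo_BEx.hyps(1)] fo_BEx.prems)
next
  case (fo_le f f')
  show ?case by (rule fo.fo_le; rule poly_fun_subst; fact)
next
  case (fo_bit f)
  show ?case by (rule fo.fo_bit; rule poly_fun_subst; fact)
next
  case (fo_not P)
  show ?case by (rule fo.fo_not) (rule fo_not.IH, fact)
next
  case (fo_or P Q)
  show ?case by (rule fo.fo_or; (rule fo_or.IH(1) | rule fo_or.IH(2)); fact)
qed

section \<open>First-order definable predicates are layered\<close>

text \<open>Iterated Cantor pairing, with the second component of the last pair ignored. Every
  number is thus the code of an assignment, and variables from index \<open>k\<close> on read as
  0.\<close>

primrec decode :: "nat \<Rightarrow> nat \<Rightarrow> nat list" where
  "decode 0 u = []"
| "decode (Suc k) u = fst (prod_decode u) # decode k (snd (prod_decode u))"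

lemma length_decode [simp]: "length (decode k u) = k"
  by (induction k arbitrary: u) simp_all

text \<open>The pairing contains a triangular number, hence a division by 2. Doubling the equation
  turns its graph into an equation of terms.\<close>

lemma prod_encode_eq_iff: "v = prod_encode (a, b) \<longleftrightarrow> 2 * v = (a + b) * Suc (a + b) + 2 * a"
proof -
  have "2 * triangle n = n * Suc n" for n by (induction n) simp_all
  then have "2 * prod_encode (a, b) = (a + b) * Suc (a + b) + 2 * a"
    by (simp add: prod_encode_def)
  then show ?thesis by linarith
qed

lemma prod_decode_le: "fst (prod_decode u) \<le> u" "snd (prod_decode u) \<le> u"
  using le_prod_encode_1 le_prod_encode_2 by (metis prod.collapse prod_decode_inverse)+

text \<open>Pairing grows quadratically, whence the factor 2 in the exponent. As \<open>M\<close> is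
  at least 2, two additional factors absorb the constant 4, and the last one makes the inequality
  strict.\<close>

lemma prod_encode_bound:
  assumes "a \<le> M ^ l" "u \<le> M" "2 \<le> M"
  shows "prod_encode (a, u) < M ^ (2 * (l + 3) + 1)"
proof -
  have p: "M ^ l \<le> M ^ (l + 1)" "M \<le> M ^ (l + 1)" "1 \<le> M ^ (l + 1)"
    using assms(3) by (auto intro: power_increasing self_le_power)
  have "2 * 2 \<le> M * M" using assms(3) by (intro mult_le_mono)
  then have "4 * M ^ (l + 1) \<le> M * M * M ^ (l + 1)" by (intro mult_le_mono1) simp
  also have "\<dots> = M ^ (l + 3)" by (simp add: eval_nat_numeral)
  finally have "a + u + 1 \<le> M ^ (l + 3)" using assms(1,2) p by linarith
  then have "(a + u + 1) * (a + u + 1) \<le> M ^ (l + 3) * M ^ (l + 3)" by (intro mult_le_mono)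
  moreover have "prod_encode (a, u) \<le> (a + u + 1) * (a + u + 1)"
    using prod_encode_eq_iff[of "prod_encode (a, u)" a u] by (simp add: algebra_simps)
  moreover have "M ^ (l + 3) * M ^ (l + 3) = M ^ (2 * (l + 3))"
    by (simp only: power_add[symmetric] mult_2)
  moreover have "M ^ (2 * (l + 3)) < M ^ (2 * (l + 3) + 1)"
    using assms(3) by (intro power_strict_increasing) simp_all
  ultimately show ?thesis by linarith
qed

lemma var_decode_le: "var i (decode k u) \<le> u"
proof (induction k arbitrary: i u)
  case (Suc k)
  show ?case
  proof (cases i)
    case i: (Suc j)
    show ?thesis using Suc.IH[of j "snd (prod_decode u)"] prod_decode_le(2)[of u]
      by (simp add: i)
  qed (simp add: prod_decode_le)
qed simp

text \<open>Both components of a pair are at most its code, so that unpacking a code is a bounded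
  quantification.\<close>

lemma delta0_dec_append:
  assumes "delta0 P"
  shows "delta0 (\<lambda>e. P (decode k (var 0 e) @ tl e))"
  using assms
proof (induction k arbitrary: P)
  case 0
  then show ?case by (simp, rule delta0_subst) (intro term_fun_var drops_tl drops_id)
next
  case (Suc k)
  \<comment> \<open>The induction hypothesis decodes at the front of the environment. So
    \<open>P'\<close> expects the outermost component behind the \<open>k\<close> decoded ones and
    moves it to the front.\<close>
  define P' where "P' l = P (var k l # take k l @ drop (Suc k) l)" for l
  have "delta0 P'"
    unfolding P'_def
  proof (rule delta0_subst[OF Suc.prems])
    fix i
    have "var i (var k e # take k e @ drop (Suc k) e) =
        var (if i = 0 then k else if i \<le> k then i - 1 else i) e" for e
      by (cases i) (auto simp: var_def nth_append)
    then show "term_fun (\<lambda>e. var i (var k e # take k e @ drop (Suc k) e))"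
      by (simp only: term_fun_var[OF drops_id])
  qed
  from Suc.IH[OF this] have "delta0 (\<lambda>e. P' (decode k (var 0 e) @ tl e))" .
  \<comment> \<open>Inside the two quantifiers below, the environment starts with \<open>u\<close>,
    \<open>a\<close> and the code itself; the code is dropped.\<close>
  then have "delta0 (\<lambda>e. P' (decode k (var 0 (var 0 e # var 1 e # tl (tl (tl e)))) @ tl (var 0 e # var 1 e # tl (tl (tl e)))))"
    by (rule delta0_subst) (intro term_fun_intros)
  then have "delta0 (\<lambda>e. P (var 1 e # decode k (var 0 e) @ tl (tl (tl e))))"
    by (simp add: P'_def var_append)
  then have "delta0 (\<lambda>e. \<exists>a\<le>var 0 e. \<exists>u\<le>var 0 e. 2 * var 0 e = (a + u) * Suc (a + u) + 2 * a \<and>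
      P (a # decode k u @ tl e))"
    by (intro delta0_intros) (simp only: var_tl One_nat_def)
  moreover have "(\<exists>a\<le>v. \<exists>u\<le>v. 2 * v = (a + u) * Suc (a + u) + 2 * a \<and> P (a # decode k u @ l)) \<longleftrightarrow>
      P (decode (Suc k) v @ l)" for v l
    unfolding prod_encode_eq_iff[symmetric]
  proof
    assume "P (decode (Suc k) v @ l)"
    then show "\<exists>a\<le>v. \<exists>u\<le>v. v = prod_encode (a, u) \<and> P (a # decode k u @ l)"
      using prod_decode_le[of v]
      by (intro exI[of _ "fst (prod_decode v)"] conjI exI[of _ "snd (prod_decode v)"]) simp_all
  qed auto
  ultimately show ?case by simp
qed

text \<open>Parameters such as the input length or a bit position stand before the decoded
  variables, so the two blocks of the environment have to change places.\<close>

lemma delta0_decode: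
  assumes "delta0 P"
  shows "delta0 (\<lambda>e. P (map (\<lambda>i. var (Suc i) e) [0..<p] @ decode k (var 0 e)))"
proof -
  define P' where "P' l = P (map (\<lambda>i. var (k + i) l) [0..<p] @ take k l)" for l
  have "delta0 P'"
    unfolding P'_def
  proof (rule delta0_subst[OF assms])
    fix i
    have "var i (map (\<lambda>i. var (k + i) e) [0..<p] @ take k e) =
        (if i < p then var (k + i) e else if i - p < k then var (i - p) e else 0)" for e
      by (auto simp: var_def nth_append)
    then show "term_fun (\<lambda>e. var i (map (\<lambda>i. var (k + i) e) [0..<p] @ take k e))"
      by (cases "i < p"; cases "i - p < k") (simp_all only: if_True if_False term_fun_var[OF drops_id] term_fun_const)
  qed
  from delta0_dec_append[OF this, of k] show ?thesis
    by (simp add: P'_def var_append var_tl)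
qed

lemma delta0_decode1:
  assumes "delta0 P"
  shows "delta0 (\<lambda>e. P (var 0 e # decode k (var 1 e)))"
proof -
  have "delta0 (\<lambda>e. P (map (\<lambda>i. var (Suc i) [var 1 e, var 0 e]) [0..<1] @ decode k (var 0 [var 1 e, var 0 e])))"
    by (rule delta0_subst[OF delta0_decode[OF assms]]) (intro term_fun_intros)
  then show ?thesis by simp
qed

lemma delta0_decode2:
  assumes "delta0 P"
  shows "delta0 (\<lambda>e. P (var 2 e # var 0 e # decode k (var 1 e)))"
proof -
  have "delta0 (\<lambda>e. P (map (\<lambda>i. var (Suc i) [var 1 e, var 2 e, var 0 e]) [0..<2] @ decode k (var 0 [var 1 e, var 2 e, var 0 e])))"
    by (rule delta0_subst[OF delta0_decode[OF assms]]) (intro term_fun_intros)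
  then show ?thesis by (simp add: numeral_2_eq_2)
qed

text \<open>One exponent serves all environments. Hence a value bounded by a term enlarges the code
  of an assignment only polynomially.\<close>

lemma term_fun_poly_bound:
  assumes "term_fun f"
  shows "\<exists>l. \<forall>M e. 2 \<le> M \<longrightarrow> (\<forall>i. var i e \<le> M) \<longrightarrow> f e \<le> M ^ l"
proof -
  have "\<exists>l. \<forall>M e. 2 \<le> M \<longrightarrow> (\<forall>i. var i e \<le> M) \<longrightarrow> term_val e t \<le> M ^ l" for t
  proof (induction t)
    case (Var i)
    show ?case by (rule exI[of _ 1]) (simp add: var_def[symmetric])
  next
    case (Plus s t)
    obtain k where k: "\<And>M e. 2 \<le> M \<Longrightarrow> \<forall>i. var i e \<le> M \<Longrightarrow> term_val e s \<le> M ^ k"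
      using Plus.IH(1) by blast
    obtain l where l: "\<And>M e. 2 \<le> M \<Longrightarrow> \<forall>i. var i e \<le> M \<Longrightarrow> term_val e t \<le> M ^ l"
      using Plus.IH(2) by blast
    have "term_val e (Plus s t) \<le> M ^ (k + l + 1)" if M: "2 \<le> M" and e: "\<forall>i. var i e \<le> M" for M e
    proof -
      have "M ^ k \<le> M ^ (k + l)" "M ^ l \<le> M ^ (k + l)" using M by (intro power_increasing; simp)+
      moreover have "2 * M ^ (k + l) \<le> M * M ^ (k + l)" using M by (rule mult_le_mono1)
      moreover have "M * M ^ (k + l) = M ^ (k + l + 1)" by simp
      moreover have "term_val e (Plus s t) = term_val e s + term_val e t" by simp
      ultimately show ?thesis using k[OF M e] l[OF M e] by linarith
    qed
    then show ?case by blast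
  next
    case (Times s t)
    obtain k where k: "\<And>M e. 2 \<le> M \<Longrightarrow> \<forall>i. var i e \<le> M \<Longrightarrow> term_val e s \<le> M ^ k"
      using Times.IH(1) by blast
    obtain l where l: "\<And>M e. 2 \<le> M \<Longrightarrow> \<forall>i. var i e \<le> M \<Longrightarrow> term_val e t \<le> M ^ l"
      using Times.IH(2) by blast
    have "term_val e (Times s t) \<le> M ^ (k + l)" if M: "2 \<le> M" and e: "\<forall>i. var i e \<le> M" for M e
      using mult_le_mono[OF k[OF M e] l[OF M e]] by (simp add: power_add)
    then show ?case by blast
  qed (auto intro: exI[of _ 0])
  moreover obtain t where t: "\<And>e. term_val e t = f e" using assms unfolding term_fun_def by blast
  ultimately show ?thesis unfolding t[symmetric] by blast
qed

text \<open>Gate \<open>u\<close> computes the truth value under the assignment coded by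
  \<open>u\<close>. A quantifier is a disjunction over the codes \<open>prod_encode (a, u)\<close>
  of the extended assignments, which have one variable more; for this reason \<open>k\<close> is
  arbitrary in the induction.\<close>

lemma fo_layered:
  assumes "fo P"
  shows "layered (\<lambda>x u. P x (decode k u))"
  using assms
proof (induction arbitrary: k)
  case (fo_le f g)
  then obtain f' g' where fg: "term_fun f'" "term_fun g'" "\<And>x e. f x e = f' (length x # e)" "\<And>x e. g x e = g' (length x # e)"
    unfolding poly_fun_def by metis
  from delta0_decode1[OF delta0_le[OF fg(1,2)]]
  have "layered (\<lambda>x u. f' (length x # decode k u) \<le> g' (length x # decode k u))"
    by (rule layered_arith[where R = "\<lambda>n u. f' (n # decode k u) \<le> g' (n # decode k u)"])
  then show ?case by (simp add: fg(3,4))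
next
  case (fo_bit f)
  then obtain f' where f: "term_fun f'" "\<And>x e. f x e = f' (length x # e)"
    unfolding poly_fun_def by metis
  have "delta0 (\<lambda>e. var 0 e = f' (tl e))"
    by (intro delta0_eq term_fun_var drops_id term_fun_tl f(1))
  from delta0_decode2[OF this, of k]
  have "delta0 (\<lambda>e. var 2 e = f' (var 0 e # decode k (var 1 e)))" by simp
  then have "layered (\<lambda>x u. \<exists>b. b = f' (length x # decode k u) \<and> b < length x \<and> x ! b)"
    by (rule layered_bit[where R = "\<lambda>n u b. b = f' (n # decode k u)"])
  then show ?case by (simp add: f(2))
next
  case (fo_BEx f P)
  then obtain f' where f: "term_fun f'" "\<And>x e. f x e = f' (length x # e)"
    unfolding poly_fun_def by metis
  \<comment> \<open>A code is at least its components, so \<open>b\<close> itself can bound the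
    quantifier over \<open>a\<close>.\<close>
  define R where "R n u b \<longleftrightarrow> (\<exists>a\<le>b. a \<le> f' (n # decode k u) \<and> 2 * b = (a + u) * Suc (a + u) + 2 * a)" for n u b
  have "delta0 (\<lambda>e. var 0 e \<le> f' (tl e))"
    by (intro delta0_le term_fun_var drops_id term_fun_tl f(1))
  from delta0_decode2[OF this, of k]
  have "delta0 (\<lambda>e. (\<lambda>n u a. a \<le> f' (n # decode k u)) (var 0 e) (var 1 e) (var 2 e))" by simp
  from delta0_app3[OF this] have A: "delta0 (\<lambda>e. h3 e \<le> f' (h1 e # decode k (h2 e)))" if "term_fun h1" "term_fun h2" "term_fun h3" for h1 h2 h3
    using that .
  have "delta0 (\<lambda>e. R (var 0 e) (var 1 e) (var 2 e))"
    unfolding R_def by (intro delta0_ex delta0_and A delta0_eq term_fun_intros)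
  moreover have "\<exists>l. \<forall>n u b. u < (n + 2) ^ c \<longrightarrow> R n u b \<longrightarrow> b < (n + 2) ^ l" for c
  proof -
    obtain l where l: "\<And>M e. 2 \<le> M \<Longrightarrow> \<forall>i. var i e \<le> M \<Longrightarrow> f' e \<le> M ^ l"
      using term_fun_poly_bound[OF f(1)] by metis
    have "b < (n + 2) ^ ((c + 1) * (2 * (l + 3) + 1))" if u: "u < (n + 2) ^ c" and R: "R n u b" for n u b
    proof -
      \<comment> \<open>A common bound for all entries of the environment: for \<open>n\<close>
        directly, and for the decoded variables because none of them exceeds
        \<open>u\<close>.\<close>
      define M where "M = (n + 2) ^ (c + 1)"
      have "(n + 2) ^ c \<le> M" "n + 2 \<le> M"
        unfolding M_def by (rule power_increasing; simp) (rule self_le_power; simp)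
      then have M: "2 \<le> M" "u \<le> M" "n \<le> M" using u by linarith+
      have "var i (n # decode k u) \<le> M" for i
        using M var_decode_le[of _ k u] by (cases i) (auto intro: order_trans)
      then have fl: "f' (n # decode k u) \<le> M ^ l" using l M(1) by blast
      obtain a where a: "a \<le> M ^ l" "2 * b = (a + u) * Suc (a + u) + 2 * a"
        using R fl unfolding R_def by (meson order_trans)
      have "b < M ^ (2 * (l + 3) + 1)"
        using prod_encode_bound[OF a(1) M(2,1)] a(2) prod_encode_eq_iff[of b a u] by simp
      then show ?thesis unfolding M_def power_mult .
    qed
    then show ?thesis by blast
  qed
  ultimately have "layered (\<lambda>x u. \<exists>b. R (length x) u b \<and> P x (decode (Suc k) b))"
    by (rule layered_ex[where R = R and P = "\<lambda>x. P x \<circ> decode (Suc k)", unfolded o_def, OF fo_BEx.IH])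
  moreover have "(\<exists>b. R (length x) u b \<and> P x (decode (Suc k) b)) \<longleftrightarrow> (\<exists>a\<le>f x (decode k u). P x (a # decode k u))" for x u
  proof -
    have "R (length x) u b \<longleftrightarrow> (\<exists>a. a \<le> f x (decode k u) \<and> b = prod_encode (a, u))" for b
      unfolding R_def f(2) prod_encode_eq_iff[symmetric] using le_prod_encode_1 by blast
    then show ?thesis by auto
  qed
  ultimately show ?case by simp
next
  case (fo_not P)
  show ?case by (rule layered_not) (rule fo_not.IH)
next
  case (fo_or P Q)
  show ?case by (rule layered_or) (rule fo_or.IH)+
qed

section \<open>First-order definable functions\<close>

text \<open>The length of \<open>F x\<close> need not be determined by that of \<open>x\<close>, so
  no term can stand for it. A formula for the positions of \<open>F x\<close> takes its
  place.\<close>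

definition fo_fun :: "(bool list \<Rightarrow> bool list) \<Rightarrow> bool" where
  "fo_fun F \<longleftrightarrow> fo (\<lambda>x e. var 0 e < length (F x)) \<and>
     fo (\<lambda>x e. var 0 e < length (F x) \<and> F x ! var 0 e) \<and>
     (\<exists>c. \<forall>x. length (F x) \<le> (length x + 2) ^ c)"

lemma fo_fun_less_length:
  assumes "fo_fun F" "poly_fun f"
  shows "fo (\<lambda>x e. f x e < length (F x))"
proof -
  have "fo (\<lambda>x e. var 0 [f x e] < length (F x))"
    by (rule fo_subst[where P = "\<lambda>x e. var 0 e < length (F x)"])
      (use assms in \<open>auto simp: fo_fun_def intro!: poly_fun_Cons poly_fun_Nil\<close>)
  then show ?thesis by simp
qed

lemma fo_fun_nth:
  assumes "fo_fun F" "poly_fun f"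
  shows "fo (\<lambda>x e. f x e < length (F x) \<and> F x ! f x e)"
proof -
  have "fo (\<lambda>x e. var 0 [f x e] < length (F x) \<and> F x ! var 0 [f x e])"
    by (rule fo_subst[where P = "\<lambda>x e. var 0 e < length (F x) \<and> F x ! var 0 e"])
      (use assms in \<open>auto simp: fo_fun_def intro!: poly_fun_Cons poly_fun_Nil\<close>)
  then show ?thesis by simp
qed

text \<open>The length of \<open>F x\<close> is the least number that is not a position of
  \<open>F x\<close>. Being polynomially bounded, it can be named by a bounded quantifier in a
  formula over \<open>x\<close>.\<close>

lemma fo_fun_length:
  assumes F: "fo_fun F" and Q: "fo (\<lambda>x e. Q x (var 0 e) (tl e))"
  shows "fo (\<lambda>x e. Q x (length (F x)) e)"
proof -
  obtain c where c: "\<And>x. length (F x) \<le> (length x + 2) ^ c"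
    using F unfolding fo_fun_def by blast
  have "fo (\<lambda>x e. \<exists>N\<le>(length x + 2) ^ c. \<not> N < length (F x) \<and> (\<forall>M<N. M < length (F x)) \<and> Q x N e)"
    by (intro fo_fun_less_length[OF F] Q fo_intros)
  moreover have "(\<exists>N\<le>(length x + 2) ^ c. \<not> N < length (F x) \<and> (\<forall>M<N. M < length (F x)) \<and> Q x N e) \<longleftrightarrow>
      Q x (length (F x)) e" for x e
  proof
    assume "\<exists>N\<le>(length x + 2) ^ c. \<not> N < length (F x) \<and> (\<forall>M<N. M < length (F x)) \<and> Q x N e"
    then obtain N where N: "\<not> N < length (F x)" "\<forall>M<N. M < length (F x)" "Q x N e" by blast
    then have "N = length (F x)" by (meson less_irrefl linorder_neqE_nat)
    then show "Q x (length (F x)) e" using N(3) by simp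
  next
    assume "Q x (length (F x)) e"
    then show "\<exists>N\<le>(length x + 2) ^ c. \<not> N < length (F x) \<and> (\<forall>M<N. M < length (F x)) \<and> Q x N e"
      using c[of x] by blast
  qed
  ultimately show ?thesis by simp
qed

text \<open>Terms in a formula about \<open>F x\<close> refer to \<open>length (F x)\<close>, which
  need not be a term over \<open>x\<close>. In every atom and every quantifier bound it is replaced
  by a variable \<open>N\<close>, which \<open>fo_fun_length\<close> then eliminates.\<close>

lemma fo_comp:
  assumes "fo P" and F: "fo_fun F"
  shows "fo (\<lambda>x e. P (F x) e)"
  using assms(1)
proof induction
  case (fo_le f g)
  obtain f' where f: "term_fun f'" "\<And>x e. f x e = f' (length x # e)"
    using fo_le(1) unfolding poly_fun_def by blast
  obtain g' where g: "term_fun g'" "\<And>x e. g x e = g' (length x # e)"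
    using fo_le(2) unfolding poly_fun_def by blast
  have "fo (\<lambda>x e. f' (var 0 e # tl e) \<le> g' (var 0 e # tl e))"
    by (rule fo.fo_le; rule poly_fun_subst_term_fun; (rule f(1) | rule g(1) | intro poly_fun_intros))
  then show ?case unfolding f(2) g(2)
    by (rule fo_fun_length[OF F, where Q = "\<lambda>x N e. f' (N # e) \<le> g' (N # e)"])
next
  case (fo_bit f)
  obtain f' where f: "term_fun f'" "\<And>x e. f x e = f' (length x # e)"
    using fo_bit unfolding poly_fun_def by blast
  have "poly_fun (\<lambda>x e. f' (var 0 e # tl e))"
    by (rule poly_fun_subst_term_fun, rule f(1), intro poly_fun_intros)
  from fo_fun_nth[OF F this]
  show ?case unfolding f(2)
    by (rule fo_fun_length[OF F, where Q = "\<lambda>x N e. f' (N # e) < length (F x) \<and> F x ! f' (N # e)"])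
next
  case (fo_not P)
  show ?case by (rule fo.fo_not[OF fo_not.IH])
next
  case (fo_or P Q)
  show ?case by (rule fo.fo_or[OF fo_or.IH])
next
  case (fo_BEx f P)
  obtain f' where f: "term_fun f'" "\<And>x e. f x e = f' (length x # e)"
    using fo_BEx(1) unfolding poly_fun_def by blast
  have P: "fo (\<lambda>x e. P (F x) (var 0 e # tl (tl e)))"
    by (rule fo_subst[OF fo_BEx.IH]) (intro poly_fun_intros)
  have "poly_fun (\<lambda>x e. f' (var 0 e # tl e))"
    by (rule poly_fun_subst_term_fun, rule f(1), intro poly_fun_intros)
  from fo_ex[OF this P]
  show ?case unfolding f(2)
    by (rule fo_fun_length[OF F, where Q = "\<lambda>x N e. \<exists>a\<le>f' (N # e). P (F x) (a # e)"])
qed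

lemma fo_fun_comp:
  assumes F: "fo_fun F" and G: "fo_fun G"
  shows "fo_fun (\<lambda>x. G (F x))"
  unfolding fo_fun_def
proof (intro conjI)
  show "fo (\<lambda>x e. var 0 e < length (G (F x)))"
    by (rule fo_comp[OF _ F]) (use G in \<open>simp add: fo_fun_def\<close>)
  show "fo (\<lambda>x e. var 0 e < length (G (F x)) \<and> G (F x) ! var 0 e)"
    by (rule fo_comp[OF _ F, where P = "\<lambda>x e. var 0 e < length (G x) \<and> G x ! var 0 e"])
      (use G in \<open>simp add: fo_fun_def\<close>)
  obtain c where c: "\<And>x. length (F x) \<le> (length x + 2) ^ c"
    using F unfolding fo_fun_def by blast
  obtain d where d: "\<And>x. length (G x) \<le> (length x + 2) ^ d"
    using G unfolding fo_fun_def by blast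
  \<comment> \<open>The bound for \<open>G\<close> has the base \<open>length (F x) + 2\<close>;
    raising \<open>c\<close> to \<open>c + 2\<close> absorbs the summand 2.\<close>
  have "length (G (F x)) \<le> (length x + 2) ^ ((c + 2) * d)" for x
  proof -
    let ?m = "length x + 2"
    have p: "?m ^ c \<le> ?m ^ (c + 1)" "?m \<le> ?m ^ (c + 1)"
      by (rule power_increasing; simp) (rule self_le_power; simp)
    have "2 * ?m ^ (c + 1) \<le> ?m * ?m ^ (c + 1)" by (intro mult_le_mono1) simp
    then have "length (F x) + 2 \<le> ?m ^ (c + 2)"
      using c[of x] p power_Suc[of ?m "c + 1"] by (simp only: Suc_eq_plus1 add.assoc one_add_one)
    then have "(length (F x) + 2) ^ d \<le> (?m ^ (c + 2)) ^ d" by (rule power_mono) simp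
    then show ?thesis using d[of "F x"] unfolding power_mult by linarith
  qed
  then show "\<exists>c. \<forall>x. length (G (F x)) \<le> (length x + 2) ^ c" by blast
qed

section \<open>The output format of pairs of gates\<close>

lemma map_upt_double:
  "map f [2 * M..<2 * (M + k)] = concat (map (\<lambda>i. [f (2 * i), f (Suc (2 * i))]) [M..<M + k])"
proof (induction k)
  case (Suc k)
  have "[2 * M..<2 * (M + Suc k)] = [2 * M..<2 * (M + k)] @ [2 * (M + k), Suc (2 * (M + k))]"
    by simp
  then show ?case by (simp only: map_append Suc.IH) simp
qed simp

lemma output_pairs:
  assumes "length y \<le> N"
    and even: "\<And>i. f (2 * i) \<longleftrightarrow> i < length y" and odd: "\<And>i. f (Suc (2 * i)) \<longleftrightarrow> i < length y \<and> y ! i"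
  shows "map f [0..<2 * N] = concat (map (\<lambda>b. [True, b]) y) @ replicate (2 * (N - length y)) False"
proof -
  let ?g = "\<lambda>i. [f (2 * i), f (Suc (2 * i))]"
  have "[0..<N] = [0..<length y] @ [length y..<length y + (N - length y)]"
    using assms(1) upt_add_eq_append[of 0 "length y" "N - length y"] by simp
  then have "map f [0..<2 * N] =
      concat (map ?g [0..<length y]) @ concat (map ?g [length y..<length y + (N - length y)])"
    using map_upt_double[of f 0 N] by (simp only: add_0 mult_0_right map_append concat_append)
  also have "map ?g [0..<length y] = map (\<lambda>b. [True, b]) y"
    by (rule nth_equalityI) (simp_all add: even odd)
  also have "map ?g [length y..<length y + (N - length y)] =
      map (\<lambda>i. [False, False]) [length y..<length y + (N - length y)]"
    by (rule map_cong) (simp_all add: even odd)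
  also have "concat (map (\<lambda>i. [False, False]) [length y..<length y + k]) = replicate (2 * k) False" for k
    by (induction k) (simp_all add: replicate_app_Cons_same)
  finally show ?thesis .
qed

lemma fo_fun_AC0_computable:
  assumes F: "fo_fun F"
  shows "uniform_AC0_computable F"
proof -
  obtain q where q: "\<And>x. length (F x) \<le> (length x + 2) ^ q"
    using F unfolding fo_fun_def by blast
  define P where "P x i \<longleftrightarrow> (\<exists>j\<le>i. (i = 2 * j \<and> j < length (F x)) \<or>
      (i = Suc (2 * j) \<and> j < length (F x) \<and> F x ! j))" for x i
  have P: "P x (2 * i) \<longleftrightarrow> i < length (F x)" "P x (Suc (2 * i)) \<longleftrightarrow> i < length (F x) \<and> F x ! i" for x i
    unfolding P_def by (simp_all add: double_not_eq_Suc_double Suc_double_not_eq_double)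
  have "fo (\<lambda>x e. P x (var 0 e))"
    unfolding P_def by (intro fo_fun_less_length[OF F] fo_fun_nth[OF F] fo_intros)
  \<comment> \<open>With one variable, gate \<open>u\<close> belongs to the assignment
    \<open>[fst (prod_decode u)]\<close>. The output gate for \<open>a\<close> must have the number
    \<open>a\<close> itself, so one more layer reads gate \<open>prod_encode (a, 0)\<close>.\<close>
  from fo_layered[OF this, of 1]
  have "layered (\<lambda>x u. P x (fst (prod_decode u)))" by simp
  moreover have "delta0 (\<lambda>e. (\<lambda>n a b. 2 * b = (a + 0) * Suc (a + 0) + 2 * a) (var 0 e) (var 1 e) (var 2 e))"
    by (intro delta0_intros)
  moreover have "\<exists>l. \<forall>n a b. a < (n + 2) ^ k \<longrightarrow> 2 * b = (a + 0) * Suc (a + 0) + 2 * a \<longrightarrow> b < (n + 2) ^ l" for k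
  proof -
    have "b < ((n + 2) ^ (k + 1)) ^ (2 * (1 + 3) + 1)"
      if "a < (n + 2) ^ k" "b = prod_encode (a, 0)" for n a b
    proof -
      have "(n + 2) ^ k \<le> (n + 2) ^ (k + 1)" by (rule power_increasing; simp)
      moreover have "n + 2 \<le> (n + 2) ^ (k + 1)" by (rule self_le_power; simp)
      ultimately have "a \<le> ((n + 2) ^ (k + 1)) ^ 1" "2 \<le> (n + 2) ^ (k + 1)"
        using that(1) by (simp_all only: power_one_right)
      then show ?thesis unfolding that(2) by (intro prod_encode_bound le0)
    qed
    then show ?thesis
      unfolding prod_encode_eq_iff[symmetric] power_mult[symmetric]
      by (intro exI[of _ "(k + 1) * (2 * (1 + 3) + 1)"] allI impI)
  qed
  ultimately have "layered (\<lambda>x a. \<exists>b. 2 * b = (a + 0) * Suc (a + 0) + 2 * a \<and> P x (fst (prod_decode b)))"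
    by (rule layered_ex[where R = "\<lambda>n a b. 2 * b = (a + 0) * Suc (a + 0) + 2 * a"
          and P = "\<lambda>x b. P x (fst (prod_decode b))"])
  then have "layered P" unfolding prod_encode_eq_iff[symmetric] by simp
  then show ?thesis
  proof (rule layered_imp_AC0_computable)
    fix x
    show "\<exists>k. map (P x) [0..<2 * (length x + 2) ^ q] =
        concat (map (\<lambda>b. [True, b]) (F x)) @ replicate (2 * k) False"
      by (rule exI, rule output_pairs[OF q P])
  qed
qed

text \<open>Transitivity is substitution of formulas on this level, so the circuits of two
  reductions are never composed.\<close>

definition fo_reducible :: "bool list set \<Rightarrow> bool list set \<Rightarrow> bool" where
  "fo_reducible A B \<longleftrightarrow> (\<exists>F. fo_fun F \<and> (\<forall>x. x \<in> A \<longleftrightarrow> F x \<in> B))"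

lemma fo_reducible_trans:
  assumes "fo_reducible A B" "fo_reducible B C"
  shows "fo_reducible A C"
proof -
  obtain F where F: "fo_fun F" "\<And>x. x \<in> A \<longleftrightarrow> F x \<in> B"
    using assms(1) unfolding fo_reducible_def by blast
  obtain G where G: "fo_fun G" "\<And>x. x \<in> B \<longleftrightarrow> G x \<in> C"
    using assms(2) unfolding fo_reducible_def by blast
  show ?thesis
    unfolding fo_reducible_def
  proof (intro exI conjI allI)
    show "fo_fun (\<lambda>x. G (F x))" by (rule fo_fun_comp[OF F(1) G(1)])
    show "x \<in> A \<longleftrightarrow> G (F x) \<in> C" for x by (simp add: F(2) G(2))
  qed
qed

lemma fo_reducible_AC0: "fo_reducible A B \<Longrightarrow> A \<le>\<^sub>A\<^sub>C\<^sub>0 B"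
  unfolding fo_reducible_def AC0_reducible_def using fo_fun_AC0_computable by blast

section \<open>Functions defined from a parse of the input\<close>

definition bit_at :: "bool list \<Rightarrow> nat \<Rightarrow> bool" where
  "bit_at x i \<longleftrightarrow> i < length x \<and> x ! i"

lemma fo_bit_at: "poly_fun f \<Longrightarrow> fo (\<lambda>x e. bit_at x (f x e))"
  unfolding bit_at_def by (rule fo_bit)

lemma fo_app3:
  assumes "fo (\<lambda>x e. R x (var 0 e) (var 1 e) (var 2 e))" "poly_fun f" "poly_fun g" "poly_fun h"
  shows "fo (\<lambda>x e. R x (f x e) (g x e) (h x e))"
proof -
  have "poly_fun (\<lambda>x e. var i [f x e, g x e, h x e])" for i by (intro poly_fun_Cons poly_fun_Nil assms)
  from fo_subst[OF assms(1) this] show ?thesis by simp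
qed

lemma fo_app4:
  assumes "fo (\<lambda>x e. R x (var 0 e) (var 1 e) (var 2 e) (var 3 e))" "poly_fun f" "poly_fun g" "poly_fun h" "poly_fun k"
  shows "fo (\<lambda>x e. R x (f x e) (g x e) (h x e) (k x e))"
proof -
  have "poly_fun (\<lambda>x e. var i [f x e, g x e, h x e, k x e])" for i by (intro poly_fun_Cons poly_fun_Nil assms)
  from fo_subst[OF assms(1) this] show ?thesis by simp
qed

lemma poly_fun_app3:
  assumes "poly_fun (\<lambda>x e. R x (var 0 e) (var 1 e) (var 2 e))" "poly_fun f" "poly_fun g" "poly_fun h"
  shows "poly_fun (\<lambda>x e. R x (f x e) (g x e) (h x e))"
proof -
  have "poly_fun (\<lambda>x e. var i [f x e, g x e, h x e])" for i by (intro poly_fun_Cons poly_fun_Nil assms)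
  from poly_fun_subst[OF assms(1) this] show ?thesis by simp
qed

text \<open>The three parameters are the numbers that describe the parsed instance \<open>x\<close>.\<close>

lemma fo_fun_parse:
  assumes parse: "fo (\<lambda>x e. parse x (var 0 e) (var 1 e) (var 2 e))"
    and le: "\<And>x a b c. parse x a b c \<Longrightarrow> a \<le> length x \<and> b \<le> length x \<and> c \<le> length x"
    and len: "poly_fun (\<lambda>x e. len x (var 0 e) (var 1 e) (var 2 e))"
    and bits: "fo (\<lambda>x e. bits x (var 0 e) (var 1 e) (var 2 e) (var 3 e))"
    and F: "\<And>x a b c. parse x a b c \<Longrightarrow> length (F x) = len x a b c"
      "\<And>x a b c i. parse x a b c \<Longrightarrow> i < len x a b c \<Longrightarrow> F x ! i = bits x a b c i"
      "\<And>x. (\<And>a b c. \<not> parse x a b c) \<Longrightarrow> F x = []"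
  shows "fo_fun F"
proof -
  have "i < length (F x) \<longleftrightarrow> (\<exists>a\<le>length x. \<exists>b\<le>length x. \<exists>c\<le>length x. parse x a b c \<and> i < len x a b c)" for i x
    using le[of x] F(1)[of x] F(3)[of x] by (metis list.size(3) not_less_zero)
  moreover have "fo (\<lambda>x e. \<exists>a\<le>length x. \<exists>b\<le>length x. \<exists>c\<le>length x. parse x a b c \<and> var 0 e < len x a b c)"
    by (intro fo_app3[OF parse] poly_fun_app3[OF len] fo_intros)
  ultimately have 1: "fo (\<lambda>x e. var 0 e < length (F x))" by simp
  have "i < length (F x) \<and> F x ! i \<longleftrightarrow>
      (\<exists>a\<le>length x. \<exists>b\<le>length x. \<exists>c\<le>length x. parse x a b c \<and> i < len x a b c \<and> bits x a b c i)" for i x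
    using le[of x] F[of x] by (metis list.size(3) not_less_zero)
  moreover have "fo (\<lambda>x e. \<exists>a\<le>length x. \<exists>b\<le>length x. \<exists>c\<le>length x.
      parse x a b c \<and> var 0 e < len x a b c \<and> bits x a b c (var 0 e))"
    by (intro fo_app3[OF parse] poly_fun_app3[OF len] fo_app4[OF bits] fo_intros)
  ultimately have 2: "fo (\<lambda>x e. var 0 e < length (F x) \<and> F x ! var 0 e)" by simp
  obtain f where f: "term_fun f" "\<And>x e. len x (var 0 e) (var 1 e) (var 2 e) = f (length x # e)"
    using len unfolding poly_fun_def by blast
  obtain l where l: "\<And>M e. 2 \<le> M \<Longrightarrow> (\<forall>i. var i e \<le> M) \<Longrightarrow> f e \<le> M ^ l"
    using term_fun_poly_bound[OF f(1)] by blast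
  have "length (F x) \<le> (length x + 2) ^ l" for x
  proof (cases "\<exists>a b c. parse x a b c")
    case True
    then obtain a b c where p: "parse x a b c" by blast
    have "var i [length x, a, b, c] \<le> length x + 2" for i
      using le[OF p] by (auto simp: var_def nth_Cons split: nat.split)
    then have "f [length x, a, b, c] \<le> (length x + 2) ^ l" by (intro l) simp_all
    then show ?thesis using F(1)[OF p] f(2)[of x "[a, b, c]"] by simp
  next
    case False
    then show ?thesis using F(3)[of x] by simp
  qed
  then show ?thesis unfolding fo_fun_def using 1 2 by blast
qed

text \<open>A unique parse makes the constructed instance a function of the string. The default
  \<open>[]\<close> is safe because it belongs to none of the three languages.\<close>

lemma parse_function:
  assumes "\<And>x a b c a' b' c'. parse x a b c \<Longrightarrow> parse x a' b' c' \<Longrightarrow> a = a' \<and> b = b' \<and> c = c'"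
  obtains F :: "bool list \<Rightarrow> bool list" where
    "\<And>x a b c. parse x a b c \<Longrightarrow> F x = code x a b c"
    "\<And>x. (\<And>a b c. \<not> parse x a b c) \<Longrightarrow> F x = []"
proof
  let ?F = "\<lambda>x. if \<exists>a b c. parse x a b c
      then (case SOME (a, b, c). parse x a b c of (a, b, c) \<Rightarrow> code x a b c) else []"
  show "?F x = code x a b c" if p: "parse x a b c" for x a b c
  proof -
    have ex: "\<exists>a b c. parse x a b c" using p by blast
    have "(SOME (a, b, c). parse x a b c) = (a, b, c)"
    proof (rule some_equality)
      fix q assume "case q of (a, b, c) \<Rightarrow> parse x a b c"
      then show "q = (a, b, c)" using assms[OF p] by (cases q) simp
    qed (simp add: p)
    then show ?thesis unfolding if_P[OF ex] by simp
  qed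
  show "?F x = []" if none: "\<And>a b c. \<not> parse x a b c" for x
    by (rule if_not_P) (use none in blast)
qed

section \<open>Reading the codes of instances\<close>

lemma nth_concat_uniform:
  assumes "\<forall>l\<in>set ls. length l = n" "i < length ls" "j < n"
  shows "concat ls ! (i * n + j) = ls ! i ! j"
  using assms
proof (induction ls arbitrary: i)
  case (Cons l ls)
  then show ?case by (cases i) (auto simp: nth_append)
qed simp

lemma length_concat_uniform: "\<forall>l\<in>set ls. length l = n \<Longrightarrow> length (concat ls) = length ls * n"
  by (induction ls) simp_all

lemma radix_cases:
  fixes p m n :: nat
  assumes "p < m * n"
  obtains a b where "a < m" "b < n" "p = a * n + b"
proof
  show "p div n < m" "p mod n < n" "p = p div n * n + p mod n"
    using assms by (simp_all add: less_mult_imp_div_less) (metis gr_zeroI mod_less_divisor mult_is_0 not_less_zero)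
qed

section \<open>Codes of bipartite graphs\<close>

lemma length_lfmm_code: "length (lfmm_code m n E t) = m + n + 2 + n + m * n"
  by (simp add: lfmm_code_def unary_def length_concat_uniform[where n = n])

lemma nth_lfmm_code:
  shows "i < m \<Longrightarrow> lfmm_code m n E t ! i"
    and "\<not> lfmm_code m n E t ! m"
    and "i < n \<Longrightarrow> lfmm_code m n E t ! (m + 1 + i)"
    and "\<not> lfmm_code m n E t ! (m + n + 1)"
    and "i < n \<Longrightarrow> lfmm_code m n E t ! (m + n + 2 + i) \<longleftrightarrow> i = t"
    and "a < m \<Longrightarrow> b < n \<Longrightarrow> lfmm_code m n E t ! (m + n + 2 + n + (a * n + b)) \<longleftrightarrow> (a, b) \<in> E"
proof -
  have rows: "\<forall>l\<in>set (map (\<lambda>i. map (\<lambda>j. (i, j) \<in> E) [0..<n]) [0..<m]). length l = n" by simp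
  show "lfmm_code m n E t ! (m + n + 2 + n + (a * n + b)) \<longleftrightarrow> (a, b) \<in> E" if "a < m" "b < n"
    using nth_concat_uniform[OF rows, of a b] that
    by (simp add: lfmm_code_def unary_def nth_append)
qed (simp_all add: lfmm_code_def unary_def nth_append char_vec_def)

lemma lfmm_index_cases:
  fixes p m n :: nat
  assumes "p < m + n + 2 + n + m * n"
  obtains "p < m" | "p = m" | i where "i < n" "p = m + 1 + i" | "p = m + n + 1"
    | i where "i < n" "p = m + n + 2 + i"
    | a b where "a < m" "b < n" "p = m + n + 2 + n + (a * n + b)"
proof -
  consider "p < m" | "p = m" | "m < p" "p < m + 1 + n" | "p = m + n + 1"
    | "m + n + 2 \<le> p" "p < m + n + 2 + n" | "m + n + 2 + n \<le> p" by linarith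
  then show ?thesis
  proof cases
    case 3
    then show ?thesis by (intro that(3)[of "p - (m + 1)"]) auto
  next
    case 5
    then show ?thesis by (intro that(5)[of "p - (m + n + 2)"]) auto
  next
    case 6
    then have "p - (m + n + 2 + n) < m * n" using assms by linarith
    then obtain a b where "a < m" "b < n" "p - (m + n + 2 + n) = a * n + b" by (rule radix_cases)
    then show ?thesis using 6 by (intro that(6)[of a b]) auto
  qed (use that in auto)
qed

text \<open>Listing the positions of the ones block by block puts the code into the form of a
  first-order formula in \<open>p\<close>. The reduction with graphs as values is shown definable in
  this way.\<close>

lemma lfmm_code_bit:
  assumes "t < n" "p < m + n + 2 + n + m * n"
  shows "lfmm_code m n E t ! p \<longleftrightarrow> p < m \<or> (\<exists>i<n. p = m + 1 + i) \<or> p = m + n + 2 + t \<or>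
    (\<exists>a<m. \<exists>b<n. p = m + n + 2 + n + (a * n + b) \<and> (a, b) \<in> E)" (is "_ \<longleftrightarrow> ?R")
proof
  assume "lfmm_code m n E t ! p"
  note code = this
  from assms(2) show ?R
  proof (cases rule: lfmm_index_cases)
    case 2
    then show ?thesis using code nth_lfmm_code(2) by metis
  next
    case 4
    then show ?thesis using code nth_lfmm_code(4) by metis
  next
    case (5 i)
    then have "i = t" using code nth_lfmm_code(5) by metis
    then show ?thesis using 5 by blast
  next
    case (6 a b)
    then have "(a, b) \<in> E" using code nth_lfmm_code(6) by metis
    then show ?thesis using 6 by blast
  qed blast+
next
  assume ?R
  then show "lfmm_code m n E t ! p"
    using nth_lfmm_code[where m = m and n = n and E = E and t = t] assms(1) by blast
qed

text \<open>Every adjacency matrix is legal, so only the length and the header are checked. All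
  positions are terms in the parameters.\<close>

definition lfmm_parse :: "bool list \<Rightarrow> nat \<Rightarrow> nat \<Rightarrow> nat \<Rightarrow> bool" where
  "lfmm_parse x m n t \<longleftrightarrow> length x = m + n + 2 + n + m * n \<and> t < n \<and>
     (\<forall>i<m. bit_at x i) \<and> \<not> bit_at x m \<and> (\<forall>i<n. bit_at x (m + 1 + i)) \<and> \<not> bit_at x (m + n + 1) \<and>
     (\<forall>i<n. bit_at x (m + n + 2 + i) \<longleftrightarrow> i = t)"

definition lfmm_edge :: "bool list \<Rightarrow> nat \<Rightarrow> nat \<Rightarrow> nat \<Rightarrow> nat \<Rightarrow> bool" where
  "lfmm_edge x m n a b \<longleftrightarrow> bit_at x (m + n + 2 + n + (a * n + b))"

definition lfmm_edges :: "bool list \<Rightarrow> nat \<Rightarrow> nat \<Rightarrow> (nat \<times> nat) set" where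
  "lfmm_edges x m n = {(a, b). a < m \<and> b < n \<and> lfmm_edge x m n a b}"

lemma radix_less: "a < m \<Longrightarrow> b < n \<Longrightarrow> a * n + b < m * (n::nat)"
  by (metis add.commute add_less_le_mono less_le_trans mult_Suc mult_le_mono1 Suc_leI nat_add_left_cancel_less)

lemma lfmm_parse_code:
  assumes "bipartite_graph m n E" "t < n"
  shows "lfmm_parse (lfmm_code m n E t) m n t" "lfmm_edges (lfmm_code m n E t) m n = E"
proof -
  note [simp] = nth_lfmm_code
  show "lfmm_parse (lfmm_code m n E t) m n t"
    unfolding lfmm_parse_def bit_at_def length_lfmm_code using assms(2)
    by (auto simp del: add_2_eq_Suc' add_Suc_right One_nat_def Suc_eq_plus1_left)
  have "lfmm_edge (lfmm_code m n E t) m n a b \<longleftrightarrow> (a, b) \<in> E" if "a < m" "b < n" for a b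
    unfolding lfmm_edge_def bit_at_def length_lfmm_code nth_lfmm_code(6)[OF that]
    using radix_less[OF that] by simp
  then show "lfmm_edges (lfmm_code m n E t) m n = E"
    using assms(1) unfolding lfmm_edges_def bipartite_graph_def by auto
qed

lemma bipartite_lfmm_edges: "bipartite_graph m n (lfmm_edges x m n)"
  unfolding bipartite_graph_def lfmm_edges_def by auto

lemma lfmm_parse_eq:
  assumes "lfmm_parse x m n t"
  shows "x = lfmm_code m n (lfmm_edges x m n) t"
proof (rule nth_equalityI)
  show len: "length x = length (lfmm_code m n (lfmm_edges x m n) t)"
    using assms by (simp add: lfmm_parse_def length_lfmm_code)
  fix p assume p: "p < length x"
  then have "p < m + n + 2 + n + m * n" using assms by (simp add: lfmm_parse_def)
  then show "x ! p = lfmm_code m n (lfmm_edges x m n) t ! p"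
  proof (cases rule: lfmm_index_cases)
    case (6 a b)
    then show ?thesis using p
      by (simp only: nth_lfmm_code) (simp add: lfmm_edges_def lfmm_edge_def bit_at_def)
  qed (use assms p nth_lfmm_code in \<open>auto simp: lfmm_parse_def bit_at_def simp del: add_2_eq_Suc' add_Suc_right\<close>)
qed

lemma fo_lfmm_parse: "fo (\<lambda>x e. lfmm_parse x (var 0 e) (var 1 e) (var 2 e))"
  unfolding lfmm_parse_def by (intro fo_bit_at fo_intros)

lemma fo_lfmm_edge:
  assumes "poly_fun f" "poly_fun g" "poly_fun h" "poly_fun k"
  shows "fo (\<lambda>x e. lfmm_edge x (f x e) (g x e) (h x e) (k x e))"
  unfolding lfmm_edge_def by (intro fo_bit_at fo_intros assms)

lemma lfmm_parse_le:
  assumes "lfmm_parse x m n t"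
  shows "m \<le> length x \<and> n \<le> length x \<and> t \<le> length x"
  using assms by (auto simp: lfmm_parse_def)

lemma not_lfmm_parse_vLfmm:
  assumes "\<And>m n t. \<not> lfmm_parse x m n t"
  shows "x \<notin> vLfmm" "x \<notin> three_vLfmm"
  using assms lfmm_parse_code(1) unfolding vLfmm_def three_vLfmm_def by blast+

lemma lfmm_code_vLfmm_iff:
  assumes "bipartite_graph m n E" "t < n"
  shows "lfmm_code m n E t \<in> vLfmm \<longleftrightarrow> top_matched m E t"
    and "lfmm_code m n E t \<in> three_vLfmm \<longleftrightarrow> max_degree_le 3 m n E \<and> top_matched m E t"
  using assms lfmm_code_inject[OF _ assms] unfolding vLfmm_def three_vLfmm_def by blast+

section \<open>Codes of comparator circuits\<close>

lemma length_ccv_code: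
  assumes "length y = m"
  shows "length (ccv_code m gs y w) = 3 * m + 1 + length gs * (2 * m)"
proof -
  have "\<forall>l\<in>set (map (\<lambda>(i, j). char_vec m i @ char_vec m j) gs). length l = 2 * m" by auto
  from length_concat_uniform[OF this] show ?thesis
    using assms by (simp add: ccv_code_def unary_def)
qed

lemma nth_ccv_code:
  assumes "length y = m"
  shows "i < m \<Longrightarrow> ccv_code m gs y w ! i"
    and "\<not> ccv_code m gs y w ! m"
    and "i < m \<Longrightarrow> ccv_code m gs y w ! (m + 1 + i) \<longleftrightarrow> y ! i"
    and "i < m \<Longrightarrow> ccv_code m gs y w ! (2 * m + 1 + i) \<longleftrightarrow> i = w"
    and "k < length gs \<Longrightarrow> i < m \<Longrightarrow> ccv_code m gs y w ! (3 * m + 1 + (k * (2 * m) + i)) \<longleftrightarrow> i = fst (gs ! k)"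
    and "k < length gs \<Longrightarrow> i < m \<Longrightarrow> ccv_code m gs y w ! (3 * m + 1 + (k * (2 * m) + (m + i))) \<longleftrightarrow> i = snd (gs ! k)"
proof -
  let ?rows = "map (\<lambda>(i, j). char_vec m i @ char_vec m j) gs"
  have rows: "\<forall>l\<in>set ?rows. length l = 2 * m" by auto
  have *: "ccv_code m gs y w ! (3 * m + 1 + i) = concat ?rows ! i" for i
  proof -
    have "length (unary m @ y @ char_vec m w) = 3 * m + 1" using assms by (simp add: unary_def)
    then show ?thesis unfolding ccv_code_def by (metis append.assoc nth_append_length_plus)
  qed
  show "ccv_code m gs y w ! (3 * m + 1 + (k * (2 * m) + i)) \<longleftrightarrow> i = fst (gs ! k)" if "k < length gs" "i < m"
    using nth_concat_uniform[OF rows, of k i] that unfolding *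
    by (simp add: nth_append char_vec_def split_beta)
  show "ccv_code m gs y w ! (3 * m + 1 + (k * (2 * m) + (m + i))) \<longleftrightarrow> i = snd (gs ! k)" if "k < length gs" "i < m"
    using nth_concat_uniform[OF rows, of k "m + i"] that unfolding *
    by (simp add: nth_append char_vec_def split_beta)
qed (use assms in \<open>simp_all add: ccv_code_def unary_def nth_append char_vec_def\<close>)

lemma ccv_index_cases:
  fixes p m l :: nat
  assumes "p < 3 * m + 1 + l * (2 * m)"
  obtains "p < m" | "p = m" | i where "i < m" "p = m + 1 + i" | i where "i < m" "p = 2 * m + 1 + i"
    | k i where "k < l" "i < m" "p = 3 * m + 1 + (k * (2 * m) + i)"
    | k i where "k < l" "i < m" "p = 3 * m + 1 + (k * (2 * m) + (m + i))"
proof -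
  consider "p < m" | "p = m" | "m < p" "p < m + 1 + m"
    | "2 * m + 1 \<le> p" "p < 3 * m + 1" | "3 * m + 1 \<le> p" by linarith
  then show ?thesis
  proof cases
    case 3
    then show ?thesis by (intro that(3)[of "p - (m + 1)"]) auto
  next
    case 4
    then show ?thesis by (intro that(4)[of "p - (2 * m + 1)"]) auto
  next
    case 5
    then have "p - (3 * m + 1) < l * (2 * m)" using assms by linarith
    then obtain k b where kb: "k < l" "b < 2 * m" "p - (3 * m + 1) = k * (2 * m) + b" by (rule radix_cases)
    then have p: "p = 3 * m + 1 + (k * (2 * m) + b)" using 5 by linarith
    show ?thesis
    proof (cases "b < m")
      case True
      with kb p show ?thesis by (intro that(5))
    next
      case False
      then have "b - m < m" "p = 3 * m + 1 + (k * (2 * m) + (m + (b - m)))" using kb(2) p by auto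
      with kb(1) show ?thesis by (rule that(6))
    qed
  qed (use that in auto)
qed

lemma comparator_circuit_nth:
  assumes "comparator_circuit m gs" "k < length gs"
  shows "fst (gs ! k) < m" "snd (gs ! k) < m" "fst (gs ! k) \<noteq> snd (gs ! k)"
proof -
  have "case gs ! k of (i, j) \<Rightarrow> i < m \<and> j < m \<and> i \<noteq> j"
    using assms(1) nth_mem[OF assms(2)] unfolding comparator_circuit_def by (rule bspec)
  then show "fst (gs ! k) < m" "snd (gs ! k) < m" "fst (gs ! k) \<noteq> snd (gs ! k)"
    by (simp_all add: split_beta)
qed

lemma ccv_code_bit:
  assumes gs: "comparator_circuit m gs" and y: "length y = m" and w: "w < m"
    and p: "p < 3 * m + 1 + length gs * (2 * m)"
  shows "ccv_code m gs y w ! p \<longleftrightarrow> p < m \<or> (\<exists>i<m. p = m + 1 + i \<and> y ! i) \<or> p = 2 * m + 1 + w \<or>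
    (\<exists>k<length gs. p = 3 * m + 1 + (k * (2 * m) + fst (gs ! k)) \<or>
      p = 3 * m + 1 + (k * (2 * m) + (m + snd (gs ! k))))" (is "_ \<longleftrightarrow> ?R")
proof
  assume code: "ccv_code m gs y w ! p"
  from p show ?R
  proof (cases rule: ccv_index_cases)
    case 2
    then show ?thesis using code nth_ccv_code(2)[OF y, of gs w] by simp
  next
    case (3 i)
    then have "y ! i" using code nth_ccv_code(3)[OF y 3(1), of gs w] by simp
    then show ?thesis using 3 by blast
  next
    case (4 i)
    then have "i = w" using code nth_ccv_code(4)[OF y 4(1), of gs w] by simp
    then show ?thesis using 4 by blast
  next
    case (5 k i)
    then have "i = fst (gs ! k)" using code nth_ccv_code(5)[OF y 5(1,2), of w] by simp
    with 5 have "k < length gs" "p = 3 * m + 1 + (k * (2 * m) + fst (gs ! k))" by simp_all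
    then show ?thesis by blast
  next
    case (6 k i)
    then have "i = snd (gs ! k)" using code nth_ccv_code(6)[OF y 6(1,2), of w] by simp
    with 6 have "k < length gs" "p = 3 * m + 1 + (k * (2 * m) + (m + snd (gs ! k)))" by simp_all
    then show ?thesis by blast
  qed blast
next
  note lt = comparator_circuit_nth[OF gs]
  assume ?R
  then show "ccv_code m gs y w ! p"
  proof (elim disjE exE conjE)
    fix k assume k: "k < length gs" "p = 3 * m + 1 + (k * (2 * m) + fst (gs ! k))"
    show ?thesis unfolding k(2) nth_ccv_code(5)[OF y k(1) lt(1)[OF k(1)]] by simp
  next
    fix k assume k: "k < length gs" "p = 3 * m + 1 + (k * (2 * m) + (m + snd (gs ! k)))"
    show ?thesis unfolding k(2) nth_ccv_code(6)[OF y k(1) lt(2)[OF k(1)]] by simp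
  qed (simp_all only: nth_ccv_code(1,3,4)[OF y] w HOL.simp_thms)
qed

definition ccv_first :: "bool list \<Rightarrow> nat \<Rightarrow> nat \<Rightarrow> nat \<Rightarrow> bool" where
  "ccv_first x m k i \<longleftrightarrow> bit_at x (3 * m + 1 + (k * (2 * m) + i))"

definition ccv_second :: "bool list \<Rightarrow> nat \<Rightarrow> nat \<Rightarrow> nat \<Rightarrow> bool" where
  "ccv_second x m k i \<longleftrightarrow> bit_at x (3 * m + 1 + (k * (2 * m) + (m + i)))"

text \<open>The number \<open>l\<close> of gates is not written in the code but follows from the
  length, as \<open>w < m\<close> makes \<open>m\<close> positive. Unlike a matrix row, a gate block
  can be illegal: it must consist of two different unit vectors.\<close>

definition ccv_parse :: "bool list \<Rightarrow> nat \<Rightarrow> nat \<Rightarrow> nat \<Rightarrow> bool" where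
  "ccv_parse x m l w \<longleftrightarrow> length x = 3 * m + 1 + l * (2 * m) \<and> w < m \<and>
     (\<forall>i<m. bit_at x i) \<and> \<not> bit_at x m \<and> (\<forall>i<m. bit_at x (2 * m + 1 + i) \<longleftrightarrow> i = w) \<and>
     (\<forall>k<l. \<exists>i<m. \<exists>j<m. i \<noteq> j \<and>
       (\<forall>s<m. (ccv_first x m k s \<longleftrightarrow> s = i) \<and> (ccv_second x m k s \<longleftrightarrow> s = j)))"

lemma ccv_parse_code:
  assumes gs: "comparator_circuit m gs" and y: "length y = m" and w: "w < m"
  shows "ccv_parse (ccv_code m gs y w) m (length gs) w"
    and "k < length gs \<Longrightarrow> i < m \<Longrightarrow> ccv_first (ccv_code m gs y w) m k i \<longleftrightarrow> i = fst (gs ! k)"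
    and "k < length gs \<Longrightarrow> i < m \<Longrightarrow> ccv_second (ccv_code m gs y w) m k i \<longleftrightarrow> i = snd (gs ! k)"
    and "i < m \<Longrightarrow> bit_at (ccv_code m gs y w) (m + 1 + i) \<longleftrightarrow> y ! i"
proof -
  let ?x = "ccv_code m gs y w"
  have less: "3 * m + 1 + (k * (2 * m) + b) < 3 * m + 1 + length gs * (2 * m)" if "k < length gs" "b < 2 * m" for k b
    using radix_less[OF that] by simp
  show fst: "ccv_first ?x m k i \<longleftrightarrow> i = fst (gs ! k)" if "k < length gs" "i < m" for k i
    unfolding ccv_first_def bit_at_def length_ccv_code[OF y] nth_ccv_code(5)[OF y that]
    using less[OF that(1), of i] that(2) by simp
  show snd: "ccv_second ?x m k i \<longleftrightarrow> i = snd (gs ! k)" if "k < length gs" "i < m" for k i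
    unfolding ccv_second_def bit_at_def length_ccv_code[OF y] nth_ccv_code(6)[OF y that]
    using less[OF that(1), of "m + i"] that(2) by simp
  show "bit_at ?x (m + 1 + i) \<longleftrightarrow> y ! i" if "i < m" for i
    unfolding bit_at_def length_ccv_code[OF y] nth_ccv_code(3)[OF y that] using that by simp
  note lt = comparator_circuit_nth[OF gs]
  show "ccv_parse ?x m (length gs) w"
    unfolding ccv_parse_def
  proof (intro conjI allI impI)
    show "bit_at ?x (2 * m + 1 + i) \<longleftrightarrow> i = w" if "i < m" for i
      unfolding bit_at_def length_ccv_code[OF y] nth_ccv_code(4)[OF y that] using that by simp
    show "\<exists>i<m. \<exists>j<m. i \<noteq> j \<and> (\<forall>s<m. (ccv_first ?x m k s \<longleftrightarrow> s = i) \<and> (ccv_second ?x m k s \<longleftrightarrow> s = j))"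
      if "k < length gs" for k
      using lt[OF that] fst[OF that] snd[OF that] by blast
  qed (use y w nth_ccv_code(1,2)[OF y] in \<open>simp_all add: length_ccv_code bit_at_def\<close>)
qed

lemma ccv_parseE:
  assumes "ccv_parse x m l w"
  obtains gs y where "comparator_circuit m gs" "length y = m" "w < m" "length gs = l" "x = ccv_code m gs y w"
proof -
  have "\<forall>k\<in>{..<l}. \<exists>ij. fst ij < m \<and> snd ij < m \<and> fst ij \<noteq> snd ij \<and>
      (\<forall>s<m. (ccv_first x m k s \<longleftrightarrow> s = fst ij) \<and> (ccv_second x m k s \<longleftrightarrow> s = snd ij))"
    using assms unfolding ccv_parse_def by fastforce
  then obtain g where g: "\<And>k. k < l \<Longrightarrow> fst (g k) < m \<and> snd (g k) < m \<and> fst (g k) \<noteq> snd (g k) \<and>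
      (\<forall>s<m. (ccv_first x m k s \<longleftrightarrow> s = fst (g k)) \<and> (ccv_second x m k s \<longleftrightarrow> s = snd (g k)))"
    unfolding bchoice_iff by (metis lessThan_iff)
  define gs where "gs = map g [0..<l]"
  define y where "y = map (\<lambda>i. bit_at x (m + 1 + i)) [0..<m]"
  have y: "length y = m" by (simp add: y_def)
  have l: "length gs = l" by (simp add: gs_def)
  have gs: "comparator_circuit m gs"
    unfolding comparator_circuit_def gs_def using g by (auto simp: split_beta)
  have w: "w < m" and len: "length x = 3 * m + 1 + l * (2 * m)" using assms by (auto simp: ccv_parse_def)
  have "x = ccv_code m gs y w"
  proof (rule nth_equalityI)
    show "length x = length (ccv_code m gs y w)" by (simp add: length_ccv_code[OF y] len l)
    fix p assume p: "p < length x"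
    then have "p < 3 * m + 1 + l * (2 * m)" by (simp add: len)
    then show "x ! p = ccv_code m gs y w ! p"
    proof (cases rule: ccv_index_cases)
      case 1
      then show ?thesis using assms nth_ccv_code(1)[OF y] by (auto simp: ccv_parse_def bit_at_def)
    next
      case 2
      then show ?thesis using assms nth_ccv_code(2)[OF y] p by (auto simp: ccv_parse_def bit_at_def)
    next
      case (3 i)
      then have "y ! i = x ! p" using p by (simp add: y_def bit_at_def)
      then show ?thesis using nth_ccv_code(3)[OF y 3(1)] 3(2) by metis
    next
      case (4 i)
      then have "bit_at x p \<longleftrightarrow> i = w" using assms by (simp add: ccv_parse_def)
      then show ?thesis using nth_ccv_code(4)[OF y 4(1)] 4(2) p unfolding bit_at_def by metis
    next
      case (5 k i)
      then have "bit_at x p \<longleftrightarrow> i = fst (gs ! k)" using g[OF 5(1)] unfolding ccv_first_def gs_def by simp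
      then show ?thesis using nth_ccv_code(5)[OF y, of k gs i] 5 p l unfolding bit_at_def by metis
    next
      case (6 k i)
      then have "bit_at x p \<longleftrightarrow> i = snd (gs ! k)" using g[OF 6(1)] unfolding ccv_second_def gs_def by simp
      then show ?thesis using nth_ccv_code(6)[OF y, of k gs i] 6 p l unfolding bit_at_def by metis
    qed
  qed
  then show ?thesis using that gs y w l by blast
qed

lemma fo_ccv_first:
  assumes "poly_fun f" "poly_fun g" "poly_fun h"
  shows "fo (\<lambda>x e. ccv_first x (f x e) (g x e) (h x e))"
  unfolding ccv_first_def by (intro fo_bit_at fo_intros assms)

lemma fo_ccv_second:
  assumes "poly_fun f" "poly_fun g" "poly_fun h"
  shows "fo (\<lambda>x e. ccv_second x (f x e) (g x e) (h x e))"
  unfolding ccv_second_def by (intro fo_bit_at fo_intros assms)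

lemma fo_ccv_parse: "fo (\<lambda>x e. ccv_parse x (var 0 e) (var 1 e) (var 2 e))"
  unfolding ccv_parse_def by (intro fo_bit_at fo_ccv_first fo_ccv_second fo_intros)

lemma ccv_parse_le:
  assumes "ccv_parse x m l w"
  shows "m \<le> length x \<and> l \<le> length x \<and> w \<le> length x"
proof -
  have "0 < m" "length x = 3 * m + 1 + l * (2 * m)" "w < m" using assms by (auto simp: ccv_parse_def)
  moreover have "l * 1 \<le> l * (2 * m)" using \<open>0 < m\<close> by (intro mult_le_mono2) simp
  ultimately show ?thesis by linarith
qed

lemma not_ccv_parse_Ccv:
  assumes "\<And>m l w. \<not> ccv_parse x m l w"
  shows "x \<notin> Ccv"
  using assms ccv_parse_code(1) unfolding Ccv_def by blast

lemma ccv_code_Ccv_iff: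
  assumes "comparator_circuit m gs" "length y = m" "w < m"
  shows "ccv_code m gs y w \<in> Ccv \<longleftrightarrow> comparator_run gs (\<lambda>i. y ! i) w"
  using assms ccv_code_inject[OF _ assms] unfolding Ccv_def by blast

lemma Nil_not_instance: "[] \<notin> Ccv" "[] \<notin> vLfmm" "[] \<notin> three_vLfmm"
  by (auto simp: Ccv_def vLfmm_def three_vLfmm_def ccv_code_def lfmm_code_def unary_def)

section \<open>Restricting the degree\<close>

text \<open>A constant bound on the degree is first-order, with three witnesses covering the
  neighbours. They range up to \<open>n\<close> inclusive, so that \<open>n\<close>, which is not a
  node, can fill in if there are fewer than three neighbours.\<close>

lemma card_le_3_iff:
  fixes n :: nat
  assumes "A \<subseteq> {..<n}"
  shows "card A \<le> 3 \<longleftrightarrow> (\<exists>a\<le>n. \<exists>b\<le>n. \<exists>c\<le>n. \<forall>j<n. j \<in> A \<longrightarrow> j = a \<or> j = b \<or> j = c)"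
proof
  assume card: "card A \<le> 3"
  have "finite A" using assms finite_subset by blast
  then obtain xs where xs: "set xs = A" "distinct xs" using finite_distinct_list by blast
  then have "length xs \<le> 3" using card distinct_card by metis
  have "\<exists>a\<le>n. \<exists>b\<le>n. \<exists>c\<le>n. set xs \<subseteq> {a, b, c}"
  proof -
    define g where "g i = (if i < length xs then xs ! i else n)" for i
    have le: "g i \<le> n" for i
    proof (cases "i < length xs")
      case True
      then have "xs ! i \<in> {..<n}" using xs(1) assms nth_mem by blast
      then show ?thesis using True by (simp add: g_def)
    qed (simp add: g_def)
    have "set xs \<subseteq> {g 0, g 1, g 2}"
    proof
      fix a assume "a \<in> set xs"
      then obtain i where "i < length xs" "a = xs ! i" by (auto simp: in_set_conv_nth)
      then have "i = 0 \<or> i = 1 \<or> i = 2" "a = g i"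
        using \<open>length xs \<le> 3\<close> by (linarith, simp add: g_def)
      then show "a \<in> {g 0, g 1, g 2}" by (elim disjE) simp_all
    qed
    with le show ?thesis by (intro exI[of _ "g 0"] exI[of _ "g 1"] exI[of _ "g 2"] conjI)
  qed
  then obtain a b c where "a \<le> n" "b \<le> n" "c \<le> n" "A \<subseteq> {a, b, c}"
    unfolding xs(1) by (elim exE conjE)
  then show "\<exists>a\<le>n. \<exists>b\<le>n. \<exists>c\<le>n. \<forall>j<n. j \<in> A \<longrightarrow> j = a \<or> j = b \<or> j = c"
    by (intro exI[of _ a] exI[of _ b] exI[of _ c] conjI) auto
next
  assume "\<exists>a\<le>n. \<exists>b\<le>n. \<exists>c\<le>n. \<forall>j<n. j \<in> A \<longrightarrow> j = a \<or> j = b \<or> j = c"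
  then obtain a b c where "\<forall>j<n. j \<in> A \<longrightarrow> j = a \<or> j = b \<or> j = c" by (elim exE conjE)
  then have "A \<subseteq> {a, b, c}" using assms by auto
  then have "card A \<le> card {a, b, c}" by (intro card_mono) auto
  also have "\<dots> \<le> 3" by (simp add: card_insert_if)
  finally show "card A \<le> 3" .
qed

lemma fo_reducible_three_vLfmm_vLfmm: "fo_reducible three_vLfmm vLfmm"
proof -
  let ?rows = "\<lambda>x m n. \<forall>i<m. \<exists>a\<le>n. \<exists>b\<le>n. \<exists>c\<le>n. \<forall>j<n. lfmm_edge x m n i j \<longrightarrow> j = a \<or> j = b \<or> j = c"
  let ?cols = "\<lambda>x m n. \<forall>j<n. \<exists>a\<le>m. \<exists>b\<le>m. \<exists>c\<le>m. \<forall>i<m. lfmm_edge x m n i j \<longrightarrow> i = a \<or> i = b \<or> i = c"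
  define parse where "parse x m n t \<longleftrightarrow> lfmm_parse x m n t \<and> ?rows x m n \<and> ?cols x m n" for x m n t
  have deg: "max_degree_le 3 m n (lfmm_edges x m n) \<longleftrightarrow> ?rows x m n \<and> ?cols x m n" for x m n
  proof -
    have "card {j. (i, j) \<in> lfmm_edges x m n} \<le> 3 \<longleftrightarrow>
        (\<exists>a\<le>n. \<exists>b\<le>n. \<exists>c\<le>n. \<forall>j<n. lfmm_edge x m n i j \<longrightarrow> j = a \<or> j = b \<or> j = c)" if "i < m" for i
    proof -
      have "{j. (i, j) \<in> lfmm_edges x m n} \<subseteq> {..<n}" by (auto simp: lfmm_edges_def)
      from card_le_3_iff[OF this] show ?thesis
        using that by (simp add: lfmm_edges_def cong: imp_cong)
    qed
    moreover have "card {i. (i, j) \<in> lfmm_edges x m n} \<le> 3 \<longleftrightarrow>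
        (\<exists>a\<le>m. \<exists>b\<le>m. \<exists>c\<le>m. \<forall>i<m. lfmm_edge x m n i j \<longrightarrow> i = a \<or> i = b \<or> i = c)" if "j < n" for j
    proof -
      have "{i. (i, j) \<in> lfmm_edges x m n} \<subseteq> {..<m}" by (auto simp: lfmm_edges_def)
      from card_le_3_iff[OF this] show ?thesis
        using that by (simp add: lfmm_edges_def cong: imp_cong)
    qed
    ultimately show ?thesis unfolding max_degree_le_def by simp
  qed
  \<comment> \<open>Graphs of larger degree must not keep a positive answer, so they go to
    \<open>[]\<close> together with the strings that code nothing.\<close>
  define F where "F x = (if \<exists>m n t. parse x m n t then x else [])" for x
  have "fo_fun F"
  proof (rule fo_fun_parse[where parse = parse and len = "\<lambda>x _ _ _. length x" and bits = "\<lambda>x _ _ _. bit_at x"])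
    show "fo (\<lambda>x e. parse x (var 0 e) (var 1 e) (var 2 e))"
      unfolding parse_def by (intro fo_app3[OF fo_lfmm_parse] fo_lfmm_edge fo_intros)
    show "m \<le> length x \<and> n \<le> length x \<and> t \<le> length x" if "parse x m n t" for x m n t
      using that lfmm_parse_le unfolding parse_def by blast
    show "poly_fun (\<lambda>x e. length x)" by (rule poly_fun_length)
    show "fo (\<lambda>x e. bit_at x (var 3 e))" by (intro fo_bit_at poly_fun_intros)
    show "length (F x) = length x" if "parse x m n t" for x m n t
      using that by (auto simp: F_def)
    show "F x ! i = bit_at x i" if "parse x m n t" "i < length x" for x m n t i
      using that by (auto simp: F_def bit_at_def)
    show "F x = []" if "\<And>m n t. \<not> parse x m n t" for x
      using that by (simp add: F_def)
  qed
  moreover have "x \<in> three_vLfmm \<longleftrightarrow> F x \<in> vLfmm" for x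
  proof (cases "\<exists>m n t. lfmm_parse x m n t")
    case True
    then obtain m n t where p: "lfmm_parse x m n t" by blast
    let ?E = "lfmm_edges x m n"
    have t: "t < n" using p by (simp add: lfmm_parse_def)
    note x = lfmm_parse_eq[OF p]
    note iff = lfmm_code_vLfmm_iff[OF bipartite_lfmm_edges[of m n x] t]
    show ?thesis
    proof (cases "\<exists>m n t. parse x m n t")
      case True
      then obtain m' n' t' where p': "parse x m' n' t'" by blast
      have t': "t' < n'" using p' by (simp add: parse_def lfmm_parse_def)
      have x': "x = lfmm_code m' n' (lfmm_edges x m' n') t'" using p' lfmm_parse_eq by (simp add: parse_def)
      have "max_degree_le 3 m' n' (lfmm_edges x m' n')" using p' unfolding deg parse_def by blast
      then have "x \<in> three_vLfmm \<longleftrightarrow> x \<in> vLfmm"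
        using lfmm_code_vLfmm_iff[OF bipartite_lfmm_edges[of m' n' x] t'] x' by metis
      then show ?thesis using True by (simp add: F_def)
    next
      case False
      then have "\<not> max_degree_le 3 m n ?E" using p unfolding deg parse_def by blast
      then have "x \<notin> three_vLfmm" using iff(2) x by metis
      then show ?thesis using False by (simp add: F_def Nil_not_instance)
    qed
  next
    case False
    then have "F x = []" unfolding F_def parse_def by simp
    then show ?thesis using not_lfmm_parse_vLfmm[of x] False Nil_not_instance by metis
  qed
  ultimately show ?thesis unfolding fo_reducible_def by blast
qed

section \<open>From matchings to comparator circuits\<close>

text \<open>Bottom nodes are wires \<open>0, \<dots>, m - 1\<close>, carrying whether the node is still unmatched, and top
  nodes are the next \<open>n\<close> wires, carrying whether the node is matched. One gate per pair of
  nodes, in lexicographic order, offers the top node to the bottom node; the gates of non-edges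
  act on two idle wires.\<close>

definition lfmm_gate :: "nat \<Rightarrow> nat \<Rightarrow> (nat \<times> nat) set \<Rightarrow> nat \<Rightarrow> nat \<times> nat" where
  "lfmm_gate m n E k =
     (if (k div n, k mod n) \<in> E then (k div n, m + k mod n) else (m + n, m + n + 1))"

text \<open>With a gate for each pair of nodes, the place of a gate in the code is a term in the
  pair. If non-edges were left out, it would depend on the number of earlier edges, and counting is
  beyond these formulas.\<close>

definition lfmm_gates :: "nat \<Rightarrow> nat \<Rightarrow> (nat \<times> nat) set \<Rightarrow> (nat \<times> nat) list" where
  "lfmm_gates m n E = map (lfmm_gate m n E) [0..<m * n]"

definition lfmm_state :: "nat \<Rightarrow> nat \<Rightarrow> (nat \<times> nat) set \<Rightarrow> nat \<Rightarrow> nat \<Rightarrow> bool" where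
  "lfmm_state m n E k = comparator_run (map (lfmm_gate m n E) [0..<k]) (\<lambda>i. i < m)"

lemma lfmm_state_Suc:
  "lfmm_state m n E (Suc k) = comparator_gate (lfmm_gate m n E k) (lfmm_state m n E k)"
  by (simp add: lfmm_state_def comparator_run_def)

lemma snd_lfm_matching_Suc:
  "snd ` lfm_matching E (Suc i) = snd ` lfm_matching E i \<union>
     (if available E (lfm_matching E i) i = {} then {} else {LEAST j. j \<in> available E (lfm_matching E i) i})"
  by (simp add: Let_def)

text \<open>The wires after the bottom nodes below \<open>i\<close> have been processed and the top nodes below
  \<open>j\<close> have been offered to the bottom node \<open>i\<close>.\<close>

definition lfmm_invar :: "nat \<Rightarrow> nat \<Rightarrow> (nat \<times> nat) set \<Rightarrow> nat \<Rightarrow> nat \<Rightarrow> (nat \<Rightarrow> bool) \<Rightarrow> bool" where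
  "lfmm_invar m n E i j v \<longleftrightarrow>
     (let A = available E (lfm_matching E i) i in
      (\<forall>s<n. v (m + s) \<longleftrightarrow> s \<in> snd ` lfm_matching E i \<or> (s < j \<and> s \<in> A \<and> (\<forall>r<s. r \<notin> A))) \<and>
      (\<forall>r<m. i < r \<longrightarrow> v r) \<and> (i < m \<longrightarrow> (v i \<longleftrightarrow> (\<forall>s<j. s \<notin> A))))"

text \<open>On (bottom, top) the gate turns (1, 0), both unmatched, into (0, 1), both matched. It
  fixes the other three pairs, where the bottom node has its partner already or the top node is
  taken.\<close>

lemma lfmm_invar_gate:
  assumes inv: "lfmm_invar m n E i j v" and ij: "i < m" "j < n"
  shows "lfmm_invar m n E i (Suc j) (comparator_gate (lfmm_gate m n E (i * n + j)) v)"
proof -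
  let ?M = "snd ` lfm_matching E i"
  define A where "A = available E (lfm_matching E i) i"
  have A: "s \<in> A \<longleftrightarrow> (i, s) \<in> E \<and> s \<notin> ?M" for s by (simp add: A_def available_def)
  have dm: "(i * n + j) div n = i" "(i * n + j) mod n = j" using ij by simp_all
  have v: "\<And>s. s < n \<Longrightarrow> v (m + s) \<longleftrightarrow> s \<in> ?M \<or> (s < j \<and> s \<in> A \<and> (\<forall>r<s. r \<notin> A))"
    "\<And>r. r < m \<Longrightarrow> i < r \<Longrightarrow> v r" "v i \<longleftrightarrow> (\<forall>s<j. s \<notin> A)"
    using inv ij unfolding lfmm_invar_def A_def Let_def by blast+
  define v' where "v' = comparator_gate (lfmm_gate m n E (i * n + j)) v"
  have vj: "v (m + j) \<longleftrightarrow> j \<in> ?M" using v(1)[OF ij(2)] by simp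
  have "v' (m + s) \<longleftrightarrow> s \<in> ?M \<or> (s < Suc j \<and> s \<in> A \<and> (\<forall>r<s. r \<notin> A))" if s: "s < n" for s
  proof (cases "s = j")
    case True
    show ?thesis
      unfolding v'_def lfmm_gate_def dm using True vj v(3) ij A[of j] by auto
  next
    case False
    then have "v' (m + s) = v (m + s)"
      unfolding v'_def lfmm_gate_def dm using s ij by auto
    then show ?thesis using v(1)[OF s] False by (simp add: less_Suc_eq)
  qed
  moreover have "v' r" if "r < m" "i < r" for r
    unfolding v'_def lfmm_gate_def dm using v(2)[OF that] that by auto
  moreover have "v' i \<longleftrightarrow> (\<forall>s<Suc j. s \<notin> A)"
    unfolding v'_def lfmm_gate_def dm All_less_Suc using vj v(3) ij A[of j] by auto
  ultimately show ?thesis unfolding lfmm_invar_def v'_def[symmetric] A_def[symmetric] Let_def by blast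
qed

text \<open>After all \<open>n\<close> top nodes have been offered, every available one has had its
  turn. The first available node of the invariant is then the \<open>LEAST\<close> in the definition
  of the matching.\<close>

lemma lfmm_invar_next:
  assumes E: "bipartite_graph m n E" and inv: "lfmm_invar m n E i n v"
  shows "lfmm_invar m n E (Suc i) 0 v"
proof -
  let ?M = "snd ` lfm_matching E i"
  define A where "A = available E (lfm_matching E i) i"
  have An: "A \<subseteq> {..<n}" using E by (auto simp: A_def available_def bipartite_graph_def)
  have "s \<in> snd ` lfm_matching E (Suc i) \<longleftrightarrow> s \<in> ?M \<or> (s \<in> A \<and> (\<forall>r<s. r \<notin> A))" for s
  proof -
    have "A \<noteq> {} \<Longrightarrow> s = (LEAST j. j \<in> A) \<longleftrightarrow> s \<in> A \<and> (\<forall>r<s. r \<notin> A)"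
      by (metis LeastI_ex not_less_Least ex_in_conv linorder_neqE_nat)
    then show ?thesis unfolding snd_lfm_matching_Suc A_def[symmetric] by auto
  qed
  then show ?thesis
    using inv unfolding lfmm_invar_def A_def[symmetric] Let_def by auto
qed

lemma lfmm_invar_0: "lfmm_invar m n E 0 0 (\<lambda>i. i < m)"
  by (auto simp: lfmm_invar_def Let_def)

lemma lfmm_invar_state:
  assumes E: "bipartite_graph m n E" and "i \<le> m"
  shows "lfmm_invar m n E i 0 (lfmm_state m n E (i * n))"
  using assms(2)
proof (induction i)
  case 0
  show ?case using lfmm_invar_0 by (simp add: lfmm_state_def comparator_run_def)
next
  case (Suc i)
  have "j \<le> n \<Longrightarrow> lfmm_invar m n E i j (lfmm_state m n E (i * n + j))" for j
  proof (induction j)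
    case 0
    show ?case using Suc by simp
  next
    case (Suc j)
    then show ?case
      using lfmm_invar_gate[of m n E i j] \<open>Suc i \<le> m\<close> by (simp add: lfmm_state_Suc)
  qed
  from lfmm_invar_next[OF E this[OF order_refl]] show ?case by (simp add: add.commute)
qed

text \<open>The invariant starts from a predicate on all numbers, whereas an instance supplies a
  list that fixes the values of its own wires only.\<close>

lemma comparator_run_cong:
  assumes "comparator_circuit N gs" "\<And>i. i < N \<Longrightarrow> u i = u' i" "i < N"
  shows "comparator_run gs u i = comparator_run gs u' i"
  using assms
proof (induction gs arbitrary: u u')
  case (Cons g gs)
  obtain a b where g: "g = (a, b)" by fastforce
  have "comparator_run gs (comparator_gate g u) i = comparator_run gs (comparator_gate g u') i"
    using Cons.prems g by (intro Cons.IH) (auto simp: comparator_circuit_def)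
  then show ?case by (simp add: comparator_run_def)
qed (simp add: comparator_run_def)

lemma circuit_lfmm_gates:
  assumes "bipartite_graph m n E"
  shows "comparator_circuit (m + n + 2) (lfmm_gates m n E)"
proof -
  have "case lfmm_gate m n E k of (i, j) \<Rightarrow> i < m + n + 2 \<and> j < m + n + 2 \<and> i \<noteq> j" for k
    using assms unfolding lfmm_gate_def bipartite_graph_def by auto
  then show ?thesis unfolding comparator_circuit_def lfmm_gates_def by simp
qed

lemma lfmm_gates_correct:
  assumes "bipartite_graph m n E" "t < n"
  shows "comparator_run (lfmm_gates m n E) (\<lambda>i. map (\<lambda>i. i < m) [0..<m + n + 2] ! i) (m + t) \<longleftrightarrow>
    top_matched m E t"
proof -
  have "comparator_run (lfmm_gates m n E) (\<lambda>i. map (\<lambda>i. i < m) [0..<m + n + 2] ! i) (m + t) =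
      lfmm_state m n E (m * n) (m + t)"
    unfolding lfmm_state_def lfmm_gates_def[symmetric]
    by (rule comparator_run_cong[OF circuit_lfmm_gates[OF assms(1)]])
      (use assms(2) in \<open>simp_all del: upt_Suc add_2_eq_Suc'\<close>)
  then show ?thesis
    using lfmm_invar_state[OF assms(1) order_refl] assms(2)
    by (simp add: lfmm_invar_def Let_def top_matched_def)
qed

lemma fo_reducible_vLfmm_Ccv: "fo_reducible vLfmm Ccv"
proof -
  define code where "code x m n t =
      ccv_code (m + n + 2) (lfmm_gates m n (lfmm_edges x m n)) (map (\<lambda>i. i < m) [0..<m + n + 2]) (m + t)" for x m n t
  have unique: "m = m' \<and> n = n' \<and> t = t'" if "lfmm_parse x m n t" "lfmm_parse x m' n' t'" for x m n t m' n' t'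
  proof -
    have t: "t < n" "t' < n'" using that by (simp_all add: lfmm_parse_def)
    have "lfmm_code m n (lfmm_edges x m n) t = lfmm_code m' n' (lfmm_edges x m' n') t'"
      by (rule trans[OF lfmm_parse_eq[OF that(1), symmetric] lfmm_parse_eq[OF that(2)]])
    from lfmm_code_inject[OF this bipartite_lfmm_edges t(1) bipartite_lfmm_edges t(2)]
    show ?thesis by blast
  qed
  obtain F where F: "\<And>x m n t. lfmm_parse x m n t \<Longrightarrow> F x = code x m n t"
    and F_Nil: "\<And>x. (\<And>m n t. \<not> lfmm_parse x m n t) \<Longrightarrow> F x = []"
    using parse_function[of lfmm_parse code] unique by blast
  have circuit: "comparator_circuit (m + n + 2) (lfmm_gates m n (lfmm_edges x m n))"
    "length (map (\<lambda>i. i < m) [0..<m + n + 2]) = m + n + 2" for x m n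
    by (rule circuit_lfmm_gates[OF bipartite_lfmm_edges]) simp
  have len_gates: "length (lfmm_gates m n E) = m * n" for m n E by (simp add: lfmm_gates_def)
  let ?len = "\<lambda>m n. 3 * (m + n + 2) + 1 + m * n * (2 * (m + n + 2))"
  let ?base = "\<lambda>m n a b. 3 * (m + n + 2) + 1 + (a * n + b) * (2 * (m + n + 2))"
  let ?bits = "\<lambda>x m n t p. p < m + n + 2 \<or> (\<exists>i<m. p = m + n + 2 + 1 + i) \<or> p = 2 * (m + n + 2) + 1 + (m + t) \<or>
    (\<exists>a<m. \<exists>b<n.
      (lfmm_edge x m n a b \<and> (p = ?base m n a b + a \<or> p = ?base m n a b + (m + n + 2 + (m + b)))) \<or>
      (\<not> lfmm_edge x m n a b \<and> (p = ?base m n a b + (m + n) \<or> p = ?base m n a b + (m + n + 2 + (m + n + 1)))))"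
  have "fo_fun F"
  proof (rule fo_fun_parse[where parse = lfmm_parse and len = "\<lambda>x m n t. ?len m n" and bits = ?bits,
        OF fo_lfmm_parse lfmm_parse_le])
    show "poly_fun (\<lambda>x e. ?len (var 0 e) (var 1 e))" by (intro poly_fun_intros)
    show "fo (\<lambda>x e. ?bits x (var 0 e) (var 1 e) (var 2 e) (var 3 e))"
      by (intro fo_lfmm_edge fo_intros)
    show "length (F x) = ?len m n" if "lfmm_parse x m n t" for x m n t
      unfolding F[OF that] code_def length_ccv_code[OF circuit(2)] len_gates ..
    show "F x ! p = ?bits x m n t p" if parse: "lfmm_parse x m n t" and p: "p < ?len m n" for x m n t p
    proof -
      let ?E = "lfmm_edges x m n"
      have t: "m + t < m + n + 2" using parse by (simp add: lfmm_parse_def)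
      \<comment> \<open>Gate \<open>k\<close> finds its nodes by division, which is not a term; in
        the formula quotient and remainder are quantified instead. \<open>Q\<close> is arbitrary in
        order to treat both wires of the gate together.\<close>
      have "(\<exists>k<m * n. Q (lfmm_gates m n ?E ! k) k) \<longleftrightarrow>
          (\<exists>a<m. \<exists>b<n. (lfmm_edge x m n a b \<and> Q (a, m + b) (a * n + b)) \<or>
            (\<not> lfmm_edge x m n a b \<and> Q (m + n, m + n + 1) (a * n + b)))" (is "?L = ?R") for Q
      proof -
        have "lfmm_gates m n ?E ! (a * n + b) = (if lfmm_edge x m n a b then (a, m + b) else (m + n, m + n + 1))"
          if "a < m" "b < n" for a b
          using that radix_less[OF that] by (simp add: lfmm_gates_def lfmm_gate_def lfmm_edges_def)
        note nth = this
        show ?thesis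
        proof
          assume ?L
          then obtain k where k: "k < m * n" "Q (lfmm_gates m n ?E ! k) k" by blast
          obtain a b where "a < m" "b < n" "k = a * n + b" using k(1) by (rule radix_cases)
          then have "(lfmm_edge x m n a b \<and> Q (a, m + b) (a * n + b)) \<or>
              (\<not> lfmm_edge x m n a b \<and> Q (m + n, m + n + 1) (a * n + b))"
            using k(2) nth[of a b] by (cases "lfmm_edge x m n a b") simp_all
          then show ?R using \<open>a < m\<close> \<open>b < n\<close> by blast
        next
          assume ?R
          then obtain a b where ab: "a < m" "b < n" "(lfmm_edge x m n a b \<and> Q (a, m + b) (a * n + b)) \<or>
              (\<not> lfmm_edge x m n a b \<and> Q (m + n, m + n + 1) (a * n + b))"
            by (elim exE conjE)
          then have "Q (lfmm_gates m n ?E ! (a * n + b)) (a * n + b)"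
            using nth[OF ab(1,2)] by (cases "lfmm_edge x m n a b") simp_all
          then show ?L using radix_less[OF ab(1,2)] by (intro exI conjI)
        qed
      qed
      note gates = this[of "\<lambda>g k. p = 3 * (m + n + 2) + 1 + (k * (2 * (m + n + 2)) + fst g) \<or>
        p = 3 * (m + n + 2) + 1 + (k * (2 * (m + n + 2)) + (m + n + 2 + snd g))"]
      have ym: "(\<exists>i<m + n + 2. p = m + n + 2 + 1 + i \<and> map (\<lambda>i. i < m) [0..<m + n + 2] ! i) \<longleftrightarrow>
          (\<exists>i<m. p = m + n + 2 + 1 + i)"
      proof -
        have "map (\<lambda>i. i < m) [0..<m + n + 2] ! i \<longleftrightarrow> i < m" if "i < m + n + 2" for i
          using that by (simp del: upt_Suc add_2_eq_Suc')
        then show ?thesis by (auto simp del: upt_Suc add_2_eq_Suc')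
      qed
      have "F x ! p \<longleftrightarrow> p < m + n + 2 \<or> (\<exists>i<m. p = m + n + 2 + 1 + i) \<or> p = 2 * (m + n + 2) + 1 + (m + t) \<or>
        (\<exists>k<m * n. p = 3 * (m + n + 2) + 1 + (k * (2 * (m + n + 2)) + fst (lfmm_gates m n ?E ! k)) \<or>
          p = 3 * (m + n + 2) + 1 + (k * (2 * (m + n + 2)) + (m + n + 2 + snd (lfmm_gates m n ?E ! k))))"
        unfolding F[OF parse] code_def
        using ccv_code_bit[OF circuit t, of p x, unfolded len_gates ym, OF p] .
      then show ?thesis unfolding gates by (simp only: fst_conv snd_conv add.assoc)
    qed
    show "F x = []" if "\<And>m n t. \<not> lfmm_parse x m n t" for x
      by (rule F_Nil) (rule that)
  qed
  moreover have "x \<in> vLfmm \<longleftrightarrow> F x \<in> Ccv" for x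
  proof (cases "\<exists>m n t. lfmm_parse x m n t")
    case True
    then obtain m n t where p: "lfmm_parse x m n t" by blast
    let ?E = "lfmm_edges x m n"
    have t: "t < n" using p by (simp add: lfmm_parse_def)
    have "x \<in> vLfmm \<longleftrightarrow> top_matched m ?E t"
      by (rule trans[OF arg_cong[OF lfmm_parse_eq[OF p], of "\<lambda>z. z \<in> vLfmm"]
            lfmm_code_vLfmm_iff(1)[OF bipartite_lfmm_edges t]])
    moreover have "F x \<in> Ccv \<longleftrightarrow> top_matched m ?E t"
    proof -
      have "m + t < m + n + 2" using t by simp
      from ccv_code_Ccv_iff[OF circuit this] show ?thesis
        unfolding F[OF p] code_def lfmm_gates_correct[OF bipartite_lfmm_edges t] .
    qed
    ultimately show ?thesis by simp
  next
    case False
    then have "F x = []" using F_Nil by blast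
    then show ?thesis using not_lfmm_parse_vLfmm[of x] False Nil_not_instance by metis
  qed
  ultimately show ?thesis unfolding fo_reducible_def by blast
qed

section \<open>From comparator circuits to matchings of degree three\<close>

lemma radix_inject:
  fixes m :: nat
  assumes "a * m + b = a' * m + b'" "b < m" "b' < m"
  shows "a = a' \<and> b = b'"
proof -
  have "(a * m + b) div m = a" "(a' * m + b') div m = a'" using assms(2,3) by simp_all
  then have "a = a'" using assms(1) by simp
  then show ?thesis using assms(1) by simp
qed

text \<open>Top node \<open>node k w\<close> stands for wire \<open>w\<close> after the first \<open>k\<close> gates. The node of the wire that
  gate \<open>k - 1\<close> turned into a conjunction comes after all other nodes of its layer, so that the
  node of the disjunction is matched first.\<close>

locale layered_graph =
  fixes m :: nat and gs :: "(nat \<times> nat) list" and y :: "bool list"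
  assumes circuit: "comparator_circuit m gs" and length_y: "length y = m"
begin

definition node :: "nat \<Rightarrow> nat \<Rightarrow> nat" where
  "node k w = k * (2 * m) + ((case k of 0 \<Rightarrow> 0 | Suc k' \<Rightarrow> if w = fst (gs ! k') then m else 0) + w)"

text \<open>A bottom node passed on by one wire of gate \<open>k\<close> may take the node of either
  wire. The order of these two nodes then makes the greedy choice compute disjunction and
  conjunction.\<close>

definition linked :: "nat \<Rightarrow> nat \<Rightarrow> nat \<Rightarrow> bool" where
  "linked k w w' \<longleftrightarrow> w = w' \<or> (w \<in> {fst (gs ! k), snd (gs ! k)} \<and> w' \<in> {fst (gs ! k), snd (gs ! k)})"

text \<open>The bottom nodes below \<open>m\<close> enter the inputs into layer 0, isolated if the
  input is 0. The bottom node \<open>Suc k * m + w\<close> belongs to wire \<open>w\<close> between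
  the layers \<open>k\<close> and \<open>Suc k\<close>.\<close>

definition edge :: "nat \<Rightarrow> nat \<Rightarrow> bool" where
  "edge b u \<longleftrightarrow> (b < m \<and> y ! b \<and> u = b) \<or>
     (\<exists>k<length gs. \<exists>w<m. b = Suc k * m + w \<and>
       (u = node k w \<or> (\<exists>w'<m. linked k w w' \<and> u = node (Suc k) w')))"

definition edges :: "(nat \<times> nat) set" where
  "edges = {(b, u). edge b u}"

definition matched :: "nat \<Rightarrow> nat set" where
  "matched b = snd ` lfm_matching edges b"

definition wire :: "nat \<Rightarrow> nat \<Rightarrow> bool" where
  "wire k = comparator_run (take k gs) (\<lambda>i. y ! i)"

lemma node_0: "node 0 w = w"
  by (simp add: node_def)

lemma node_bounds:
  assumes "w < m"
  shows "k * (2 * m) \<le> node k w" "node k w < Suc k * (2 * m)"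
  using assms by (auto simp: node_def split: nat.split)

text \<open>Since a layer lies entirely before the next one, a bottom node prefers its own node of
  the present layer.\<close>

lemma node_less:
  assumes "w < m" "w' < m" "k < k'"
  shows "node k w < node k' w'"
proof -
  have "Suc k * (2 * m) \<le> k' * (2 * m)" using assms(3) by (intro mult_le_mono1) simp
  then show ?thesis using node_bounds[OF assms(1), of k] node_bounds[OF assms(2), of k'] by linarith
qed

lemma node_inject:
  assumes "w < m" "w' < m"
  shows "node k w = node k' w' \<longleftrightarrow> k = k' \<and> w = w'"
proof
  assume eq: "node k w = node k' w'"
  then have k: "k = k'"
    using node_less[OF assms, of k k'] node_less[OF assms(2,1), of k' k] by (metis less_irrefl linorder_neqE_nat)
  define d where "d v = (case k of 0 \<Rightarrow> 0 | Suc k' \<Rightarrow> if v = fst (gs ! k') then (1::nat) else 0)" for v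
  have "node k v = k * (2 * m) + (d v * m + v)" for v
    by (simp add: node_def d_def split: nat.split)
  then have "d w * m + w = d w' * m + w'" using eq k by simp
  then show "k = k' \<and> w = w'" using radix_inject assms k by blast
qed simp

lemma node_snd_less_fst: "k < length gs \<Longrightarrow> node (Suc k) (snd (gs ! k)) < node (Suc k) (fst (gs ! k))"
  using comparator_circuit_nth[OF circuit, of k] by (simp add: node_def)

lemma edge_layer:
  assumes "k < length gs" "c < m"
  shows "edge (Suc k * m + c) u \<longleftrightarrow> u = node k c \<or> (\<exists>w<m. linked k c w \<and> u = node (Suc k) w)"
proof -
  have "\<not> Suc k * m + c < m" by simp
  moreover have "Suc k * m + c = Suc k' * m + w \<longleftrightarrow> k = k' \<and> c = w" if "w < m" for k' w
    using radix_inject[of "Suc k" m c "Suc k'" w] assms(2) that by auto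
  ultimately have "edge (Suc k * m + c) u \<longleftrightarrow> (\<exists>k'<length gs. \<exists>w<m. k = k' \<and> c = w \<and>
      (u = node k' w \<or> (\<exists>w'<m. linked k' w w' \<and> u = node (Suc k') w')))"
    unfolding edge_def by (simp only: simp_thms conj_assoc cong: conj_cong)
  then show ?thesis using assms by auto
qed

lemma edge_first:
  assumes "b < m"
  shows "edge b u \<longleftrightarrow> y ! b \<and> u = node 0 b"
  using assms unfolding edge_def node_0 by auto

lemma matched_0: "matched 0 = {}"
  by (simp add: matched_def)

lemma matched_Suc_min:
  assumes "edge b u" "u \<notin> matched b" "\<And>v. edge b v \<Longrightarrow> v \<notin> matched b \<Longrightarrow> u \<le> v"
  shows "matched (Suc b) = insert u (matched b)"
proof -
  let ?A = "available edges (lfm_matching edges b) b"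
  have A: "v \<in> ?A \<longleftrightarrow> edge b v \<and> v \<notin> matched b" for v
    by (simp add: available_def edges_def matched_def)
  have "(LEAST v. v \<in> ?A) = u" unfolding A by (rule Least_equality) (use assms in auto)
  moreover have "?A \<noteq> {}" using A assms by blast
  ultimately show ?thesis by (simp add: matched_def Let_def)
qed

lemma matched_Suc_none:
  assumes "\<And>v. edge b v \<Longrightarrow> v \<in> matched b"
  shows "matched (Suc b) = matched b"
proof -
  have "available edges (lfm_matching edges b) b = {}"
    using assms by (auto simp: available_def edges_def matched_def)
  then show ?thesis by (simp add: matched_def Let_def)
qed

lemma matched_inputs: "b \<le> m \<Longrightarrow> matched b = {w. w < b \<and> y ! w}"
proof (induction b)
  case (Suc b)
  then have IH: "matched b = {w. w < b \<and> y ! w}" and b: "b < m" by simp_all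
  show ?case
  proof (cases "y ! b")
    case True
    have "matched (Suc b) = insert b (matched b)"
      by (rule matched_Suc_min) (use True in \<open>auto simp: edge_first[OF b] node_0 IH\<close>)
    then show ?thesis using True IH by (auto simp: less_Suc_eq)
  next
    case False
    have "matched (Suc b) = matched b"
      by (rule matched_Suc_none) (use False in \<open>auto simp: edge_first[OF b]\<close>)
    then show ?thesis using False IH by (auto simp: less_Suc_eq)
  qed
qed (simp add: matched_0)

lemma wire_Suc:
  assumes "k < length gs"
  shows "wire (Suc k) w =
    (if w = fst (gs ! k) then wire k (fst (gs ! k)) \<and> wire k (snd (gs ! k))
     else if w = snd (gs ! k) then wire k (fst (gs ! k)) \<or> wire k (snd (gs ! k)) else wire k w)"
proof -
  have "wire (Suc k) = comparator_gate (gs ! k) (wire k)"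
    using assms by (simp add: wire_def comparator_run_def take_Suc_conv_app_nth)
  moreover obtain i j where "gs ! k = (i, j)" by fastforce
  ultimately show ?thesis using comparator_circuit_nth(3)[OF circuit assms] by simp
qed

text \<open>The matched top nodes after the bottom nodes below \<open>Suc k * m + c\<close>: with \<open>i\<close> and \<open>j\<close> the
  wires of gate \<open>k\<close>, the first bottom node passed on by \<open>i\<close> or \<open>j\<close> takes the node of \<open>j\<close> and
  the second one that of \<open>i\<close>.\<close>

definition invar :: "nat \<Rightarrow> nat \<Rightarrow> nat set \<Rightarrow> bool" where
  "invar k c T \<longleftrightarrow>
     (let i = fst (gs ! k); j = snd (gs ! k) in
      (\<forall>w<m. c \<le> w \<longrightarrow> (node k w \<in> T \<longleftrightarrow> wire k w)) \<and>
      (\<forall>l w. Suc k < l \<longrightarrow> w < m \<longrightarrow> node l w \<notin> T) \<and>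
      (\<forall>w<m. w \<noteq> i \<longrightarrow> w \<noteq> j \<longrightarrow> (node (Suc k) w \<in> T \<longleftrightarrow> w < c \<and> wire k w)) \<and>
      (node (Suc k) j \<in> T \<longleftrightarrow> (i < c \<and> wire k i) \<or> (j < c \<and> wire k j)) \<and>
      (node (Suc k) i \<in> T \<longleftrightarrow> (i < c \<and> wire k i) \<and> (j < c \<and> wire k j)))"

text \<open>Every bottom node of a layer finds a partner, so a step adds exactly one top node. The
  auxiliary fact \<open>conclude\<close> reduces the new invariant to the effect of that
  node.\<close>

lemma invar_step:
  assumes k: "k < length gs" and c: "c < m" and inv: "invar k c (matched (Suc k * m + c))"
  shows "invar k (Suc c) (matched (Suc k * m + Suc c))"
proof -
  let ?b = "Suc k * m + c"
  let ?T = "matched ?b"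
  define i where "i = fst (gs ! k)"
  define j where "j = snd (gs ! k)"
  have ij: "i < m" "j < m" "i \<noteq> j"
    unfolding i_def j_def using comparator_circuit_nth[OF circuit k] by auto
  have I: "\<And>w. w < m \<Longrightarrow> c \<le> w \<Longrightarrow> node k w \<in> ?T \<longleftrightarrow> wire k w"
    "\<And>l w. Suc k < l \<Longrightarrow> w < m \<Longrightarrow> node l w \<notin> ?T"
    "\<And>w. w < m \<Longrightarrow> w \<noteq> i \<Longrightarrow> w \<noteq> j \<Longrightarrow> node (Suc k) w \<in> ?T \<longleftrightarrow> w < c \<and> wire k w"
    "node (Suc k) j \<in> ?T \<longleftrightarrow> (i < c \<and> wire k i) \<or> (j < c \<and> wire k j)"
    "node (Suc k) i \<in> ?T \<longleftrightarrow> (i < c \<and> wire k i) \<and> (j < c \<and> wire k j)"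
    using inv unfolding invar_def i_def[symmetric] j_def[symmetric] Let_def by blast+
  have link: "linked k c w \<longleftrightarrow> w = c \<or> (c \<in> {i, j} \<and> w \<in> {i, j})" for w
    unfolding linked_def i_def j_def by blast
  note E = edge_layer[OF k c]
  have lt: "node k c < node (Suc k) w" if "w < m" for w
    using node_less[OF c that] by simp
  have ltij: "node (Suc k) j < node (Suc k) i"
    unfolding i_def j_def by (rule node_snd_less_fst[OF k])
  have conclude: "invar k (Suc c) (insert (node l v) ?T)"
    if "v < m" and
      other: "\<And>w. w < m \<Longrightarrow> w \<noteq> i \<Longrightarrow> w \<noteq> j \<Longrightarrow> (l = Suc k \<and> v = w) \<or> (w < c \<and> wire k w) \<longleftrightarrow> w < Suc c \<and> wire k w"
      and new_j: "(l = Suc k \<and> v = j) \<or> node (Suc k) j \<in> ?T \<longleftrightarrow> (i < Suc c \<and> wire k i) \<or> (j < Suc c \<and> wire k j)"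
      and new_i: "(l = Suc k \<and> v = i) \<or> node (Suc k) i \<in> ?T \<longleftrightarrow> (i < Suc c \<and> wire k i) \<and> (j < Suc c \<and> wire k j)"
      and "l = Suc k \<or> (l = k \<and> v = c)" for l v
  proof -
    have ins: "node l' w \<in> insert (node l v) ?T \<longleftrightarrow> (l = l' \<and> v = w) \<or> node l' w \<in> ?T" if "w < m" for l' w
      using node_inject[OF that \<open>v < m\<close>] by auto
    show ?thesis
      unfolding invar_def i_def[symmetric] j_def[symmetric] Let_def
    proof (intro conjI allI impI)
      show "node k w \<in> insert (node l v) ?T \<longleftrightarrow> wire k w" if "w < m" "Suc c \<le> w" for w
        using ins[OF that(1), of k] I(1)[of w] that \<open>l = Suc k \<or> (l = k \<and> v = c)\<close> by auto
      show "node l' w \<notin> insert (node l v) ?T" if "Suc k < l'" "w < m" for l' w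
        using ins[OF that(2), of l'] I(2)[OF that] that(1) \<open>l = Suc k \<or> (l = k \<and> v = c)\<close> by auto
      show "node (Suc k) w \<in> insert (node l v) ?T \<longleftrightarrow> w < Suc c \<and> wire k w"
        if "w < m" "w \<noteq> i" "w \<noteq> j" for w
        using ins[OF that(1), of "Suc k"] I(3)[OF that] other[OF that] by simp
    qed (simp_all only: ins ij new_j new_i)
  qed
  have "invar k (Suc c) (matched (Suc ?b))"
  proof (cases "wire k c")
    \<comment> \<open>The wire carries 0: its node is still free and, lying in the earlier layer, is
      the least neighbour.\<close>
    case False
    have new: "matched (Suc ?b) = insert (node k c) ?T"
    proof (rule matched_Suc_min)
      show "node k c \<notin> ?T" using I(1)[OF c] False by simp
      show "node k c \<le> v" if "edge ?b v" for v
        using that lt unfolding E by (auto intro: less_imp_le)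
    qed (simp only: E simp_thms)
    show ?thesis
      unfolding new by (rule conclude) (use False I(4,5) c in \<open>auto simp: less_Suc_eq\<close>)
  next
    case val: True
    then have T: "node k c \<in> ?T" using I(1)[OF c] by simp
    show ?thesis
    proof (cases "c \<in> {i, j}")
      \<comment> \<open>A wire that gate \<open>k\<close> does not touch hands its 1 on to its own
        node of the next layer.\<close>
      case False
      have new: "matched (Suc ?b) = insert (node (Suc k) c) ?T"
      proof (rule matched_Suc_min)
        show "edge ?b (node (Suc k) c)" unfolding E link using c by blast
        show "node (Suc k) c \<notin> ?T" using I(3)[OF c] False by simp
        show "node (Suc k) c \<le> v" if "edge ?b v" "v \<notin> ?T" for v
          using that T False unfolding E link by auto
      qed
      show ?thesis
        unfolding new by (rule conclude) (use False val I(4,5) c in \<open>auto simp: less_Suc_eq\<close>)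
    next
      case True
      have iT: "node (Suc k) i \<notin> ?T" using I(5) True by auto
      show ?thesis
      proof (cases "node (Suc k) j \<in> ?T")
        \<comment> \<open>The first 1 to arrive at the gate makes the disjunction true; the node of
          \<open>j\<close> is the least free neighbour.\<close>
        case jT: False
        have new: "matched (Suc ?b) = insert (node (Suc k) j) ?T"
        proof (rule matched_Suc_min)
          show "edge ?b (node (Suc k) j)" unfolding E link using True ij by blast
          show "node (Suc k) j \<le> v" if "edge ?b v" "v \<notin> ?T" for v
            using that T True ltij unfolding E link by auto
        qed (rule jT)
        show ?thesis
          unfolding new by (rule conclude) (use True val jT iT I(4,5) c ij in \<open>auto simp: less_Suc_eq\<close>)
      next
        \<comment> \<open>The other wire of the gate has already taken the node of \<open>j\<close>,
          so both carry 1 and the conjunction is true as well.\<close>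
        case jT: True
        have new: "matched (Suc ?b) = insert (node (Suc k) i) ?T"
        proof (rule matched_Suc_min)
          show "edge ?b (node (Suc k) i)" unfolding E link using True ij by blast
          show "node (Suc k) i \<le> v" if "edge ?b v" "v \<notin> ?T" for v
            using that T jT True unfolding E link by auto
        qed (rule iT)
        show ?thesis
          unfolding new by (rule conclude) (use True val jT iT I(4,5) c ij in \<open>auto simp: less_Suc_eq\<close>)
      qed
    qed
  qed
  then show ?thesis by simp
qed

text \<open>That all later layers are still free is what the induction needs on entering the next
  layer.\<close>

lemma matched_layer:
  "k \<le> length gs \<Longrightarrow> (\<forall>w<m. node k w \<in> matched (Suc k * m) \<longleftrightarrow> wire k w) \<and>
     (\<forall>l w. k < l \<longrightarrow> w < m \<longrightarrow> node l w \<notin> matched (Suc k * m))"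
proof (induction k)
  case 0
  have "node l w \<notin> matched m" if "0 < l" "w < m" for l w
  proof -
    have "1 * (2 * m) \<le> l * (2 * m)" using that(1) by (intro mult_le_mono1) simp
    then have "m < node l w" using node_bounds(1)[OF that(2), of l] that(2) by linarith
    then show ?thesis by (simp add: matched_inputs)
  qed
  then show ?case by (simp add: node_0 matched_inputs wire_def comparator_run_def)
next
  case (Suc k)
  then have k: "k < length gs" by simp
  note ij = comparator_circuit_nth[OF circuit k]
  have "invar k c (matched (Suc k * m + c))" if "c \<le> m" for c
    using that
  proof (induction c)
    case 0
    show ?case using Suc.IH k ij unfolding invar_def Let_def by simp
  next
    case (Suc c)
    then show ?case using invar_step[OF k, of c] by simp
  qed
  from this[OF order_refl] have "invar k m (matched (Suc (Suc k) * m))" by (simp add: ac_simps)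
  then show ?case
    using ij unfolding invar_def Let_def wire_Suc[OF k] by auto
qed

lemma top_matched_node:
  assumes "w < m"
  shows "top_matched (Suc (length gs) * m) edges (node (length gs) w) \<longleftrightarrow> comparator_run gs (\<lambda>i. y ! i) w"
  using matched_layer[OF order_refl] assms by (simp add: matched_def top_matched_def wire_def)

section \<open>Size and degree of the constructed graph\<close>

lemma bipartite_edges: "bipartite_graph (Suc (length gs) * m) (Suc (length gs) * (2 * m)) edges"
proof -
  have node: "node k w < Suc (length gs) * (2 * m)" if "k \<le> length gs" "w < m" for k w
  proof -
    have "Suc k * (2 * m) \<le> Suc (length gs) * (2 * m)" using that(1) by (intro mult_le_mono1) simp
    then show ?thesis using node_bounds(2)[OF that(2), of k] by linarith
  qed
  have "b < Suc (length gs) * m \<and> u < Suc (length gs) * (2 * m)" if "edge b u" for b u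
    using that unfolding edge_def
  proof (elim disjE exE conjE)
    fix k w assume k: "k < length gs" and w: "w < m" and b: "b = Suc k * m + w"
    have b': "b < Suc (length gs) * m" unfolding b using k w by (intro radix_less) simp_all
    show ?thesis if "u = node k w" using b' that k w node by simp
    show ?thesis if "w' < m" "u = node (Suc k) w'" for w' using b' that k node by simp
  qed (use node[of 0] in \<open>auto simp: node_0\<close>)
  then show ?thesis unfolding bipartite_graph_def edges_def by auto
qed

text \<open>A bottom node after the inputs sees its own node and at most two of the next layer. A
  top node is reached by its own bottom node and, from the layer before, by at most two linked
  wires, or in layer 0 by an input.\<close>

lemma degree_edges: "max_degree_le 3 (Suc (length gs) * m) (Suc (length gs) * (2 * m)) edges"
proof -
  have le3: "card A \<le> 3" if "A \<subseteq> {a, b, c}" for A :: "nat set" and a b c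
  proof -
    have "card A \<le> card {a, b, c}" using that by (intro card_mono) auto
    also have "\<dots> \<le> 3" by (simp add: card_insert_if)
    finally show ?thesis .
  qed
  have "card {u. edge b u} \<le> 3" if b_less: "b < Suc (length gs) * m" for b
  proof -
    obtain a c where a: "a < Suc (length gs)" and c: "c < m" and b: "b = a * m + c"
      using b_less by (rule radix_cases)
    show ?thesis
    proof (cases a)
      case 0
      then have "{u. edge b u} \<subseteq> {b, b, b}" using b c by (auto simp: edge_first node_0)
      then show ?thesis by (rule le3)
    next
      case (Suc k)
      have k: "k < length gs" using a Suc by simp
      note E = edge_layer[OF k c]
      show ?thesis
      proof (cases "c \<in> {fst (gs ! k), snd (gs ! k)}")
        case True
        have "{u. edge b u} \<subseteq> {node k c, node (Suc k) (fst (gs ! k)), node (Suc k) (snd (gs ! k))}"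
          unfolding b Suc E linked_def using True by auto
        then show ?thesis by (rule le3)
      next
        case False
        have "{u. edge b u} \<subseteq> {node k c, node (Suc k) c, node (Suc k) c}"
          unfolding b Suc E linked_def using False by auto
        then show ?thesis by (rule le3)
      qed
    qed
  qed
  moreover have "card {b. edge b u} \<le> 3" for u
  proof (cases "\<exists>k w. w < m \<and> u = node k w")
    case True
    then obtain k w where w: "w < m" and u: "u = node k w" by blast
    have cases: "b = Suc k * m + w \<or> (k = 0 \<and> b = w) \<or> (\<exists>k' w'. k = Suc k' \<and> linked k' w' w \<and> b = k * m + w')"
      if "edge b u" for b
      using that unfolding edge_def
    proof (elim disjE exE conjE)
      assume "b < m" "u = b"
      then have "k = 0 \<and> w = b" using u node_inject[OF w \<open>b < m\<close>, of k 0] by (simp add: node_0)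
      then show ?thesis by simp
    next
      fix k' w' assume "w' < m" "b = Suc k' * m + w'" "u = node k' w'"
      then show ?thesis using node_inject[OF w \<open>w' < m\<close>, of k k'] u by simp
    next
      fix k' w' w'' assume "b = Suc k' * m + w'" "w'' < m" "linked k' w' w''" "u = node (Suc k') w''"
      then have "k = Suc k' \<and> linked k' w' w \<and> b = k * m + w'"
        using node_inject[OF w \<open>w'' < m\<close>, of k "Suc k'"] u by simp
      then show ?thesis by blast
    qed
    show ?thesis
    proof (cases k)
      case 0
      have "{b. edge b u} \<subseteq> {Suc k * m + w, w, w}"
      proof
        fix b assume "b \<in> {b. edge b u}"
        then show "b \<in> {Suc k * m + w, w, w}" using cases[of b] 0 by auto
      qed
      then show ?thesis by (rule le3)
    next
      case (Suc k')
      show ?thesis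
      proof (cases "w \<in> {fst (gs ! k'), snd (gs ! k')}")
        case True
        have "{b. edge b u} \<subseteq> {Suc k * m + w, k * m + fst (gs ! k'), k * m + snd (gs ! k')}"
        proof
          fix b assume "b \<in> {b. edge b u}"
          then show "b \<in> {Suc k * m + w, k * m + fst (gs ! k'), k * m + snd (gs ! k')}"
            using cases[of b] Suc True unfolding linked_def by auto
        qed
        then show ?thesis by (rule le3)
      next
        case False
        have "{b. edge b u} \<subseteq> {Suc k * m + w, k * m + w, k * m + w}"
        proof
          fix b assume "b \<in> {b. edge b u}"
          then show "b \<in> {Suc k * m + w, k * m + w, k * m + w}"
            using cases[of b] Suc False unfolding linked_def by auto
        qed
        then show ?thesis by (rule le3)
      qed
    qed
  next
    \<comment> \<open>Slots that hold no node of a wire are isolated.\<close>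
    case False
    have "\<not> edge b u" for b
    proof
      assume "edge b u"
      then show False unfolding edge_def
      proof (elim disjE exE conjE)
        assume "b < m" "u = b"
        then have "b < m \<and> u = node 0 b" by (simp add: node_0)
        then show False using False by blast
      qed (use False in blast)+
    qed
    then show ?thesis by simp
  qed
  ultimately show ?thesis unfolding max_degree_le_def edges_def by simp
qed

end

text \<open>The number of a node depends on bits of the code, so it is not a term in the parameters;
  its graph replaces the function \<open>node\<close>. The bounded quantifier over \<open>k'\<close>
  names the predecessor of \<open>k\<close>.\<close>

definition ccv_node :: "bool list \<Rightarrow> nat \<Rightarrow> nat \<Rightarrow> nat \<Rightarrow> nat \<Rightarrow> bool" where
  "ccv_node x m k w u \<longleftrightarrow>
     (let A = \<exists>k'<k. k = Suc k' \<and> ccv_first x m k' w in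
      (A \<and> u = k * (2 * m) + (m + w)) \<or> (\<not> A \<and> u = k * (2 * m) + w))"

definition ccv_linked :: "bool list \<Rightarrow> nat \<Rightarrow> nat \<Rightarrow> nat \<Rightarrow> nat \<Rightarrow> bool" where
  "ccv_linked x m k w w' \<longleftrightarrow> w = w' \<or>
     ((ccv_first x m k w \<or> ccv_second x m k w) \<and> (ccv_first x m k w' \<or> ccv_second x m k w'))"

definition ccv_edge :: "bool list \<Rightarrow> nat \<Rightarrow> nat \<Rightarrow> nat \<Rightarrow> nat \<Rightarrow> bool" where
  "ccv_edge x m l b u \<longleftrightarrow> (b < m \<and> bit_at x (m + 1 + b) \<and> u = b) \<or>
     (\<exists>k<l. \<exists>w<m. b = Suc k * m + w \<and>
       (ccv_node x m k w u \<or> (\<exists>w'<m. ccv_linked x m k w w' \<and> ccv_node x m (Suc k) w' u)))"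

lemma fo_ccv_node: "fo (\<lambda>x e. ccv_node x (var 0 e) (var 1 e) (var 2 e) (var 3 e))"
  unfolding ccv_node_def Let_def by (intro fo_ccv_first fo_intros)

lemma fo_ccv_linked: "fo (\<lambda>x e. ccv_linked x (var 0 e) (var 1 e) (var 2 e) (var 3 e))"
  unfolding ccv_linked_def by (intro fo_ccv_first fo_ccv_second fo_intros)

lemma fo_ccv_edge: "fo (\<lambda>x e. ccv_edge x (var 0 e) (var 1 e) (var 2 e) (var 3 e))"
  unfolding ccv_edge_def
  by (intro fo_app4[OF fo_ccv_node] fo_app4[OF fo_ccv_linked] fo_bit_at fo_intros)

context layered_graph
begin

lemma ccv_node_code:
  assumes "v < m" "w < m" "k \<le> length gs"
  shows "ccv_node (ccv_code m gs y v) m k w u \<longleftrightarrow> u = node k w"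
proof (cases k)
  case (Suc k')
  then have "(\<exists>i<k. k = Suc i \<and> ccv_first (ccv_code m gs y v) m i w) \<longleftrightarrow> w = fst (gs ! k')"
    using ccv_parse_code(2)[OF circuit length_y assms(1), of k' w] assms by auto
  then show ?thesis unfolding ccv_node_def Let_def node_def using Suc by simp
qed (simp add: ccv_node_def node_def)

lemma ccv_linked_code:
  assumes "v < m" "w < m" "w' < m" "k < length gs"
  shows "ccv_linked (ccv_code m gs y v) m k w w' \<longleftrightarrow> linked k w w'"
  unfolding ccv_linked_def linked_def
  using ccv_parse_code(2,3)[OF circuit length_y assms(1,4)] assms(2,3) by simp

lemma ccv_edge_code:
  assumes "v < m"
  shows "ccv_edge (ccv_code m gs y v) m (length gs) b u \<longleftrightarrow> edge b u"
  unfolding ccv_edge_def edge_def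
  using ccv_parse_code(4)[OF circuit length_y assms] ccv_node_code[OF assms] ccv_linked_code[OF assms]
  by (simp cong: conj_cong)

end

lemma ccv_parse_unique:
  assumes "ccv_parse x m l w" "ccv_parse x m' l' w'"
  shows "m = m' \<and> l = l' \<and> w = w'"
proof -
  obtain gs y where 1: "comparator_circuit m gs" "length y = m" "w < m" "length gs = l" "x = ccv_code m gs y w"
    using assms(1) by (rule ccv_parseE)
  obtain gs' y' where 2: "comparator_circuit m' gs'" "length y' = m'" "w' < m'" "length gs' = l'"
    "x = ccv_code m' gs' y' w'"
    using assms(2) by (rule ccv_parseE)
  have "ccv_code m gs y w = ccv_code m' gs' y' w'" using 1(5) 2(5) by simp
  from ccv_code_inject[OF this 1(1-3) 2(1-3)] show ?thesis using 1(4) 2(4) by blast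
qed

lemma fo_reducible_Ccv_three_vLfmm: "fo_reducible Ccv three_vLfmm"
proof -
  let ?M = "\<lambda>m l. Suc l * m" and ?N = "\<lambda>m l. Suc l * (2 * m)"
  let ?E = "\<lambda>x m l. {(b, u). ccv_edge x m l b u}"
  \<comment> \<open>Strings offer only the relation \<open>ccv_node\<close>, so the designated top
    node is given by a definite description; it is the node of wire \<open>w\<close> in the last
    layer.\<close>
  obtain F where F: "\<And>x m l w. ccv_parse x m l w \<Longrightarrow>
      F x = lfmm_code (?M m l) (?N m l) (?E x m l) (THE t. ccv_node x m l w t)"
    and F_Nil: "\<And>x. (\<And>m l w. \<not> ccv_parse x m l w) \<Longrightarrow> F x = []"
    using parse_function[of ccv_parse "\<lambda>x m l w. lfmm_code (?M m l) (?N m l) (?E x m l) (THE t. ccv_node x m l w t)"]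
      ccv_parse_unique by blast
  have graph: "\<exists>gs y. layered_graph m gs y \<and> length gs = l \<and> w < m \<and> x = ccv_code m gs y w \<and>
      ?E x m l = layered_graph.edges m gs y \<and> (\<forall>t. ccv_node x m l w t \<longleftrightarrow> t = layered_graph.node m gs l w)"
    if parse: "ccv_parse x m l w" for x m l w
  proof -
    obtain gs y where *: "comparator_circuit m gs" "length y = m" "w < m" "length gs = l" "x = ccv_code m gs y w"
      using parse by (rule ccv_parseE)
    then interpret layered_graph m gs y by unfold_locales
    have "?E x m l = edges"
      unfolding edges_def *(5) *(4)[symmetric] by (simp only: ccv_edge_code[OF *(3)])
    moreover have "ccv_node x m l w t \<longleftrightarrow> t = node l w" for t
      unfolding *(5) by (rule ccv_node_code) (use * in auto)
    ultimately show ?thesis using * layered_graph_axioms by blast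
  qed
  let ?len = "\<lambda>m l. ?M m l + ?N m l + 2 + ?N m l + ?M m l * ?N m l"
  let ?bits = "\<lambda>x m l w p. p < ?M m l \<or> (\<exists>i<?N m l. p = ?M m l + 1 + i) \<or>
    (\<exists>t<?N m l. ccv_node x m l w t \<and> p = ?M m l + ?N m l + 2 + t) \<or>
    (\<exists>b<?M m l. \<exists>u<?N m l. p = ?M m l + ?N m l + 2 + ?N m l + (b * ?N m l + u) \<and> ccv_edge x m l b u)"
  have node_less: "layered_graph.node m gs (length gs) w < ?N m (length gs)"
    if "layered_graph m gs y" "w < m" for m gs y w
    using layered_graph.node_bounds(2)[OF that] .
  have "fo_fun F"
  proof (rule fo_fun_parse[where parse = ccv_parse and len = "\<lambda>x m l w. ?len m l" and bits = ?bits,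
        OF fo_ccv_parse ccv_parse_le])
    show "poly_fun (\<lambda>x e. ?len (var 0 e) (var 1 e))" by (intro poly_fun_intros)
    show "fo (\<lambda>x e. ?bits x (var 0 e) (var 1 e) (var 2 e) (var 3 e))"
      by (intro fo_app4[OF fo_ccv_node] fo_app4[OF fo_ccv_edge] fo_intros)
    show "length (F x) = ?len m l" if "ccv_parse x m l w" for x m l w
      unfolding F[OF that] length_lfmm_code ..
    show "F x ! p = ?bits x m l w p" if parse: "ccv_parse x m l w" and p: "p < ?len m l" for x m l w p
    proof -
      obtain gs y where g: "layered_graph m gs y" "length gs = l" "w < m"
        "\<forall>t. ccv_node x m l w t \<longleftrightarrow> t = layered_graph.node m gs l w"
        using graph[OF parse] by blast
      let ?t = "layered_graph.node m gs l w"
      have t: "(THE t. ccv_node x m l w t) = ?t" using g(4) by simp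
      have less: "?t < ?N m l" using node_less[OF g(1,3)] unfolding g(2) .
      have "(\<exists>t<?N m l. ccv_node x m l w t \<and> p = ?M m l + ?N m l + 2 + t) \<longleftrightarrow> p = ?M m l + ?N m l + 2 + ?t"
        using g(4) less by (auto simp del: mult_Suc mult_Suc_right add_2_eq_Suc')
      then show ?thesis
        unfolding F[OF parse] t lfmm_code_bit[OF less p] by (simp only: mem_Collect_eq prod.case)
    qed
    show "F x = []" if "\<And>m l w. \<not> ccv_parse x m l w" for x
      by (rule F_Nil) (rule that)
  qed
  moreover have "x \<in> Ccv \<longleftrightarrow> F x \<in> three_vLfmm" for x
  proof (cases "\<exists>m l w. ccv_parse x m l w")
    case True
    then obtain m l w where p: "ccv_parse x m l w" by blast
    obtain gs y where g: "layered_graph m gs y" "length gs = l" "w < m" "x = ccv_code m gs y w"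
      "?E x m l = layered_graph.edges m gs y" "\<forall>t. ccv_node x m l w t \<longleftrightarrow> t = layered_graph.node m gs l w"
      using graph[OF p] by blast
    interpret layered_graph m gs y by (rule g(1))
    have t: "(THE t. ccv_node x m l w t) = node l w" using g(6) by simp
    have "x \<in> Ccv \<longleftrightarrow> comparator_run gs (\<lambda>i. y ! i) w"
      unfolding g(4) by (rule ccv_code_Ccv_iff[OF circuit length_y g(3)])
    moreover have "F x \<in> three_vLfmm \<longleftrightarrow> comparator_run gs (\<lambda>i. y ! i) w"
    proof -
      have "lfmm_code (?M m (length gs)) (?N m (length gs)) edges (node (length gs) w) \<in> three_vLfmm \<longleftrightarrow>
          comparator_run gs (\<lambda>i. y ! i) w"
        unfolding lfmm_code_vLfmm_iff(2)[OF bipartite_edges node_bounds(2)[OF g(3)]]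
        using degree_edges top_matched_node[OF g(3)] by blast
      then show ?thesis unfolding F[OF p] t g(2,5) .
    qed
    ultimately show ?thesis by blast
  next
    case False
    then have "F x = []" using F_Nil by blast
    then show ?thesis using not_ccv_parse_Ccv[of x] False Nil_not_instance by metis
  qed
  ultimately show ?thesis unfolding fo_reducible_def by blast
qed

theorem theorem32:
  "Ccv \<equiv>\<^sub>A\<^sub>C\<^sub>0 three_vLfmm \<and> three_vLfmm \<equiv>\<^sub>A\<^sub>C\<^sub>0 vLfmm \<and> Ccv \<equiv>\<^sub>A\<^sub>C\<^sub>0 vLfmm"
proof -
  note 1 = fo_reducible_Ccv_three_vLfmm and 2 = fo_reducible_three_vLfmm_vLfmm
    and 3 = fo_reducible_vLfmm_Ccv
  show ?thesis
    unfolding AC0_equivalent_def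
    by (intro conjI fo_reducible_AC0 1 2 3 fo_reducible_trans[OF 1 2] fo_reducible_trans[OF 2 3]
        fo_reducible_trans[OF 3 1])
qed

end
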